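(* Assume $d\ge3$ and $V=0$. Then $\mathcal{T}(W_0)<\infty$ for every nonzero initial condition $W_0=(w_0,\dot w_0)$ satisfying one of the following: (i) $w_0=0$ and $\dot w_0\in H^s(\mathbb{T}^d)$ for some $s>\frac d2-1$, with $\dot w_0\ge0$ a.e. on $\mathbb{T}^d$ (or $\dot w_0\le0$ a.e.); (ii) $W_0\in H^1\times L^2(\mathbb{T}^d)$, $Z(w_0)=Z(W_0)$ and $Z(W_0)$ is closed; (iii) $W_0\in H^1\times H^1(\mathbb{T}^d)$ and $Z(W_0)$ is closed. Moreover, when $d=3$, statements (ii) and (iii) hold without the closedness assumption on $Z(W_0)$.
   Context: Setting: $d\ge 1$ is an integer, $\mathbb{T}^d=\mathbb{R}^d/2\pi\mathbb{Z}^d$; all functions are real-valued. Control potentials: $V_0(x)=1$, $V_{2j-1}(x)=\sin(x_j)$, $V_{2j}(x)=\cos(x_j)$ for $j=1,\dots,d$. On $H^1\times L^2(\mathbb{T}^d)$, equipped with the norm $\|(w_1,w_2)\|^2=\int_{\mathbb{T}^d}(|\nabla w_1|^2+|w_1|^2+|w_2|^2)$, consider $A=\begin{pmatrix}0&1\\ \Delta-1&0\end{pmatrix}$ (domain $H^2\times H^1$), generating a group $(e^{tA})$ of isometries, and $B=\begin{pmatrix}0&0\\1&0\end{pmatrix}$. For a bounded operator $L$ on $H^1\times L^2$, $\exp(t(A+L))W_0$ is the unique $W\in C^0(\mathbb{R},H^1\times L^2)$ with $W(t)=e^{tA}W_0+\int_0^te^{(t-s)A}LW(s)\,ds$. The control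 system is $\frac{dW}{dt}=\big(A+VB+\sum_{j=0}^{2d}u_j(t)V_jB\big)W$ (here with $V=0$); for piecewise constant $u:[0,T]\to\mathbb{R}^{2d+1}$, $W(t;u,W_0)$ is the solution with $W(0)=W_0$. A target $W_f$ is approximately reachable in time $T^+$ from $W_0$ if for every $\epsilon>0$ there exist $T_1\in[T,T+\epsilon]$ and piecewise constant $u:[0,T_1]\to\mathbb{R}^{2d+1}$ with $\|W(T_1;u,W_0)-W_f\|<\epsilon$; the system is approximately controllable in time $T^+$ from $W_0$ if every target in $H^1\times L^2$ is so; $\mathcal{T}(W_0)$ is the infimum of such $T\ge0$ ($+\infty$ if none). For $f\in L^2(\mathbb{T}^d,\mathbb{R}^n)$, $Z(f)=f^{-1}(\{0\})$ (up to null sets); "$Z(f)$ is closed" means some representative of $f$ has a closed zero set; $Z(W_0)$ is the common zero set of $w_0,\dot w_0$. *)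

theory Defs
  imports "HOL-Analysis.Analysis"
begin

text \<open>Functions on the torus T^d = R^d / 2 pi Z^d are represented by real-valued
  functions on real^'d that are 2 pi-periodic in every coordinate.
  The dimension d is CARD('d).\<close>

definition periodic_T :: "(real^'d \<Rightarrow> real) \<Rightarrow> bool" where
  "periodic_T f \<longleftrightarrow> (\<forall>x i. f (x + (2*pi) *\<^sub>R axis i 1) = f x)"

definition tcube :: "(real^'d) set" where
  "tcube = {x. \<forall>i. 0 \<le> x$i \<and> x$i \<le> 2*pi}"

definition L2T :: "(real^'d \<Rightarrow> real) \<Rightarrow> bool" where
  "L2T f \<longleftrightarrow> periodic_T f \<and> f \<in> borel_measurable lebesgue
     \<and> set_integrable lebesgue tcube (\<lambda>x. (f x)^2)"

definition kdot :: "int^'d \<Rightarrow> real^'d \<Rightarrow> real" where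
  "kdot k x = (\<Sum>i\<in>UNIV. real_of_int (k$i) * x$i)"

definition ksq :: "int^'d \<Rightarrow> real" where
  "ksq k = (\<Sum>i\<in>UNIV. (real_of_int (k$i))^2)"

definition fcoef :: "(real^'d \<Rightarrow> real) \<Rightarrow> int^'d \<Rightarrow> complex" where
  "fcoef f k = complex_of_real (1 / (2*pi) ^ CARD('d)) *
     (LINT x:tcube|lebesgue. complex_of_real (f x) * cis (- kdot k x))"

definition sob_weight :: "real \<Rightarrow> (real^'d \<Rightarrow> real) \<Rightarrow> int^'d \<Rightarrow> real" where
  "sob_weight s f k = (1 + ksq k) powr s * (cmod (fcoef f k))^2"

definition HsT :: "real \<Rightarrow> (real^'d \<Rightarrow> real) \<Rightarrow> bool" where
  "HsT s f \<longleftrightarrow> L2T f \<and> (sob_weight s f) summable_on UNIV"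

type_synonym 'd state = "(real^'d \<Rightarrow> real) \<times> (real^'d \<Rightarrow> real)"

definition H1L2 :: "('d::finite) state \<Rightarrow> bool" where
  "H1L2 W \<longleftrightarrow> HsT 1 (fst W) \<and> L2T (snd W)"

text \<open>The norm  (int |grad w1|^2 + |w1|^2 + |w2|^2)^(1/2), written via Parseval.\<close>
definition snorm :: "('d::finite) state \<Rightarrow> real" where
  "snorm W = sqrt ((2*pi) ^ CARD('d) *
      ((\<Sum>\<^sub>\<infinity>k. sob_weight 1 (fst W) k) + (\<Sum>\<^sub>\<infinity>k. sob_weight 0 (snd W) k)))"

definition sdiff :: "('d::finite) state \<Rightarrow> ('d::finite) state \<Rightarrow> ('d::finite) state" where
  "sdiff W W' = ((\<lambda>x. fst W x - fst W' x), (\<lambda>x. snd W x - snd W' x))"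

text \<open>A control value c = (u_0, (u_{2j-1})_j, (u_{2j})_j) gives the potential
  sum_j u_j V_j = u_0 + sum_j (u_{2j-1} sin x_j + u_{2j} cos x_j).\<close>
type_synonym 'd control = "real \<times> (real^'d) \<times> (real^'d)"

definition qpot :: "('d::finite) control \<Rightarrow> real^'d \<Rightarrow> real" where
  "qpot c x = fst c + (\<Sum>j\<in>UNIV. (fst (snd c))$j * sin (x$j) + (snd (snd c))$j * cos (x$j))"

definition lamk :: "int^'d \<Rightarrow> real" where
  "lamk k = sqrt (1 + ksq k)"

text \<open>exp(t(A+L))W0 with L W = (0, q w1): the unique continuous W with
  W(t) = e^{tA} W0 + int_0^t e^{(t-s)A} L W(s) ds.  The group e^{tA} acts diagonally
  on Fourier modes (rotation with frequency lamk k); the identity is stated on every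
  Fourier coefficient, which determines the element of H^1 x L^2.\<close>
definition mild_sol :: "(real^'d \<Rightarrow> real) \<Rightarrow> ('d::finite) state \<Rightarrow> (real \<Rightarrow> ('d::finite) state) \<Rightarrow> bool" where
  "mild_sol q W0 W \<longleftrightarrow>
     (\<forall>t. H1L2 (W t)) \<and>
     (\<forall>t. ((\<lambda>s. snorm (sdiff (W s) (W t))) \<longlongrightarrow> 0) (at t)) \<and>
     (\<forall>t k. let l = lamk k;
                 a = fcoef (fst W0) k; b = fcoef (snd W0) k;
                 g = (\<lambda>s. fcoef (\<lambda>x. q x * fst (W s) x) k) in
        fcoef (fst (W t)) k =
          complex_of_real (cos (l*t)) * a + complex_of_real (sin (l*t) / l) * b
          + (CLBINT s=0..t. complex_of_real (sin (l*(t-s)) / l) * g s)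
      \<and> fcoef (snd (W t)) k =
          complex_of_real (- l * sin (l*t)) * a + complex_of_real (cos (l*t)) * b
          + (CLBINT s=0..t. complex_of_real (cos (l*(t-s))) * g s))"

text \<open>A piecewise constant control on [0,T1] is a finite list of pieces (duration, value).
  evolve p W0 W: W is the state at the final time starting from W0.\<close>
fun evolve :: "(real \<times> ('d::finite) control) list \<Rightarrow> ('d::finite) state \<Rightarrow> ('d::finite) state \<Rightarrow> bool" where
  "evolve [] W0 W \<longleftrightarrow> W = W0"
| "evolve ((\<tau>, c) # p) W0 W \<longleftrightarrow>
     (\<exists>Wt. mild_sol (qpot c) W0 Wt \<and> evolve p (Wt \<tau>) W)"

definition approx_reach :: "real \<Rightarrow> ('d::finite) state \<Rightarrow> ('d::finite) state \<Rightarrow> bool" where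
  "approx_reach T W0 Wf \<longleftrightarrow>
     (\<forall>\<epsilon>>0. \<exists>T1 p W. T \<le> T1 \<and> T1 \<le> T + \<epsilon> \<and>
        (\<forall>x\<in>set p. fst x > 0) \<and> sum_list (map fst p) = T1 \<and>
        evolve p W0 W \<and> snorm (sdiff W Wf) < \<epsilon>)"

definition approx_ctrl :: "real \<Rightarrow> ('d::finite) state \<Rightarrow> bool" where
  "approx_ctrl T W0 \<longleftrightarrow> (\<forall>Wf. H1L2 Wf \<longrightarrow> approx_reach T W0 Wf)"

definition ctrl_time :: "('d::finite) state \<Rightarrow> ereal" where
  "ctrl_time W0 = Inf {ereal T | T. T \<ge> 0 \<and> approx_ctrl T W0}"

definition closed_zero_set :: "('d::finite) state \<Rightarrow> bool" where
  "closed_zero_set W \<longleftrightarrow> (\<exists>g1 g2. periodic_T g1 \<and> periodic_T g2 \<and>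
      (AE x in lebesgue. g1 x = fst W x) \<and> (AE x in lebesgue. g2 x = snd W x) \<and>
      closed {x. g1 x = 0 \<and> g2 x = 0})"

end

(* Large controls during short times act as impulses (w, v) -> (w, v + phi w) with phi in the span of
   1, sin x_j, cos x_j. Conjugating the flow by opposite impulses of size tau^(-1/2) for a time tau gives
   the impulse -phi^2, and since cos^2 + sin^2 = 1 this generates all trigonometric polynomials phi.
   Hence, from a state with w nonzero almost everywhere, every velocity is approximately reachable at
   once, and then, letting the wave equation act for a time delta with sin(|k| delta) nonzero for k <> 0,
   every target.

   It remains to reach a state with w nonzero almost everywhere. Alternating n times an impulse M and the
   wave flow S leads to a state that is a polynomial in M, with top coefficient (S^n) w. For large n its
   Fourier coefficients are summable. One last impulse M cos(l.x) or M sin(l.x) gives it a nonzero mean,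
   and the wave equation (u_0 = 1) makes the mean grow linearly in time while all other modes stay
   bounded: after a long time the top coefficient has no zero. For almost every M the state then has a
   null zero set. *)
theory Submission
  imports Defs
begin

section \<open>Hermitian square-summable families\<close>

text \<open>The dynamics lives on coefficient families in energy coordinates, where the free group
  is a bounded rotation. Functions return only for the one pointwise property that matters, being
  nonzero almost everywhere: it makes the multiples \<open>\<phi> w\<close> with trigonometric
  \<open>\<phi>\<close> dense in L2, so that impulses can set the velocity. Finite energy does not
  make Fourier coefficients absolutely summable, so a large mean alone would not keep a function
  away from zero. Hence the parameter \<open>M\<close>: a polynomial in \<open>M\<close> with
  nonzero top coefficient has few roots, and only this coefficient has to be made regular. Each
  round applies the propagator \<open>wS\<close> to it, which gains one derivative, and d rounds
  suffice because the sum of (1 + |k|^2)^(-d) over the lattice is finite. In the bracket limit,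
  impulses of size \<open>s\<close> are a time \<open>\<tau>\<close> apart with s^2
  \<open>\<tau>\<close> = 1. The terms of order \<open>s\<close> cancel up to a null sequence
  because multiplication by \<open>\<phi>\<close> is bounded on H1 as well as on L2; this is why
  each multiplication operator comes with a second one. Every impulse costs a positive but
  arbitrarily small time, which the slack in \<open>reaches\<close> absorbs.\<close>

typedef (overloaded) ('d::finite) hl2 =
  "{a :: int^'d \<Rightarrow> complex. (\<forall>k. a (-k) = cnj (a k)) \<and> (\<lambda>k. (cmod (a k))^2) summable_on UNIV}"
  morphisms cf Hl2
  by (rule exI[of _ "\<lambda>_. 0"]) simp

setup_lifting type_definition_hl2

lemma cf_uminus: "cf a (-k) = cnj (cf a k)"
  using cf[of a] by auto

lemma cf_summable: "(\<lambda>k. (cmod (cf a k))^2) summable_on UNIV"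
  using cf[of a] by auto

lemma hl2_eqI: "(\<And>k. cf a k = cf b k) \<Longrightarrow> a = b"
  by (metis cf_inject ext)

lemma l2_summableI:
  fixes a :: "'i \<Rightarrow> complex"
  assumes "\<And>F. finite F \<Longrightarrow> (\<Sum>k\<in>F. (cmod (a k))^2) \<le> C"
  shows "(\<lambda>k. (cmod (a k))^2) summable_on UNIV"
  by (rule nonneg_bdd_above_summable_on) (use assms in \<open>auto simp: bdd_above_def\<close>)

lemma L2_set_le_add:
  fixes a b :: "'i \<Rightarrow> complex"
  shows "L2_set (\<lambda>k. cmod (a k + b k)) F \<le> L2_set (\<lambda>k. cmod (a k)) F + L2_set (\<lambda>k. cmod (b k)) F"
  by (rule order_trans[OF L2_set_mono L2_set_triangle_ineq]) (auto intro: norm_triangle_ineq)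

lemma l2_summable_add:
  fixes a b :: "'i \<Rightarrow> complex"
  assumes "(\<lambda>k. (cmod (a k))^2) summable_on UNIV" "(\<lambda>k. (cmod (b k))^2) summable_on UNIV"
  shows "(\<lambda>k. (cmod (a k + b k))^2) summable_on UNIV"
proof -
  have "(\<lambda>k. 2 * (cmod (a k))^2 + 2 * (cmod (b k))^2) summable_on UNIV"
    by (intro summable_on_add summable_on_cmult_right assms)
  then show ?thesis
  proof (rule summable_on_comparison_test)
    fix k
    have "(cmod (a k + b k))^2 \<le> (cmod (a k) + cmod (b k))^2"
      by (intro power_mono norm_triangle_ineq) auto
    also have "\<dots> \<le> 2 * (cmod (a k))^2 + 2 * (cmod (b k))^2"
      using sum_squares_bound[of "cmod (a k)" "cmod (b k)"] by (simp add: power2_sum)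
    finally show "(cmod (a k + b k))^2 \<le> 2 * (cmod (a k))^2 + 2 * (cmod (b k))^2" .
  qed auto
qed

instantiation hl2 :: (finite) real_vector
begin

lift_definition zero_hl2 :: "'a hl2" is "\<lambda>_. 0" by simp
lift_definition plus_hl2 :: "'a hl2 \<Rightarrow> 'a hl2 \<Rightarrow> 'a hl2" is "\<lambda>a b k. a k + b k"
  by (auto intro: l2_summable_add)
lift_definition uminus_hl2 :: "'a hl2 \<Rightarrow> 'a hl2" is "\<lambda>a k. - a k" by auto
lift_definition minus_hl2 :: "'a hl2 \<Rightarrow> 'a hl2 \<Rightarrow> 'a hl2" is "\<lambda>a b k. a k - b k"
  subgoal for a b using l2_summable_add[of a "\<lambda>k. - b k"] by auto
  done
lift_definition scaleR_hl2 :: "real \<Rightarrow> 'a hl2 \<Rightarrow> 'a hl2" is "\<lambda>r a k. of_real r * a k"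
  by (auto simp: norm_mult power_mult_distrib intro: summable_on_cmult_right)

instance
  by standard (transfer, simp add: algebra_simps)+

end

lemma cf_zero [simp]: "cf 0 k = 0" by transfer simp
lemma cf_add [simp]: "cf (a + b) k = cf a k + cf b k" by transfer simp
lemma cf_minus [simp]: "cf (a - b) k = cf a k - cf b k" by transfer simp
lemma cf_scaleR [simp]: "cf (r *\<^sub>R a) k = of_real r * cf a k" by transfer simp

lemma cf_sum: "cf (sum f A) k = (\<Sum>i\<in>A. cf (f i) k)"
  by (induction A rule: infinite_finite_induct) auto

instantiation hl2 :: (finite) real_normed_vector
begin

definition norm_hl2 :: "'a hl2 \<Rightarrow> real" where
  "norm_hl2 a = sqrt (\<Sum>\<^sub>\<infinity>k. (cmod (cf a k))^2)"
definition dist_hl2 :: "'a hl2 \<Rightarrow> 'a hl2 \<Rightarrow> real" where "dist_hl2 a b = norm (a - b)"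
definition sgn_hl2 :: "'a hl2 \<Rightarrow> 'a hl2" where "sgn_hl2 a = a /\<^sub>R norm a"
definition uniformity_hl2 :: "('a hl2 \<times> 'a hl2) filter" where
  "uniformity_hl2 = (INF e\<in>{0<..}. principal {(x, y). dist x y < e})"
definition open_hl2 :: "'a hl2 set \<Rightarrow> bool" where
  "open_hl2 U \<longleftrightarrow> (\<forall>x\<in>U. eventually (\<lambda>(x', y). x' = x \<longrightarrow> y \<in> U) uniformity)"

lemma hl2_norm_sq: "(norm a)^2 = (\<Sum>\<^sub>\<infinity>k. (cmod (cf a k))^2)" for a :: "'a hl2"
  unfolding norm_hl2_def by (simp add: infsum_nonneg)

lemma L2_set_le_norm: "finite F \<Longrightarrow> L2_set (\<lambda>k. cmod (cf a k)) F \<le> norm a" for a :: "'a hl2"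
  unfolding L2_set_def norm_hl2_def
  by (intro real_sqrt_le_mono finite_sum_le_infsum cf_summable) auto

text \<open>Passing through finite sets reduces the triangle inequality of the norm to the one of
  \<open>L2_set\<close>.\<close>

lemma hl2_norm_le_L2_set:
  fixes a :: "'a hl2"
  assumes "\<And>F. finite F \<Longrightarrow> L2_set (\<lambda>k. cmod (cf a k)) F \<le> C"
  shows "norm a \<le> C"
proof -
  have C0: "0 \<le> C" using assms[of "{}"] by simp
  have "(\<Sum>\<^sub>\<infinity>k. (cmod (cf a k))^2) \<le> C^2"
  proof (rule infsum_le_finite_sums[OF cf_summable])
    fix F :: "(int^'a) set" assume "finite F"
    from assms[OF this] have "(L2_set (\<lambda>k. cmod (cf a k)) F)^2 \<le> C^2"
      by (intro power_mono) auto
    then show "(\<Sum>k\<in>F. (cmod (cf a k))^2) \<le> C^2"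
      by (simp add: L2_set_def sum_nonneg)
  qed
  then show ?thesis unfolding norm_hl2_def using C0 by (metis real_sqrt_abs abs_of_nonneg real_sqrt_le_mono)
qed

lemma hl2_norm_eq_0D: "norm a = 0 \<Longrightarrow> a = 0" for a :: "'a hl2"
proof (rule hl2_eqI)
  fix k assume "norm a = 0"
  then show "cf a k = cf 0 k" using L2_set_le_norm[of "{k}" a] by simp
qed

instance
proof
  fix a b :: "'a hl2" and r :: real
  show "dist a b = norm (a - b)" by (rule dist_hl2_def)
  show "sgn a = a /\<^sub>R norm a" by (rule sgn_hl2_def)
  show "(uniformity :: ('a hl2 \<times> 'a hl2) filter) = (INF e\<in>{0<..}. principal {(x, y). dist x y < e})"
    by (rule uniformity_hl2_def)
  fix U :: "'a hl2 set"
  show "open U \<longleftrightarrow> (\<forall>x\<in>U. eventually (\<lambda>(x', y). x' = x \<longrightarrow> y \<in> U) uniformity)"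
    by (rule open_hl2_def)
next
  fix a b :: "'a hl2" and r :: real
  show "norm a = 0 \<longleftrightarrow> a = 0" using hl2_norm_eq_0D by (auto simp: norm_hl2_def)
  show "norm (a + b) \<le> norm a + norm b"
  proof (rule hl2_norm_le_L2_set)
    fix F :: "(int^'a) set" assume F: "finite F"
    have "L2_set (\<lambda>k. cmod (cf (a + b) k)) F
        \<le> L2_set (\<lambda>k. cmod (cf a k)) F + L2_set (\<lambda>k. cmod (cf b k)) F"
      using L2_set_le_add[of "cf a" "cf b" F] by simp
    also have "\<dots> \<le> norm a + norm b" using F by (intro add_mono L2_set_le_norm)
    finally show "L2_set (\<lambda>k. cmod (cf (a + b) k)) F \<le> norm a + norm b" .
  qed
  show "norm (r *\<^sub>R a) = \<bar>r\<bar> * norm a"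
    by (simp add: norm_hl2_def norm_mult power_mult_distrib infsum_cmult_right' real_sqrt_mult)
qed

end

lemma hl2_sum_le_norm: "finite F \<Longrightarrow> (\<Sum>k\<in>F. (cmod (cf a k))^2) \<le> (norm a)^2"
  unfolding hl2_norm_sq by (intro finite_sum_le_infsum cf_summable) auto

lemma cmod_cf_le_norm: "cmod (cf a k) \<le> norm a"
  using L2_set_le_norm[of "{k}" a] by simp

lemma hl2_norm_leI:
  assumes "0 \<le> C" and "\<And>F. finite F \<Longrightarrow> (\<Sum>k\<in>F. (cmod (cf a k))^2) \<le> C^2"
  shows "norm a \<le> C"
proof (rule hl2_norm_le_L2_set)
  fix F :: "(int^'a) set" assume "finite F"
  from assms(2)[OF this] show "L2_set (\<lambda>k. cmod (cf a k)) F \<le> C"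
    unfolding L2_set_def using assms(1) by (metis real_sqrt_abs abs_of_nonneg real_sqrt_le_mono)
qed

lemma cf_Hl2:
  assumes "\<And>k. a (-k) = cnj (a k)" and "\<And>F. finite F \<Longrightarrow> (\<Sum>k\<in>F. (cmod (a k))^2) \<le> C"
  shows "cf (Hl2 a) k = a k"
  using assms l2_summableI[of a C] by (simp add: Hl2_inverse)

lemma bounded_linear_cf: "bounded_linear (\<lambda>a. cf a k)"
  by (rule bounded_linear_intro[where K=1]) (auto simp: cmod_cf_le_norm scaleR_conv_of_real)

instance hl2 :: (finite) banach
proof
  fix X :: "nat \<Rightarrow> 'a hl2" assume X: "Cauchy X"
  have "convergent (\<lambda>n. cf (X n) k)" for k
    by (rule Cauchy_convergent[OF bounded_linear.Cauchy[OF bounded_linear_cf X]])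
  then obtain c where c: "(\<lambda>n. cf (X n) k) \<longlonglongrightarrow> c k" for k
    unfolding convergent_def by metis
  \<comment> \<open>On a fixed finite set the Cauchy bound survives the limit \<open>m\<close> to
    infinity; being uniform in the set, it then bounds the norm of the difference to the
    limit.\<close>
  have tail: "(\<Sum>k\<in>F. (cmod (cf (X n) k - c k))^2) \<le> e^2"
    if F: "finite F" and e: "0 \<le> e" and N: "\<And>m. m \<ge> N \<Longrightarrow> norm (X n - X m) \<le> e" for F n N e
  proof (rule LIMSEQ_le_const2)
    show "(\<lambda>m. \<Sum>k\<in>F. (cmod (cf (X n) k - cf (X m) k))^2) \<longlonglongrightarrow> (\<Sum>k\<in>F. (cmod (cf (X n) k - c k))^2)"
      by (intro tendsto_intros c)
    show "\<exists>N. \<forall>m\<ge>N. (\<Sum>k\<in>F. (cmod (cf (X n) k - cf (X m) k))^2) \<le> e^2"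
    proof (intro exI allI impI)
      fix m assume "m \<ge> N"
      have "(\<Sum>k\<in>F. (cmod (cf (X n) k - cf (X m) k))^2) \<le> (norm (X n - X m))^2"
        using hl2_sum_le_norm[OF F, of "X n - X m"] by simp
      also have "\<dots> \<le> e^2" by (intro power_mono N \<open>m \<ge> N\<close>) auto
      finally show "(\<Sum>k\<in>F. (cmod (cf (X n) k - cf (X m) k))^2) \<le> e^2" .
    qed
  qed
  have herm: "c (-k) = cnj (c k)" for k
    using LIMSEQ_unique[OF c[of "-k"]] tendsto_cnj[OF c[of k]] by (simp add: cf_uminus)
  obtain N where N: "\<And>m n. m \<ge> N \<Longrightarrow> n \<ge> N \<Longrightarrow> norm (X n - X m) \<le> 1"
    using CauchyD[OF X, of 1] by (metis less_imp_le zero_less_one)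
  \<comment> \<open>\<open>c\<close> differs from the square-summable \<open>X N\<close> by a
    square-summable family, so it is itself square-summable.\<close>
  have "(\<lambda>k. (cmod (cf (X N) k - c k))^2) summable_on UNIV"
    by (rule l2_summableI[of _ "1^2"], rule tail) (use N in auto)
  from l2_summable_add[OF this, of "\<lambda>k. - cf (X N) k"] cf_summable[of "X N"]
  have "(\<lambda>k. (cmod (c k))^2) summable_on UNIV" by simp
  with herm have cfc: "cf (Hl2 c) = c" by (simp add: Hl2_inverse)
  have "X \<longlonglongrightarrow> Hl2 c"
  proof (rule LIMSEQ_I)
    fix r :: real assume r: "0 < r"
    obtain N where N: "\<And>m n. m \<ge> N \<Longrightarrow> n \<ge> N \<Longrightarrow> norm (X n - X m) < r/2"
      using CauchyD[OF X, of "r/2"] r by (metis half_gt_zero)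
    have "norm (X n - Hl2 c) \<le> r/2" if "n \<ge> N" for n
    proof (rule hl2_norm_leI)
      fix F :: "(int^'a) set" assume "finite F"
      then show "(\<Sum>k\<in>F. (cmod (cf (X n - Hl2 c) k))^2) \<le> (r/2)^2"
        unfolding cf_minus cfc
        by (rule tail) (use r N that in \<open>auto intro: less_imp_le\<close>)
    qed (use r in auto)
    then show "\<exists>no. \<forall>n\<ge>no. norm (X n - Hl2 c) < r"
      using r by (intro exI[of _ N]) (fastforce)
  qed
  then show "convergent X" by (rule convergentI)
qed

section \<open>Lattice weights and diagonal Fourier multipliers\<close>

lemma finite_ksq_le: "finite {k :: int^'d. ksq k \<le> C}"
proof (rule finite_subset)
  show "{k :: int^'d. ksq k \<le> C} \<subseteq> vec_lambda ` (PiE UNIV (\<lambda>_. {-\<lceil>\<bar>C\<bar>\<rceil>..\<lceil>\<bar>C\<bar>\<rceil>}))"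
  proof
    fix k :: "int^'d" assume "k \<in> {k. ksq k \<le> C}"
    then have k: "ksq k \<le> C" by simp
    have "\<bar>k $ i\<bar> \<le> \<lceil>\<bar>C\<bar>\<rceil>" for i
    proof -
      have "\<bar>k $ i\<bar> \<le> (k $ i)^2"
        using self_le_power[of "\<bar>k $ i\<bar>" 2] by (cases "k $ i = 0") auto
      then have "real_of_int \<bar>k $ i\<bar> \<le> (real_of_int (k $ i))^2"
        by (metis of_int_le_iff of_int_power)
      also have "\<dots> \<le> ksq k" unfolding ksq_def by (rule member_le_sum) auto
      finally show ?thesis using k by linarith
    qed
    then have "vec_nth k \<in> (PiE UNIV (\<lambda>_. {-\<lceil>\<bar>C\<bar>\<rceil>..\<lceil>\<bar>C\<bar>\<rceil>}))" by (auto simp: abs_le_iff minus_le_iff)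
    then show "k \<in> vec_lambda ` (PiE UNIV (\<lambda>_. {-\<lceil>\<bar>C\<bar>\<rceil>..\<lceil>\<bar>C\<bar>\<rceil>}))"
      by (metis image_eqI vec_lambda_eta)
  qed
qed (intro finite_imageI finite_PiE, auto)

lemma ksq_uminus [simp]: "ksq (-k) = ksq k" by (simp add: ksq_def)
lemma ksq_nonneg [simp]: "0 \<le> ksq k" by (simp add: ksq_def sum_nonneg)
lemma ksq_zero [simp]: "ksq 0 = 0" by (simp add: ksq_def)

lemma ksq_ge_1: "k \<noteq> 0 \<Longrightarrow> 1 \<le> ksq k"
proof -
  assume "k \<noteq> 0"
  then obtain i where "k $ i \<noteq> 0" by (auto simp: vec_eq_iff)
  then have "1 \<le> (k $ i)^2" by (simp add: int_one_le_iff_zero_less)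
  then have "1 \<le> (real_of_int (k $ i))^2" by (metis of_int_1_le_iff of_int_power)
  also have "\<dots> \<le> ksq k" unfolding ksq_def by (rule member_le_sum) auto
  finally show ?thesis .
qed

lemma lamk_ge_1: "1 \<le> lamk k" by (simp add: lamk_def)
lemma lamk_pos [simp]: "0 < lamk k" using lamk_ge_1[of k] by linarith
lemma lamk_nz [simp]: "lamk k \<noteq> 0" using lamk_pos[of k] by linarith
lemma lamk_uminus [simp]: "lamk (-k) = lamk k" by (simp add: lamk_def)
lemma lamk_zero [simp]: "lamk 0 = 1" by (simp add: lamk_def)
lemma lamk_sq: "(lamk k)^2 = 1 + ksq k" by (simp add: lamk_def)

text \<open>A real even symbol preserves the Hermitian condition and a bounded one preserves
  square-summability. Without both, the \<open>Hl2\<close> in \<open>dg\<close> could be applied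
  outside its domain.\<close>

definition mult_sym :: "(int^'d \<Rightarrow> real) \<Rightarrow> bool" where
  "mult_sym m \<longleftrightarrow> (\<forall>k. m (-k) = m k) \<and> (\<exists>B. \<forall>k. \<bar>m k\<bar> \<le> B)"

lemma mult_symI: "(\<And>k. m (-k) = m k) \<Longrightarrow> (\<And>k. \<bar>m k\<bar> \<le> B) \<Longrightarrow> mult_sym m"
  by (auto simp: mult_sym_def)

definition dg :: "(int^'d \<Rightarrow> real) \<Rightarrow> ('d::finite) hl2 \<Rightarrow> 'd hl2" where
  "dg m a = Hl2 (\<lambda>k. of_real (m k) * cf a k)"

lemma sum_dg_le:
  assumes "\<And>k. \<bar>m k\<bar> \<le> B" "finite F"
  shows "(\<Sum>k\<in>F. (cmod (of_real (m k) * cf a k))^2) \<le> (B * norm a)^2"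
proof -
  have "0 \<le> B" using assms(1)[of undefined] by linarith
  have "(\<Sum>k\<in>F. (cmod (of_real (m k) * cf a k))^2) \<le> (\<Sum>k\<in>F. B^2 * (cmod (cf a k))^2)"
    unfolding norm_mult power_mult_distrib
    by (intro sum_mono mult_right_mono power_mono) (use assms in auto)
  also have "\<dots> = B^2 * (\<Sum>k\<in>F. (cmod (cf a k))^2)" by (simp add: sum_distrib_left)
  also have "\<dots> \<le> B^2 * (norm a)^2" by (intro mult_left_mono hl2_sum_le_norm assms) auto
  finally show ?thesis by (simp add: power_mult_distrib)
qed

lemma cf_dg:
  assumes "mult_sym m"
  shows "cf (dg m a) k = of_real (m k) * cf a k"
proof -
  from assms obtain B where B: "\<And>k. \<bar>m k\<bar> \<le> B" and s: "\<And>k. m (-k) = m k" by (auto simp: mult_sym_def)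
  show ?thesis unfolding dg_def
    by (rule cf_Hl2[where C="(B * norm a)^2"]) (use B s in \<open>auto simp: cf_uminus intro: sum_dg_le\<close>)
qed

lemma norm_dg_le:
  assumes "mult_sym m" "\<And>k. \<bar>m k\<bar> \<le> B"
  shows "norm (dg m a) \<le> B * norm a"
proof (rule hl2_norm_leI)
  show "0 \<le> B * norm a" using assms(2)[of undefined] by (intro mult_nonneg_nonneg) auto
qed (unfold cf_dg[OF assms(1)], rule sum_dg_le[OF assms(2)])

lemma bounded_linear_dg:
  assumes "mult_sym m" shows "bounded_linear (dg m)"
proof -
  from assms obtain B where B: "\<And>k. \<bar>m k\<bar> \<le> B" by (auto simp: mult_sym_def)
  show ?thesis
    by (rule bounded_linear_intro[where K=B])
      (use norm_dg_le[OF assms B] in \<open>auto intro!: hl2_eqI simp: cf_dg assms algebra_simps\<close>)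
qed

text \<open>Dominated convergence: finitely many modes carry all but a small part of the norm of
  \<open>a\<close>, and on them pointwise convergence suffices. The convergence is only strong, not
  in operator norm, which is all that the time dependence of the flows allows.\<close>

lemma tendsto_dg:
  fixes m :: "'n \<Rightarrow> int^'d::finite \<Rightarrow> real"
  assumes ms: "\<forall>\<^sub>F n in F. mult_sym (m n) \<and> (\<forall>k. \<bar>m n k\<bar> \<le> B)"
    and l: "mult_sym l" and lim: "\<And>k. ((\<lambda>n. m n k) \<longlongrightarrow> l k) F"
  shows "((\<lambda>n. dg (m n) a) \<longlongrightarrow> dg l a) F"
proof -
  obtain B' where B': "\<And>k. \<bar>l k\<bar> \<le> B'" using l by (auto simp: mult_sym_def)
  define D where "D = \<bar>B\<bar> + B'"
  have Dl: "\<bar>l k\<bar> \<le> D" for k using B'[of k] by (simp add: D_def)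
  have D0: "0 \<le> D" using Dl[of undefined] by linarith
  show ?thesis
  proof (rule tendstoI)
    fix e :: real assume e: "0 < e"
    \<comment> \<open>The symbols differ by at most \<open>2*D\<close>, so a tail of mass
      \<open>c\<close> contributes at most e^2/2; the finite part contributes less than e^2/4. The
      summand 1 covers the case \<open>D = 0\<close>.\<close>
    define c where "c = e^2 / (2 * ((2*D)^2 + 1))"
    have c: "c > 0" using e by (auto simp: c_def intro!: divide_pos_pos add_nonneg_pos)
    let ?f = "\<lambda>k. (cmod (cf a k))^2"
    have "\<exists>F0. finite F0 \<and> infsum ?f UNIV - c < sum ?f F0"
    proof -
      have "(?f has_sum infsum ?f UNIV) UNIV" using cf_summable by (rule has_sum_infsum)
      then have "(sum ?f \<longlongrightarrow> infsum ?f UNIV) (finite_subsets_at_top UNIV)" by (simp add: has_sum_def)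
      from order_tendstoD(1)[OF this, of "infsum ?f UNIV - c"] c
      have "\<forall>\<^sub>F F in finite_subsets_at_top UNIV. infsum ?f UNIV - c < sum ?f F" by simp
      then show ?thesis unfolding eventually_finite_subsets_at_top by blast
    qed
    then obtain F0 where F0: "finite F0" "infsum ?f UNIV - c < sum ?f F0" by blast
    have "((\<lambda>n. \<Sum>k\<in>F0. (m n k - l k)^2 * ?f k) \<longlongrightarrow> (\<Sum>k\<in>F0. (l k - l k)^2 * ?f k)) F"
      by (intro tendsto_intros lim)
    then have "\<forall>\<^sub>F n in F. (\<Sum>k\<in>F0. (m n k - l k)^2 * ?f k) < e^2/4"
      using e by (intro order_tendstoD(2)) auto
    with ms show "\<forall>\<^sub>F n in F. dist (dg (m n) a) (dg l a) < e"
    proof eventually_elim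
      fix n assume A: "mult_sym (m n) \<and> (\<forall>k. \<bar>m n k\<bar> \<le> B)" and small: "(\<Sum>k\<in>F0. (m n k - l k)^2 * ?f k) < e^2/4"
      have le: "\<bar>m n k - l k\<bar> \<le> 2*D" for k
      proof -
        have "\<bar>m n k\<bar> \<le> B" using A by blast
        have "0 \<le> B'" using B'[of k] abs_ge_zero[of "l k"] by (rule order_trans[rotated])
        have "\<bar>m n k - l k\<bar> \<le> \<bar>m n k\<bar> + \<bar>l k\<bar>" by (rule abs_triangle_ineq4)
        also have "\<dots> \<le> B + B'" by (intro add_mono B' \<open>\<bar>m n k\<bar> \<le> B\<close>)
        also have "\<dots> \<le> 2 * D" using \<open>0 \<le> B'\<close> by (simp add: D_def)
        finally show ?thesis .
      qed
      have "norm (dg (m n) a - dg l a) \<le> sqrt (3/4 * e^2)"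
      proof (rule hl2_norm_leI)
        fix G :: "(int^'d) set" assume G: "finite G"
        have "(\<Sum>k\<in>G. (cmod (cf (dg (m n) a - dg l a) k))^2) = (\<Sum>k\<in>G. (m n k - l k)^2 * ?f k)"
        proof (rule sum.cong)
          fix k
          have "cf (dg (m n) a - dg l a) k = of_real (m n k - l k) * cf a k"
            using A l by (simp add: cf_dg algebra_simps)
          then show "(cmod (cf (dg (m n) a - dg l a) k))^2 = (m n k - l k)^2 * ?f k"
            by (simp only: norm_mult norm_of_real power_mult_distrib power2_abs)
        qed simp
        also have "\<dots> \<le> (\<Sum>k\<in>G \<union> F0. (m n k - l k)^2 * ?f k)"
          by (rule sum_mono2) (use G F0 in auto)
        also have "\<dots> = (\<Sum>k\<in>G - F0. (m n k - l k)^2 * ?f k) + (\<Sum>k\<in>F0. (m n k - l k)^2 * ?f k)"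
          using sum.union_disjoint[of "G-F0" F0 "\<lambda>k. (m n k - l k)^2 * ?f k"] G F0 by (simp add: Diff_disjoint Int_commute)
        also have "(\<Sum>k\<in>G - F0. (m n k - l k)^2 * ?f k) \<le> (\<Sum>k\<in>G - F0. (2*D)^2 * ?f k)"
          by (intro sum_mono mult_right_mono) (use power_mono[OF le, where n=2] in auto)
        also have "\<dots> = (2*D)^2 * sum ?f (G - F0)" by (simp add: sum_distrib_left)
        also have "sum ?f (G - F0) \<le> c"
        proof -
          have "sum ?f (G - F0) + sum ?f F0 = sum ?f (G \<union> F0)"
            using sum.union_disjoint[of "G-F0" F0 ?f] G F0 by (simp add: Int_commute)
          also have "\<dots> \<le> infsum ?f UNIV" by (rule finite_sum_le_infsum[OF cf_summable]) (use G F0 in auto)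
          finally show ?thesis using F0 by linarith
        qed
        also have "(2*D)^2 * c \<le> e^2/2"
        proof -
          have "(2*D)^2 * c \<le> ((2*D)^2 + 1) * c" using c by (intro mult_right_mono) auto
          also have "\<dots> = e^2/2"
          proof -
            have "(2*D)^2 + 1 \<noteq> 0" by (metis add_nonneg_pos less_numeral_extra(1) less_numeral_extra(3) zero_le_power2)
            then show ?thesis unfolding c_def by (simp add: divide_simps)
          qed
          finally show ?thesis .
        qed
        finally have "(\<Sum>k\<in>G. (cmod (cf (dg (m n) a - dg l a) k))^2) \<le> 3/4 * e^2"
          using small by (simp add: mult_left_mono)
        then show "(\<Sum>k\<in>G. (cmod (cf (dg (m n) a - dg l a) k))^2) \<le> (sqrt (3/4 * e^2))^2" by simp
      qed auto
      also have "\<dots> < e"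
      proof -
        have "sqrt (3/4 * e^2) < sqrt (e^2)" using e by (intro real_sqrt_less_mono) auto
        then show ?thesis using e by simp
      qed
      finally show "dist (dg (m n) a) (dg l a) < e" by (simp add: dist_norm)
    qed
  qed
qed

section \<open>Fourier coefficients on the torus\<close>

abbreviation tM :: "(real^'d) measure" where "tM \<equiv> lebesgue_on tcube"

lemma tcube_cbox: "(tcube :: (real^'d) set) = cbox 0 (\<chi> i. 2*pi)"
  by (auto simp: tcube_def mem_box_cart)

lemma tcube_sets [simp, measurable]: "(tcube :: (real^'d) set) \<in> sets lebesgue"
  by (simp add: tcube_cbox)

lemma compact_tcube: "compact (tcube :: (real^'d) set)"
  by (simp add: tcube_cbox)

lemma finite_measure_tM: "finite_measure (tM :: (real^'d) measure)"
  by (rule finite_measureI)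
     (use fmeasurableD2[OF lmeasurable_cbox] in \<open>simp add: emeasure_restrict_space tcube_cbox\<close>)

lemma tM_integrable_bounded:
  fixes f :: "real^'d \<Rightarrow> 'b::{banach,second_countable_topology}"
  assumes "f \<in> borel_measurable tM" "\<And>x. norm (f x) \<le> B"
  shows "integrable tM f"
  by (rule finite_measure.integrable_const_bound[OF finite_measure_tM]) (use assms in auto)

lemma set_lebesgue_integral_tcube:
  fixes f :: "real^'d \<Rightarrow> 'b::{banach,second_countable_topology}"
  shows "(LINT x:tcube|lebesgue. f x) = (\<integral>x. f x \<partial>tM)"
  by (simp add: set_lebesgue_integral_def integral_restrict_space)

lemma kdot_inner: "kdot k x = inner (\<chi> i. real_of_int (k$i)) x"
  by (simp add: kdot_def inner_vec_def)

lemma kdot_zero [simp]: "kdot 0 x = 0" by (simp add: kdot_def)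
lemma kdot_uminus: "kdot (-k) x = - kdot k x" by (simp add: kdot_def sum_negf)
lemma kdot_add: "kdot (k + l) x = kdot k x + kdot l x"
  by (simp add: kdot_def algebra_simps sum.distrib)
lemma kdot_diff: "kdot (k - l) x = kdot k x - kdot l x"
  by (simp add: kdot_def algebra_simps sum_subtractf)

lemma continuous_kdot [continuous_intros]: "continuous_on S (kdot k)"
  unfolding kdot_def by (intro continuous_intros)

lemma borel_measurable_kdot [measurable]: "kdot k \<in> borel_measurable borel"
  by (intro borel_measurable_continuous_onI continuous_intros)

lemma continuous_on_cis_kdot [continuous_intros]: "continuous_on S (\<lambda>x. cis (kdot k x))"
  unfolding cis_conv_exp by (intro continuous_intros)

lemma borel_measurable_cis_kdot [measurable]: "(\<lambda>x. cis (kdot k x)) \<in> borel_measurable borel"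
  by (intro borel_measurable_continuous_onI continuous_intros)

lemma borel_tM [measurable_dest]:
  "f \<in> borel_measurable borel \<Longrightarrow> f \<in> borel_measurable (tM :: (real^'d) measure)"
  by (intro measurable_restrict_space1 borel_measurable_subalgebra[of lborel lebesgue f]) auto

lemma integral_cis_1d:
  fixes n :: int
  shows "(\<integral>t. indicator {0..2*pi} t *\<^sub>R cis (real_of_int n * t) \<partial>lborel) = (if n = 0 then 2*pi else 0)"
    and "integrable lborel (\<lambda>t. indicator {0..2*pi} t *\<^sub>R cis (real_of_int n * t))"
proof -
  have c: "continuous_on {0..2*pi} (\<lambda>t. cis (real_of_int n * t))"
    unfolding cis_conv_exp by (intro continuous_intros)
  then show "integrable lborel (\<lambda>t. indicator {0..2*pi} t *\<^sub>R cis (real_of_int n * t))"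
    by (intro borel_integrable_compact) auto
  show "(\<integral>t. indicator {0..2*pi} t *\<^sub>R cis (real_of_int n * t) \<partial>lborel) = (if n = 0 then 2*pi else 0)"
  proof (cases "n = 0")
    case True
    then show ?thesis
      using integral_FTC_atLeastAtMost[of 0 "2*pi" "\<lambda>t. complex_of_real t" "\<lambda>_. 1"]
      by (auto intro!: derivative_eq_intros simp: has_vector_derivative_def has_derivative_of_real scaleR_conv_of_real)
  next
    case False
    let ?F = "\<lambda>t::real. exp (\<i> * of_int n * of_real t) / (\<i> * of_int n)"
    have "(\<integral>t. indicator {0..2*pi} t *\<^sub>R cis (real_of_int n * t) \<partial>lborel) = ?F (2*pi) - ?F 0"
    proof (rule integral_FTC_atLeastAtMost[OF _ _ c])
      fix x :: real
      have "((\<lambda>z. exp (\<i> * of_int n * z) / (\<i> * of_int n)) has_field_derivative exp (\<i> * of_int n * of_real x)) (at (of_real x))"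
        using False by (auto intro!: derivative_eq_intros)
      from has_vector_derivative_real_field[OF this]
      show "(?F has_vector_derivative cis (real_of_int n * x)) (at x within {0..2*pi})" 
        by (simp add: cis_conv_exp mult_ac has_vector_derivative_at_within)
    qed simp
    also have "exp (\<i> * of_int n * of_real (2*pi)) = 1"
    proof -
      have "exp (\<i> * of_int n * of_real (2*pi)) = cis (2 * pi * n)" by (simp add: cis_conv_exp mult_ac)
      then show ?thesis by (simp add: cis_multiple_2pi)
    qed
    finally show ?thesis using False by simp
  qed
qed

text \<open>The character restricted to the cube is a product of functions of one coordinate, and
  Lebesgue measure is the image of a product measure; a coordinate with nonzero frequency makes one
  factor vanish.\<close>

lemma integral_cis_kdot:
  fixes k :: "int^'d"
  shows "(\<integral>x. cis (kdot k x) \<partial>tM) = (if k = 0 then (2*pi)^CARD('d) else 0)"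
proof -
  define \<kappa> :: "real^'d" where "\<kappa> = (\<chi> i. real_of_int (k$i))"
  define G where "G b t = indicator {0..2*pi} t *\<^sub>R cis ((\<kappa> \<bullet> b) * t)" for b and t :: real
  have int\<kappa>: "\<exists>n::int. \<kappa> \<bullet> b = of_int n" if "b \<in> Basis" for b
    using that by (auto simp: \<kappa>_def Basis_vec_def inner_axis)
  have G: "integral\<^sup>L lborel (G b) = (if \<kappa> \<bullet> b = 0 then 2*pi else 0)" "integrable lborel (G b)"
    if b: "b \<in> Basis" for b
  proof -
    obtain n :: int where n: "\<kappa> \<bullet> b = of_int n" using int\<kappa>[OF b] by blast
    have "G b = (\<lambda>t. indicator {0..2*pi} t *\<^sub>R cis (real_of_int n * t))" by (auto simp: G_def n)
    with integral_cis_1d[of n] n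
    show "integral\<^sup>L lborel (G b) = (if \<kappa> \<bullet> b = 0 then 2*pi else 0)" "integrable lborel (G b)"
      by auto
  qed
  have cis_sum: "cis (\<Sum>b\<in>B. g b) = (\<Prod>b\<in>B. cis (g b))" if "finite B" for B and g :: "real^'d \<Rightarrow> real"
    using that by (induction B rule: finite_induct) (auto simp: cis_mult[symmetric])
  have prodG: "indicator tcube x *\<^sub>R cis (kdot k x) = (\<Prod>b\<in>Basis. G b (x \<bullet> b))" for x :: "real^'d"
  proof -
    have "indicator tcube x = (\<Prod>b\<in>Basis. indicator {0..2*pi} (x \<bullet> b) :: real)"
    proof (cases "x \<in> tcube")
      case True
      then have "(\<Prod>b\<in>Basis. indicator {0..2*pi} (x \<bullet> b) :: real) = (\<Prod>b\<in>(Basis::(real^'d) set). 1)"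
        by (intro prod.cong) (auto simp: tcube_def Basis_vec_def inner_axis)
      then show ?thesis using True by simp
    next
      case False
      then obtain i where "\<not> (0 \<le> x$i \<and> x$i \<le> 2*pi)" by (auto simp: tcube_def)
      then have "\<exists>b\<in>Basis. indicator {0..2*pi} (x \<bullet> b) = (0::real)"
        by (intro bexI[of _ "axis i 1"]) (auto simp: inner_axis Basis_vec_def)
      then show ?thesis using False by (simp add: prod_zero)
    qed
    moreover have "kdot k x = (\<Sum>b\<in>Basis. (\<kappa> \<bullet> b) * (x \<bullet> b))"
      unfolding kdot_inner \<kappa>_def by (rule euclidean_inner)
    ultimately show ?thesis
      by (simp add: G_def cis_sum scaleR_conv_of_real prod.distrib)
  qed
  interpret P: product_sigma_finite "\<lambda>b::real^'d. lborel :: real measure" by standard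
  have "(\<integral>x. cis (kdot k x) \<partial>tM) = (\<integral>x. indicator tcube x *\<^sub>R cis (kdot k x) \<partial>lebesgue)"
    by (simp add: integral_restrict_space)
  also have "\<dots> = (\<integral>x. indicator tcube x *\<^sub>R cis (kdot k x) \<partial>lborel)"
    by (rule integral_completion) (simp add: tcube_cbox)
  also have "\<dots> = (\<integral>x. (\<Prod>b\<in>Basis. G b (x \<bullet> b)) \<partial>lborel)" by (simp add: prodG)
  also have "\<dots> = (\<integral>x. (\<Prod>b\<in>Basis. G b (x \<bullet> b)) \<partial>(distr (\<Pi>\<^sub>M b\<in>Basis. lborel) borel (\<lambda>f. \<Sum>b\<in>Basis. f b *\<^sub>R b)))"
    by (subst lborel_eq) simp
  also have "\<dots> = (\<integral>f. (\<Prod>b\<in>Basis. G b ((\<Sum>b\<in>Basis. f b *\<^sub>R b) \<bullet> b)) \<partial>(\<Pi>\<^sub>M b\<in>Basis. lborel))"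
  proof (rule integral_distr)
    have "G b \<in> borel_measurable borel" if "b \<in> Basis" for b
      using G(2)[OF that] borel_measurable_integrable by force
    show "(\<lambda>x::real^'d. \<Prod>b\<in>Basis. G b (x \<bullet> b)) \<in> borel_measurable borel"
    proof (rule borel_measurable_prod)
      fix b :: "real^'d" assume "b \<in> Basis"
      have "(\<lambda>x::real^'d. x \<bullet> b) \<in> borel_measurable borel" by simp
      from measurable_compose[OF this] show "(\<lambda>x. G b (x \<bullet> b)) \<in> borel_measurable borel"
        using \<open>\<And>b. b \<in> Basis \<Longrightarrow> G b \<in> borel_measurable borel\<close> \<open>b \<in> Basis\<close> by blast
    qed
  qed measurable
  also have "\<dots> = (\<integral>f. (\<Prod>b\<in>Basis. G b (f b)) \<partial>(\<Pi>\<^sub>M b\<in>Basis. lborel))"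
    by (intro Bochner_Integration.integral_cong prod.cong) (auto simp: inner_sum_left_Basis)
  also have "\<dots> = (\<Prod>b\<in>Basis. integral\<^sup>L lborel (G b))"
    by (rule P.product_integral_prod) (use G in auto)
  also have "\<dots> = (\<Prod>b\<in>(Basis::(real^'d) set). if \<kappa> \<bullet> b = 0 then 2*pi else 0)"
    unfolding of_real_prod by (intro prod.cong) (auto simp: G)
  also have "\<dots> = (if k = 0 then (2*pi)^CARD('d) else 0)"
  proof (cases "k = 0")
    case True
    then have "\<kappa> = 0" by (simp add: \<kappa>_def vec_eq_iff)
    with True show ?thesis by simp
  next
    case False
    then obtain i where "k $ i \<noteq> 0" by (auto simp: vec_eq_iff)
    then have "\<kappa> \<bullet> axis i 1 \<noteq> 0" by (simp add: \<kappa>_def inner_axis)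
    then have "\<exists>b\<in>Basis. (if \<kappa> \<bullet> b = 0 then 2*pi else 0) = 0"
      by (intro bexI[of _ "axis i 1"]) (auto simp: Basis_vec_def)
    with False show ?thesis by (simp add: prod_zero)
  qed
  finally show ?thesis by simp
qed

lemma L2T_iff:
  "L2T f \<longleftrightarrow> periodic_T f \<and> f \<in> borel_measurable lebesgue \<and> integrable tM (\<lambda>x. (f x)^2)"
  by (simp add: L2T_def set_integrable_def integrable_restrict_space)

lemma L2T_measurable: "L2T f \<Longrightarrow> f \<in> borel_measurable (tM :: (real^'d) measure)"
  by (auto simp: L2T_iff intro: measurable_restrict_space1)

lemma integrable_of_sq:
  fixes f g :: "real^'d \<Rightarrow> real"
  assumes [measurable]: "f \<in> borel_measurable tM" "g \<in> borel_measurable tM"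
    and "integrable tM (\<lambda>x. (f x)^2)" "integrable tM (\<lambda>x. (g x)^2)"
  shows "integrable tM (\<lambda>x. f x * g x)"
proof (rule Bochner_Integration.integrable_bound)
  show "integrable tM (\<lambda>x. (f x)^2 + (g x)^2)" using assms by auto
  have "\<bar>x * y\<bar> \<le> x^2 + y^2" for x y :: real
    using sum_squares_bound[of x y] sum_squares_bound[of x "-y"] by (auto simp: abs_if) 
  then show "AE x in tM. norm (f x * g x) \<le> norm ((f x)^2 + (g x)^2)" by auto
qed measurable

lemma L2T_integrable: "L2T f \<Longrightarrow> integrable tM f"
  using integrable_of_sq[of f "\<lambda>_. 1"] tM_integrable_bounded[of "\<lambda>_. 1::real" 1]
  by (auto simp: L2T_iff L2T_measurable)

lemma L2T_diff:
  assumes "L2T f" "L2T g" shows "L2T (\<lambda>x. f x - g x)"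
proof -
  have "integrable tM (\<lambda>x. (f x)^2 + (g x)^2 - 2 * (f x * g x))"
    using assms integrable_of_sq[of f g] by (auto simp: L2T_iff L2T_measurable intro!: Bochner_Integration.integrable_diff Bochner_Integration.integrable_add)
  moreover have "(\<lambda>x. (f x)^2 + (g x)^2 - 2 * (f x * g x)) = (\<lambda>x. (f x - g x)^2)"
    by (simp add: power2_diff algebra_simps)
  ultimately show ?thesis using assms by (auto simp: L2T_iff periodic_T_def)
qed

lemma L2T_mult_bounded:
  fixes f \<phi> :: "real^'d \<Rightarrow> real"
  assumes f: "L2T f" and p: "periodic_T \<phi>" and m: "\<phi> \<in> borel_measurable lebesgue" and b: "\<And>x. \<bar>\<phi> x\<bar> \<le> B"
  shows "L2T (\<lambda>x. \<phi> x * f x)"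
  unfolding L2T_iff
proof (intro conjI)
  show "periodic_T (\<lambda>x. \<phi> x * f x)" using f p by (auto simp: L2T_iff periodic_T_def)
  show "(\<lambda>x. \<phi> x * f x) \<in> borel_measurable lebesgue" using f m by (auto simp: L2T_iff)
  have [measurable]: "\<phi> \<in> borel_measurable tM" "f \<in> borel_measurable tM"
    using m L2T_measurable[OF f] by (auto intro: measurable_restrict_space1)
  show "integrable tM (\<lambda>x. (\<phi> x * f x)^2)"
  proof (rule Bochner_Integration.integrable_bound)
    show "integrable tM (\<lambda>x. B^2 * (f x)^2)" using f by (auto simp: L2T_iff)
    have "(\<phi> x)^2 \<le> B^2" for x using power_mono[OF b[of x], of 2] by simp
    then show "AE x in tM. norm ((\<phi> x * f x)^2) \<le> norm (B^2 * (f x)^2)"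
      by (auto simp: power_mult_distrib intro!: mult_right_mono)
  qed measurable
qed

lemma L2T_scale: "L2T f \<Longrightarrow> L2T (\<lambda>x. c * f x)"
  by (rule L2T_mult_bounded[where B="\<bar>c\<bar>"]) (auto simp: periodic_T_def)

lemma L2T_add: "L2T f \<Longrightarrow> L2T g \<Longrightarrow> L2T (\<lambda>x. f x + g x)"
  using L2T_diff[of f "\<lambda>x. - 1 * g x"] L2T_scale[of g "-1"] by simp

lemma fcoef_tM: "fcoef f k = complex_of_real (1 / (2*pi)^CARD('d)) * (\<integral>x. of_real (f x) * cis (- kdot k x) \<partial>tM)"
  for f :: "real^'d \<Rightarrow> real"
  by (simp add: fcoef_def set_lebesgue_integral_tcube)

lemma integrable_mult_cis:
  fixes f :: "real^'d \<Rightarrow> real"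
  assumes "integrable tM f"
  shows "integrable tM (\<lambda>x. of_real (f x) * cis (kdot k x))"
proof (rule Bochner_Integration.integrable_bound[OF assms])
  have [measurable]: "f \<in> borel_measurable tM" using assms by auto
  show "(\<lambda>x. of_real (f x) * cis (kdot k x)) \<in> borel_measurable tM" by measurable
qed (auto simp: norm_mult)

lemma integrable_mult_cis': "integrable tM f \<Longrightarrow> integrable tM (\<lambda>x. of_real (f x) * cis (- kdot k x))"
  for f :: "real^'d \<Rightarrow> real"
  using integrable_mult_cis[of f "-k"] by (simp add: kdot_uminus)

lemma fcoef_diff: "integrable tM f \<Longrightarrow> integrable tM g \<Longrightarrow> fcoef (\<lambda>x. f x - g x) k = fcoef f k - fcoef g k"
  by (simp add: fcoef_tM left_diff_distrib integrable_mult_cis' right_diff_distrib)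

lemma fcoef_add: "integrable tM f \<Longrightarrow> integrable tM g \<Longrightarrow> fcoef (\<lambda>x. f x + g x) k = fcoef f k + fcoef g k"
  by (simp add: fcoef_tM distrib_right integrable_mult_cis' distrib_left)

lemma fcoef_scale: "fcoef (\<lambda>x. c * f x) k = of_real c * fcoef f k"
  by (simp add: fcoef_tM mult.assoc)

lemma fcoef_uminus: "fcoef f (-k) = cnj (fcoef f k)"
  unfolding fcoef_tM by (simp add: kdot_uminus cis_cnj flip: Bochner_Integration.integral_cnj)

definition tpoly :: "(int^'d) set \<Rightarrow> (int^'d \<Rightarrow> complex) \<Rightarrow> real^'d \<Rightarrow> complex" where
  "tpoly F c x = (\<Sum>k\<in>F. c k * cis (kdot k x))"

lemma borel_measurable_tpoly [measurable]: "tpoly F c \<in> borel_measurable borel"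
  unfolding tpoly_def by measurable

lemma cmod_tpoly_le: "cmod (tpoly F c x) \<le> (\<Sum>k\<in>F. cmod (c k))"
  unfolding tpoly_def by (rule order_trans[OF norm_sum]) (simp add: norm_mult)

lemma integral_tpoly_cis:
  fixes k :: "int^'d" and c :: "int^'d \<Rightarrow> complex"
  assumes "finite F"
  shows "(\<integral>x. tpoly F c x * cis (- kdot k x) \<partial>tM) = (2*pi)^CARD('d) * (if k \<in> F then c k else 0)"
proof -
  have i: "integrable tM (\<lambda>x::real^'d. cis (kdot j x))" for j
    by (rule tM_integrable_bounded[where B=1]) auto
  have "(\<integral>x. tpoly F c x * cis (- kdot k x) \<partial>tM) = (\<integral>x. (\<Sum>j\<in>F. c j * cis (kdot (j - k) x)) \<partial>tM)"
    by (simp add: tpoly_def sum_distrib_right mult.assoc cis_mult kdot_diff)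
  also have "\<dots> = (\<Sum>j\<in>F. c j * (\<integral>x. cis (kdot (j - k) x) \<partial>tM))"
    by (subst Bochner_Integration.integral_sum) (auto simp: i)
  also have "\<dots> = (\<Sum>j\<in>F. if j = k then c j * complex_of_real ((2*pi)^CARD('d)) else 0)"
    by (intro sum.cong) (auto simp: integral_cis_kdot)
  also have "\<dots> = (2*pi)^CARD('d) * (if k \<in> F then c k else 0)"
    using assms by (simp add: sum.delta' mult.commute)
  finally show ?thesis .
qed

lemma integral_cmod_tpoly_sq:
  fixes c :: "int^'d \<Rightarrow> complex"
  assumes "finite F"
  shows "(\<integral>x. (cmod (tpoly F c x))^2 \<partial>tM) = (2*pi)^CARD('d) * (\<Sum>k\<in>F. (cmod (c k))^2)"
proof -
  have "complex_of_real (\<integral>x. (cmod (tpoly F c x))^2 \<partial>tM) = (\<integral>x. tpoly F c x * cnj (tpoly F c x) \<partial>tM)"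
    by (simp only: integral_complex_of_real[symmetric] complex_norm_square)
  also have "\<dots> = (\<integral>x. (\<Sum>k\<in>F. cnj (c k) * (tpoly F c x * cis (- kdot k x))) \<partial>tM)"
  proof (intro Bochner_Integration.integral_cong refl)
    fix x
    have "cnj (tpoly F c x) = (\<Sum>k\<in>F. cnj (c k) * cis (- kdot k x))"
      by (simp add: tpoly_def cis_cnj)
    then show "tpoly F c x * cnj (tpoly F c x) = (\<Sum>k\<in>F. cnj (c k) * (tpoly F c x * cis (- kdot k x)))"
      by (simp add: sum_distrib_left mult_ac)
  qed
  also have "\<dots> = (\<Sum>k\<in>F. cnj (c k) * (\<integral>x. tpoly F c x * cis (- kdot k x) \<partial>tM))"
  proof (subst Bochner_Integration.integral_sum)
    fix k
    have "(\<lambda>x. tpoly F c x * cis (kdot (-k) x)) \<in> borel_measurable tM" by measurable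
    then have "integrable tM (\<lambda>x. tpoly F c x * cis (kdot (-k) x))"
      by (rule tM_integrable_bounded[where B="\<Sum>k\<in>F. cmod (c k)"]) (simp add: norm_mult cmod_tpoly_le)
    then show "integrable tM (\<lambda>x. cnj (c k) * (tpoly F c x * cis (- kdot k x)))"
      by (simp add: kdot_uminus)
  qed simp
  also have "\<dots> = (\<Sum>k\<in>F. cnj (c k) * ((2*pi)^CARD('d) * c k))"
    by (simp add: integral_tpoly_cis assms)
  also have "\<dots> = complex_of_real ((2*pi)^CARD('d) * (\<Sum>k\<in>F. (cmod (c k))^2))"
    unfolding of_real_mult of_real_sum sum_distrib_left
    by (intro sum.cong refl) (simp only: complex_norm_square mult_ac)
  finally show ?thesis by (simp only: of_real_eq_iff)
qed

text \<open>Expansion of the nonnegative integral of |f - P|^2 with \<open>P\<close> the partial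
  Fourier sum over \<open>F\<close>: the cross term contributes -2 and the square of
  \<open>P\<close> contributes +1 times the same sum.\<close>

lemma bessel:
  fixes f :: "real^'d \<Rightarrow> real"
  assumes "f \<in> borel_measurable tM" "integrable tM (\<lambda>x. (f x)^2)" "finite F"
  shows "(2*pi)^CARD('d) * (\<Sum>k\<in>F. (cmod (fcoef f k))^2) \<le> (\<integral>x. (f x)^2 \<partial>tM)"
proof -
  note [measurable] = assms(1)
  let ?c = "fcoef f" and ?K = "(2*pi)^CARD('d) :: real"
  have K: "?K > 0" by simp
  have fi: "integrable tM f"
    using integrable_of_sq[of f "\<lambda>_. 1"] tM_integrable_bounded[of "\<lambda>_. 1::real" 1] assms by auto
  let ?P = "tpoly F ?c"
  have Pm: "?P \<in> borel_measurable tM" by measurable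
  note [measurable] = Pm
  have iP: "integrable tM (\<lambda>x. (cmod (?P x))^2)"
    by (rule tM_integrable_bounded[where B="(\<Sum>k\<in>F. cmod (?c k))^2"]) (auto intro!: power_mono cmod_tpoly_le)
  have ifP: "integrable tM (\<lambda>x. of_real (f x) * cnj (?P x))"
    unfolding tpoly_def
    by (simp add: sum_distrib_left cis_cnj mult.left_commute[of _ "cnj _"] mult.assoc integrable_mult_cis' fi)
  have I1: "(\<integral>x. of_real (f x) * cnj (?P x) \<partial>tM) = ?K * (\<Sum>k\<in>F. (cmod (?c k))^2)"
  proof -
    have "(\<integral>x. of_real (f x) * cnj (?P x) \<partial>tM) = (\<integral>x. (\<Sum>k\<in>F. cnj (?c k) * (of_real (f x) * cis (- kdot k x))) \<partial>tM)"
      unfolding tpoly_def by (simp add: sum_distrib_left cis_cnj mult_ac)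
    also have "\<dots> = (\<Sum>k\<in>F. cnj (?c k) * (\<integral>x. of_real (f x) * cis (- kdot k x) \<partial>tM))"
      by (subst Bochner_Integration.integral_sum) (auto simp: integrable_mult_cis' fi)
    also have "\<dots> = (\<Sum>k\<in>F. cnj (?c k) * (?K * ?c k))"
      by (intro sum.cong refl) (simp add: fcoef_tM)
    also have "\<dots> = ?K * (\<Sum>k\<in>F. (cmod (?c k))^2)"
      unfolding of_real_mult of_real_sum sum_distrib_left
      by (intro sum.cong refl) (simp only: complex_norm_square mult_ac)
    finally show ?thesis .
  qed
  have eq: "(cmod (of_real (f x) - ?P x))^2 = (f x)^2 - 2 * Re (of_real (f x) * cnj (?P x)) + (cmod (?P x))^2" for x
    unfolding cmod_power2 by (simp add: power2_eq_square algebra_simps)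
  have "0 \<le> (\<integral>x. (cmod (of_real (f x) - ?P x))^2 \<partial>tM)" by (rule integral_nonneg_AE) auto
  also have "\<dots> = (\<integral>x. (f x)^2 \<partial>tM) - 2 * Re (\<integral>x. of_real (f x) * cnj (?P x) \<partial>tM) + (\<integral>x. (cmod (?P x))^2 \<partial>tM)"
    unfolding eq using iP integrable_Re[OF ifP] assms(2) ifP
    by (simp add: integral_Re del: times_complex.simps complex_cnj Re_complex_of_real)
  also have "\<dots> = (\<integral>x. (f x)^2 \<partial>tM) - ?K * (\<Sum>k\<in>F. (cmod (?c k))^2)"
    unfolding I1 integral_cmod_tpoly_sq[OF assms(3)] by (simp only: Re_complex_of_real)
  finally show ?thesis by simp
qed

section \<open>Partial sums over balls and the Riesz-Fischer theorem\<close>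

definition ksqs :: "nat \<Rightarrow> (int^'d) set" where "ksqs n = {k. ksq k \<le> real n}"

lemma finite_ksqs [simp]: "finite (ksqs n)" unfolding ksqs_def by (rule finite_ksq_le)
lemma ksqs_mono: "m \<le> n \<Longrightarrow> ksqs m \<subseteq> ksqs n" by (auto simp: ksqs_def)
lemma uminus_ksqs: "uminus ` ksqs n = ksqs n"
proof (intro subset_antisym subsetI)
  fix k assume "k \<in> ksqs n"
  then have "- k \<in> ksqs n" by (simp add: ksqs_def)
  then show "k \<in> uminus ` ksqs n" by (rule rev_image_eqI) simp
qed (auto simp: ksqs_def)
lemma ksqs_cover: "\<exists>n. k \<in> ksqs n"
  using real_arch_simple[of "ksq k"] by (auto simp: ksqs_def)

definition psum :: "('d::finite) hl2 \<Rightarrow> nat \<Rightarrow> real^'d \<Rightarrow> real" where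
  "psum a n x = Re (tpoly (ksqs n) (cf a) x)"

text \<open>The balls are symmetric under negation, so the Hermitian condition pairs each term with
  its conjugate and the partial sum is real.\<close>

lemma of_real_psum: "complex_of_real (psum a n x) = tpoly (ksqs n) (cf a) x"
proof -
  have "cnj (tpoly (ksqs n) (cf a) x) = (\<Sum>k\<in>ksqs n. cf a (-k) * cis (kdot (-k) x))"
    by (simp add: tpoly_def cis_cnj cf_uminus kdot_uminus)
  also have "\<dots> = (\<Sum>k\<in>uminus ` ksqs n. cf a k * cis (kdot k x))"
    by (subst sum.reindex) (auto simp: inj_on_def)
  also have "\<dots> = tpoly (ksqs n) (cf a) x" by (simp add: uminus_ksqs tpoly_def)
  finally have "Im (tpoly (ksqs n) (cf a) x) = 0"
    by (simp add: complex_eq_iff)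
  then show ?thesis by (simp add: psum_def complex_eq_iff)
qed

lemma borel_measurable_psum [measurable]: "psum a n \<in> borel_measurable borel"
  unfolding psum_def by measurable

lemma psum_bounded: "\<bar>psum a n x\<bar> \<le> (\<Sum>k\<in>ksqs n. cmod (cf a k))"
  unfolding psum_def using abs_Re_le_cmod cmod_tpoly_le order_trans by blast

lemma kdot_shift: "cis (kdot k (x + (2*pi) *\<^sub>R axis i 1)) = cis (kdot k x)"
proof -
  have "kdot k (x + (2*pi) *\<^sub>R axis i 1) = kdot k x + 2 * pi * k $ i"
    unfolding kdot_inner by (simp add: inner_add_right inner_axis mult_ac)
  then show ?thesis by (simp add: cis_mult[symmetric] cis_multiple_2pi)
qed

lemma periodic_psum: "periodic_T (psum a n)"
  by (simp add: periodic_T_def psum_def tpoly_def kdot_shift)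

lemma integrable_psum: "integrable tM (psum a n)"
  by (rule tM_integrable_bounded[OF borel_tM]) (auto intro: psum_bounded)

lemma fcoef_psum: "fcoef (psum a n) k = (if k \<in> ksqs n then cf a k else 0)"
  unfolding fcoef_tM of_real_psum integral_tpoly_cis[OF finite_ksqs] by simp

lemma integral_psum_diff:
  fixes a :: "('d::finite) hl2"
  assumes "n \<le> m"
  shows "(\<integral>x. (psum a m x - psum a n x)^2 \<partial>tM) = (2*pi)^CARD('d) * (\<Sum>k\<in>ksqs m - ksqs n. (cmod (cf a k))^2)"
proof -
  have "tpoly (ksqs m) (cf a) x - tpoly (ksqs n) (cf a) x = tpoly (ksqs m - ksqs n) (cf a) x" for x
    unfolding tpoly_def using ksqs_mono[OF assms] by (subst sum_diff) auto
  then have "complex_of_real (psum a m x - psum a n x) = tpoly (ksqs m - ksqs n) (cf a) x" for x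
    by (simp add: of_real_psum)
  then have "(psum a m x - psum a n x)^2 = (cmod (tpoly (ksqs m - ksqs n) (cf a) x))^2" for x
    by (metis norm_of_real power2_abs)
  then show ?thesis by (simp add: integral_cmod_tpoly_sq)
qed

lemma hl2_tail:
  fixes a :: "('d::finite) hl2"
  assumes "e > 0"
  shows "\<exists>N. \<forall>n\<ge>N. \<forall>m\<ge>n. (\<Sum>k\<in>ksqs m - ksqs n. (cmod (cf a k))^2) < e"
proof -
  let ?s = "\<lambda>n. \<Sum>k\<in>ksqs n. (cmod (cf a k))^2"
  have "incseq ?s" by (intro monoI sum_mono2 ksqs_mono) auto
  moreover have "?s n \<le> (norm a)^2" for n by (rule hl2_sum_le_norm) simp
  ultimately have "convergent ?s" using incseq_convergent by (metis convergentI)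
  then have "Cauchy ?s" by (rule convergent_Cauchy)
  then obtain N where N: "\<And>m n. m \<ge> N \<Longrightarrow> n \<ge> N \<Longrightarrow> norm (?s m - ?s n) < e"
    using CauchyD assms by blast
  show ?thesis
  proof (intro exI allI impI)
    fix n m assume "N \<le> n" "n \<le> m"
    then have "(\<Sum>k\<in>ksqs m - ksqs n. (cmod (cf a k))^2) = ?s m - ?s n"
      by (intro sum_diff ksqs_mono) auto
    also have "\<dots> < e" using N[of m n] \<open>N \<le> n\<close> \<open>n \<le> m\<close> by auto
    finally show "(\<Sum>k\<in>ksqs m - ksqs n. (cmod (cf a k))^2) < e" .
  qed
qed

text \<open>A subsequence with geometrically small L2 gaps also has summable L1 gaps, hence
  converges almost everywhere. The subsequence is part of the conclusion because pointwise lower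
  bounds on partial sums are later passed on to \<open>f\<close>.\<close>

lemma riesz_fischer:
  fixes a :: "('d::finite) hl2"
  shows "\<exists>f r. L2T f \<and> (\<forall>k. fcoef f k = cf a k) \<and> (AE x in tM. (\<lambda>j. psum a (r j) x) \<longlonglongrightarrow> f x)"
proof -
  let ?K = "(2*pi)^CARD('d) :: real"
  have K: "?K > 0" by simp
  have "\<forall>j. \<exists>N. \<forall>n\<ge>N. \<forall>m\<ge>n. (\<Sum>k\<in>ksqs m - ksqs n. (cmod (cf a k))^2) < (1/4)^j / ?K"
    by (intro allI hl2_tail) (simp add: K)
  then obtain N where N: "\<And>j n m. n \<ge> N j \<Longrightarrow> m \<ge> n \<Longrightarrow> (\<Sum>k\<in>ksqs m - ksqs n. (cmod (cf a k))^2) < (1/4)^j / ?K"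
    by metis
  \<comment> \<open>The sum makes \<open>r\<close> monotone and at least \<open>N j\<close>; the
    summand \<open>j\<close> makes it exhaust all frequencies.\<close>
  define r where "r j = (\<Sum>i\<le>j. N i) + j" for j
  have rN: "N j \<le> r j" for j unfolding r_def by (intro trans_le_add1 member_le_sum) auto
  have rmono: "r i \<le> r j" if "i \<le> j" for i j
    unfolding r_def by (intro add_mono sum_mono2) (use that in auto)
  define p where "p j = psum a (r j)" for j
  have [measurable]: "p j \<in> borel_measurable borel" for j unfolding p_def by measurable
  have pm: "p j \<in> borel_measurable tM" for j by (rule borel_tM) simp
  note [measurable] = pm
  have isq: "integrable tM (\<lambda>x. (p m x - p j x)^2)" for m j
  proof (rule tM_integrable_bounded)
    fix x
    have "\<bar>p m x - p j x\<bar> \<le> (\<Sum>k\<in>ksqs (r m). cmod (cf a k)) + (\<Sum>k\<in>ksqs (r j). cmod (cf a k))"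
      unfolding p_def using psum_bounded[of a "r m" x] psum_bounded[of a "r j" x] by linarith
    from power_mono[OF this, of 2]
    show "norm ((p m x - p j x)^2) \<le> ((\<Sum>k\<in>ksqs (r m). cmod (cf a k)) + (\<Sum>k\<in>ksqs (r j). cmod (cf a k)))^2"
      by simp
  qed measurable
  have close: "(\<integral>x. (p m x - p j x)^2 \<partial>tM) \<le> (1/4)^j" if "j \<le> m" for m j
  proof -
    have "(\<integral>x. (p m x - p j x)^2 \<partial>tM) = ?K * (\<Sum>k\<in>ksqs (r m) - ksqs (r j). (cmod (cf a k))^2)"
      unfolding p_def by (rule integral_psum_diff) (rule rmono[OF that])
    also have "\<dots> \<le> ?K * ((1/4)^j / ?K)"
      by (intro mult_left_mono less_imp_le N rN rmono that) (simp add: K less_imp_le)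
    finally show ?thesis by simp
  qed
  let ?vol = "measure tM (space tM :: (real^'d) set)"
  have d1: "integrable tM (\<lambda>x. p (Suc j) x - p j x)" "(\<integral>x. \<bar>p (Suc j) x - p j x\<bar> \<partial>tM) \<le> (1 + ?vol) * (1/2)^j" for j
  proof -
    show "integrable tM (\<lambda>x. p (Suc j) x - p j x)" unfolding p_def by (intro Bochner_Integration.integrable_diff integrable_psum)
    \<comment> \<open>The weight \<open>2^j\<close> balances the squared gap of order 4^(-j) against
      the constant 2^(-j), so an L2 bound yields an L1 bound that is still geometric.\<close>
    have "(\<integral>x. \<bar>p (Suc j) x - p j x\<bar> \<partial>tM) \<le> (\<integral>x. 2^j * (p (Suc j) x - p j x)^2 + (1/2)^j \<partial>tM)"
    proof (rule integral_mono)
      fix x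
      define t where "t = \<bar>p (Suc j) x - p j x\<bar>"
      define Y where "Y = 2^j * t^2 + (1/2)^j"
      have Y0: "0 \<le> Y" unfolding Y_def by (intro add_nonneg_nonneg mult_nonneg_nonneg) auto
      have "0 \<le> (2^j * t - 1)^2" by simp
      then have "2^j * (2 * t) \<le> 2^j * Y"
        by (simp add: Y_def power2_eq_square algebra_simps power_one_over)
      then have "2 * t \<le> Y" by (rule mult_left_le_imp_le) auto
      with Y0 have "t \<le> Y" by linarith
      then show "\<bar>p (Suc j) x - p j x\<bar> \<le> 2^j * (p (Suc j) x - p j x)^2 + (1/2)^j"
        by (simp add: t_def Y_def)
    next
      show "integrable tM (\<lambda>x. 2^j * (p (Suc j) x - p j x)^2 + (1/2)^j)"
        by (intro Bochner_Integration.integrable_add integrable_mult_right isq tM_integrable_bounded[where B="(1/2)^j"]) auto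
    qed (simp add: \<open>integrable tM (\<lambda>x. p (Suc j) x - p j x)\<close>)
    also have "\<dots> = 2^j * (\<integral>x. (p (Suc j) x - p j x)^2 \<partial>tM) + ?vol * (1/2)^j"
      by (subst Bochner_Integration.integral_add) (auto intro!: isq tM_integrable_bounded[where B="(1/2)^j"] simp: mult.commute)
    also have "\<dots> \<le> 2^j * (1/4)^j + ?vol * (1/2)^j"
      using close[of j "Suc j"] by (intro add_mono mult_left_mono) auto
    also have "2^j * (1/4)^j = (1/2::real)^j" by (simp flip: power_mult_distrib)
    finally show "(\<integral>x. \<bar>p (Suc j) x - p j x\<bar> \<partial>tM) \<le> (1 + ?vol) * (1/2)^j" by (simp add: algebra_simps)
  qed
  have "AE x in tM. summable (\<lambda>j. p (Suc j) x - p j x)"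
  proof -
    have "(\<integral>\<^sup>+x. (\<Sum>j. ennreal \<bar>p (Suc j) x - p j x\<bar>) \<partial>tM) = (\<Sum>j. \<integral>\<^sup>+x. ennreal \<bar>p (Suc j) x - p j x\<bar> \<partial>tM)"
      by (rule nn_integral_suminf) measurable
    also have "\<dots> = (\<Sum>j. ennreal (\<integral>x. \<bar>p (Suc j) x - p j x\<bar> \<partial>tM))"
      by (intro suminf_cong nn_integral_eq_integral) (auto intro: d1)
    also have "\<dots> \<le> (\<Sum>j. ennreal ((1 + ?vol) * (1/2)^j))"
      by (intro suminf_le ennreal_leI d1) auto
    also have "\<dots> < \<infinity>"
    proof -
      have "summable (\<lambda>j. (1 + ?vol) * (1/2)^j)" by (intro summable_mult summable_geometric) auto
      then have "(\<Sum>j. ennreal ((1 + ?vol) * (1/2)^j)) = ennreal (\<Sum>j. (1 + ?vol) * (1/2)^j)"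
        by (intro suminf_ennreal2) (auto intro!: mult_nonneg_nonneg)
      then show ?thesis by simp
    qed
    finally have "AE x in tM. (\<Sum>j. ennreal \<bar>p (Suc j) x - p j x\<bar>) \<noteq> \<infinity>"
      by (intro nn_integral_noteq_infinite) auto
    then show ?thesis
    proof eventually_elim
      fix x assume "(\<Sum>j. ennreal \<bar>p (Suc j) x - p j x\<bar>) \<noteq> \<infinity>"
      then have "summable (\<lambda>j. \<bar>p (Suc j) x - p j x\<bar>)"
        by (intro summable_suminf_not_top) auto
      then show "summable (\<lambda>j. p (Suc j) x - p j x)" by (rule summable_rabs_cancel)
    qed
  qed
  define f where "f x = lim (\<lambda>j. p j x)" for x
  have conv: "AE x in tM. (\<lambda>j. p j x) \<longlonglongrightarrow> f x"
    using \<open>AE x in tM. summable (\<lambda>j. p (Suc j) x - p j x)\<close>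
  proof eventually_elim
    fix x assume "summable (\<lambda>j. p (Suc j) x - p j x)"
    then have "convergent (\<lambda>n. \<Sum>j<n. p (Suc j) x - p j x)" by (simp add: summable_iff_convergent)
    then have "convergent (\<lambda>n. (p n x - p 0 x) + p 0 x)"
      using sum_lessThan_telescope[of "\<lambda>j. p j x"] by (intro convergent_add convergent_const) simp
    then show "(\<lambda>j. p j x) \<longlonglongrightarrow> f x" unfolding f_def by (simp add: convergent_LIMSEQ_iff)
  qed
  have fb: "f \<in> borel_measurable borel" unfolding f_def by measurable
  have fm[measurable]: "f \<in> borel_measurable tM" by (rule borel_tM) (rule fb)
  have fper: "periodic_T f"
    by (simp add: periodic_T_def f_def p_def periodic_psum[unfolded periodic_T_def, rule_format])
  \<comment> \<open>Fatou's lemma along \<open>m\<close>: the gap bound between \<open>p m\<close>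
    and \<open>p j\<close> passes to the almost everywhere limit \<open>f\<close>.\<close>
  have nn: "(\<integral>\<^sup>+x. ennreal ((f x - p j x)^2) \<partial>tM) \<le> ennreal ((1/4)^j)" for j
  proof -
    have "(\<integral>\<^sup>+x. ennreal ((f x - p j x)^2) \<partial>tM) = (\<integral>\<^sup>+x. liminf (\<lambda>m. ennreal ((p m x - p j x)^2)) \<partial>tM)"
    proof (rule nn_integral_cong_AE)
      show "AE x in tM. ennreal ((f x - p j x)^2) = liminf (\<lambda>m. ennreal ((p m x - p j x)^2))"
        using conv
      proof eventually_elim
        fix x assume "(\<lambda>j. p j x) \<longlonglongrightarrow> f x"
        then have "(\<lambda>m. ennreal ((p m x - p j x)^2)) \<longlonglongrightarrow> ennreal ((f x - p j x)^2)"
          by (intro tendsto_intros)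
        then show "ennreal ((f x - p j x)^2) = liminf (\<lambda>m. ennreal ((p m x - p j x)^2))"
          using lim_imp_Liminf[OF sequentially_bot] by metis
      qed
    qed
    also have "\<dots> \<le> liminf (\<lambda>m. \<integral>\<^sup>+x. ennreal ((p m x - p j x)^2) \<partial>tM)"
      by (rule nn_integral_liminf) measurable
    also have "\<dots> \<le> ennreal ((1/4)^j)"
    proof (rule Liminf_le)
      show "\<forall>\<^sub>F m in sequentially. (\<integral>\<^sup>+x. ennreal ((p m x - p j x)^2) \<partial>tM) \<le> ennreal ((1/4)^j)"
        using eventually_ge_at_top[of j]
      proof eventually_elim
        fix m assume "j \<le> m"
        have "(\<integral>\<^sup>+x. ennreal ((p m x - p j x)^2) \<partial>tM) = ennreal (\<integral>x. (p m x - p j x)^2 \<partial>tM)"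
          by (rule nn_integral_eq_integral) (auto intro: isq)
        then show "(\<integral>\<^sup>+x. ennreal ((p m x - p j x)^2) \<partial>tM) \<le> ennreal ((1/4)^j)"
          using close[OF \<open>j \<le> m\<close>] by (simp add: ennreal_leI)
      qed
    qed simp
    finally show ?thesis .
  qed
  have fp: "integrable tM (\<lambda>x. (f x - p j x)^2)" "(\<integral>x. (f x - p j x)^2 \<partial>tM) \<le> (1/4)^j" for j
  proof -
    show i: "integrable tM (\<lambda>x. (f x - p j x)^2)"
      by (rule integrableI_nonneg) (use nn[of j] in \<open>auto intro: le_less_trans\<close>)
    have "ennreal (\<integral>x. (f x - p j x)^2 \<partial>tM) \<le> ennreal ((1/4)^j)"
      using nn[of j] by (subst nn_integral_eq_integral[symmetric]) (auto intro: i)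
    then show "(\<integral>x. (f x - p j x)^2 \<partial>tM) \<le> (1/4)^j" by simp
  qed
  have pL: "L2T (p j)" for j
    unfolding L2T_iff using periodic_psum[of a "r j"] borel_measurable_psum[of a "r j"]
    by (auto simp: p_def intro!: tM_integrable_bounded[where B="(\<Sum>k\<in>ksqs (r j). cmod (cf a k))^2"] borel_tM borel_measurable_power
         borel_measurable_subalgebra[of lborel lebesgue] power_mono[OF psum_bounded, where n=2, simplified])
  have dL: "L2T (\<lambda>x. f x - p 0 x)"
    unfolding L2T_iff using fper periodic_psum[of a "r 0"] fp(1)[of 0] fb
    by (auto simp: periodic_T_def p_def intro!: borel_measurable_diff borel_measurable_subalgebra[of lborel lebesgue])
  have fL: "L2T f" using L2T_add[OF dL pL[of 0]] by simp
  have "fcoef f k = cf a k" for k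
  proof -
    obtain n0 where n0: "k \<in> ksqs n0" using ksqs_cover by blast
    \<comment> \<open>Bessel for the single mode \<open>k\<close> of \<open>f - p j\<close>, whose
      coefficient there no longer depends on \<open>j\<close> once the ball contains
      \<open>k\<close>.\<close>
    have "cmod (fcoef f k - cf a k) ^ 2 \<le> (1/4)^j / ?K" if "j \<ge> n0" for j
    proof -
      have "n0 \<le> r j" using that by (simp add: r_def)
      then have "k \<in> ksqs (r j)" using n0 ksqs_mono by blast
      then have "fcoef (\<lambda>x. f x - p j x) k = fcoef f k - cf a k"
        unfolding p_def by (subst fcoef_diff) (auto simp: fcoef_psum integrable_psum intro: L2T_integrable fL)
      then have "?K * (cmod (fcoef f k - cf a k))^2 \<le> (\<integral>x. (f x - p j x)^2 \<partial>tM)"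
        using bessel[of "\<lambda>x. f x - p j x" "{k}"] fp(1)[of j] by simp
      also have "\<dots> \<le> (1/4)^j" by (rule fp)
      finally show ?thesis using K by (simp add: field_simps)
    qed
    moreover have "(\<lambda>j. (1/4)^j / ?K) \<longlonglongrightarrow> 0 / ?K"
      by (intro tendsto_divide LIMSEQ_realpow_zero tendsto_const) (use K in auto)
    ultimately have "cmod (fcoef f k - cf a k) ^ 2 \<le> 0"
      by (intro LIMSEQ_le_const[of "\<lambda>j. (1/4)^j / ?K"]) auto
    then show ?thesis by simp
  qed
  with fL conv show ?thesis unfolding p_def by blast
qed

section \<open>Trigonometric polynomials\<close>

text \<open>Generated as a linear span, without products, so that inductions over operators and
  impulses have only four cases; closure under products follows from the product-to-sum formulas in
  \<open>trig_mult\<close>.\<close>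

inductive trig :: "(real^'d \<Rightarrow> real) \<Rightarrow> bool" where
  cos: "trig (\<lambda>x. cos (kdot k x))"
| sin: "trig (\<lambda>x. sin (kdot k x))"
| scale: "trig \<phi> \<Longrightarrow> trig (\<lambda>x. c * \<phi> x)"
| add: "trig \<phi> \<Longrightarrow> trig \<psi> \<Longrightarrow> trig (\<lambda>x. \<phi> x + \<psi> x)"

lemma trig_const: "trig (\<lambda>x. c)"
  using trig.scale[OF trig.cos[of 0], of c] by simp

lemma trig_sum: "(\<And>i. i \<in> I \<Longrightarrow> trig (\<phi> i)) \<Longrightarrow> trig (\<lambda>x. \<Sum>i\<in>I. \<phi> i x)"
  by (induction I rule: infinite_finite_induct) (auto intro: trig_const trig.add)

lemma trig_diff: "trig \<phi> \<Longrightarrow> trig \<psi> \<Longrightarrow> trig (\<lambda>x. \<phi> x - \<psi> x)"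
  using trig.add[OF _ trig.scale[of \<psi> "-1"], of \<phi>] by simp

lemma trig_cos_mult: "trig \<psi> \<Longrightarrow> trig (\<lambda>x. cos (kdot k x) * \<psi> x)"
proof (induction rule: trig.induct)
  case (cos l)
  have "(\<lambda>x. cos (kdot k x) * cos (kdot l x)) = (\<lambda>x. 1/2 * (cos (kdot (k - l) x) + cos (kdot (k + l) x)))"
    by (auto simp: kdot_add kdot_diff cos_times_cos)
  then show ?case by (simp only:) (intro trig.scale trig.add trig.cos)
next
  case (sin l)
  have "(\<lambda>x. cos (kdot k x) * sin (kdot l x)) = (\<lambda>x. 1/2 * (sin (kdot (k + l) x) - sin (kdot (k - l) x)))"
    by (auto simp: kdot_add kdot_diff cos_times_sin)
  then show ?case by (simp only:) (intro trig.scale trig_diff trig.sin)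
next
  case (scale \<phi> c)
  then show ?case using trig.scale[OF scale.IH, of c] by (simp add: mult.left_commute)
next
  case (add \<phi> \<psi>)
  then show ?case using trig.add[OF add.IH] by (simp add: distrib_left)
qed

lemma trig_sin_mult: "trig \<psi> \<Longrightarrow> trig (\<lambda>x. sin (kdot k x) * \<psi> x)"
proof (induction rule: trig.induct)
  case (cos l)
  show ?case using trig_cos_mult[OF trig.sin[of k], of l] by (simp add: mult.commute)
next
  case (sin l)
  have "(\<lambda>x. sin (kdot k x) * sin (kdot l x)) = (\<lambda>x. 1/2 * (cos (kdot (k - l) x) - cos (kdot (k + l) x)))"
    by (auto simp: kdot_add kdot_diff sin_times_sin)
  then show ?case by (simp only:) (intro trig.scale trig_diff trig.cos)
next
  case (scale \<phi> c)
  then show ?case using trig.scale[OF scale.IH, of c] by (simp add: mult.left_commute)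
next
  case (add \<phi> \<psi>)
  then show ?case using trig.add[OF add.IH] by (simp add: distrib_left)
qed

lemma trig_mult: "trig \<phi> \<Longrightarrow> trig \<psi> \<Longrightarrow> trig (\<lambda>x. \<phi> x * \<psi> x)"
proof (induction rule: trig.induct)
  case (scale \<phi> c)
  then show ?case using trig.scale[OF scale.IH, of c] by (simp add: mult.assoc)
next
  case (add \<phi> \<phi>')
  then show ?case using trig.add[OF add.IH] by (simp add: distrib_right)
qed (auto intro: trig_cos_mult trig_sin_mult)

lemma kdot_axis: "kdot (axis i 1) x = x $ i"
proof -
  have "kdot (axis i 1) x = (\<Sum>j\<in>UNIV. if j = i then x $ j else 0)"
    unfolding kdot_def by (intro sum.cong) (auto simp: axis_def)
  then show ?thesis by simp
qed

lemma trig_cos_nth: "trig (\<lambda>x. cos (x $ i))" and trig_sin_nth: "trig (\<lambda>x. sin (x $ i))"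
  using trig.cos[of "axis i 1"] trig.sin[of "axis i 1"] by (simp_all add: kdot_axis)

lemma trig_bounded: "trig \<phi> \<Longrightarrow> \<exists>B. \<forall>x. \<bar>\<phi> x\<bar> \<le> B"
proof (induction rule: trig.induct)
  case (scale \<phi> c)
  then obtain B where "\<bar>\<phi> x\<bar> \<le> B" for x by blast
  then have "\<bar>c * \<phi> x\<bar> \<le> \<bar>c\<bar> * B" for x by (simp add: abs_mult mult_left_mono)
  then show ?case by blast
next
  case (add \<phi> \<psi>)
  then obtain B C where "\<bar>\<phi> x\<bar> \<le> B" "\<bar>\<psi> x\<bar> \<le> C" for x by blast
  then have "\<bar>\<phi> x + \<psi> x\<bar> \<le> B + C" for x by (meson abs_triangle_ineq add_mono order_trans)
  then show ?case by blast
qed (auto intro!: exI[of _ 1])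

lemma trig_continuous: "trig \<phi> \<Longrightarrow> continuous_on S \<phi>"
  by (induction rule: trig.induct) (auto intro!: continuous_intros)

lemma trig_measurable: "trig \<phi> \<Longrightarrow> \<phi> \<in> borel_measurable borel"
  by (intro borel_measurable_continuous_onI trig_continuous)

lemma trig_measurable_lebesgue: "trig \<phi> \<Longrightarrow> \<phi> \<in> borel_measurable lebesgue"
  by (intro borel_measurable_subalgebra[of lborel lebesgue \<phi>]) (auto intro: trig_measurable)

lemma trig_measurable_tM: "trig \<phi> \<Longrightarrow> \<phi> \<in> borel_measurable tM"
  by (intro borel_tM trig_measurable)

lemma trig_periodic: "trig \<phi> \<Longrightarrow> periodic_T \<phi>"
proof (induction rule: trig.induct)
  case (cos k)
  show ?case by (simp add: periodic_T_def arg_cong[OF kdot_shift, of Re, simplified])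
next
  case (sin k)
  show ?case by (simp add: periodic_T_def arg_cong[OF kdot_shift, of Im, simplified])
qed (auto simp: periodic_T_def)

section \<open>Density of trigonometric polynomials\<close>

definition circ :: "real^'d \<Rightarrow> (real^'d) \<times> (real^'d)" where
  "circ x = ((\<chi> i. cos (x $ i)), (\<chi> i. sin (x $ i)))"

lemma trig_comp_circ: "real_polynomial_function p \<Longrightarrow> trig (\<lambda>x. p (circ x))"
proof (induction rule: real_polynomial_function.induct)
  case (linear f)
  interpret bounded_linear f by fact
  have "f (circ x) = (\<Sum>i\<in>UNIV. f (axis i 1, 0) * cos (x $ i)) + (\<Sum>i\<in>UNIV. f (0, axis i 1) * sin (x $ i))" for x
  proof -
    have 1: "(\<chi> i. cos (x $ i)) = (\<Sum>i\<in>UNIV. cos (x $ i) *\<^sub>R axis i 1)"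
      and 2: "(\<chi> i. sin (x $ i)) = (\<Sum>i\<in>UNIV. sin (x $ i) *\<^sub>R axis i 1)"
      using basis_expansion[of "\<chi> i. cos (x $ i)"] basis_expansion[of "\<chi> i. sin (x $ i)"]
      by (simp_all add: scalar_mult_eq_scaleR)
    have "circ x = (\<Sum>i\<in>UNIV. cos (x $ i) *\<^sub>R (axis i 1, 0)) + (\<Sum>i\<in>UNIV. sin (x $ i) *\<^sub>R (0, axis i 1))"
      by (intro prod_eqI) (simp_all add: circ_def 1 2 fst_sum snd_sum)
    then show ?thesis by (simp add: add sum scaleR mult.commute del: scaleR_Pair)
  qed
  then show ?case
    by (simp only:) (intro trig.add trig_sum trig.scale trig_cos_nth trig_sin_nth)
qed (auto intro: trig_const trig.add trig_mult)

lemma continuous_circ: "continuous_on S circ"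
  unfolding circ_def by (intro continuous_intros)

lemma cos_sin_eq_cases:
  assumes "cos s = cos t" "sin s = sin t" "0 \<le> s" "s \<le> 2*pi" "0 \<le> t" "t \<le> 2*pi"
  shows "s = t \<or> (s = 0 \<and> t = 2*pi) \<or> (s = 2*pi \<and> t = 0)"
proof -
  obtain n :: int where n: "s = t + 2 * pi * n" using assms(1,2) sin_cos_eq_iff by metis
  have "\<bar>2 * pi * real_of_int n\<bar> \<le> 2 * pi" using assms(3-6) n by linarith
  then have "2 * pi * \<bar>real_of_int n\<bar> \<le> 2 * pi * 1" by (simp add: abs_mult)
  then have "\<bar>real_of_int n\<bar> \<le> 1" by (subst (asm) mult_le_cancel_left_pos) auto
  then have "n = 0 \<or> n = 1 \<or> n = -1" by linarith
  then show ?thesis using n assms by (auto simp: algebra_simps)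
qed

text \<open>\<open>circ\<close> embeds the torus in Euclidean space and identifies only opposite
  faces of the cube, where \<open>g\<close> vanishes. So \<open>g\<close> descends to a continuous
  function on a compact set, and Stone-Weierstrass supplies a polynomial in the cosines and
  sines.\<close>

lemma trig_uniform_approx:
  fixes g :: "real^'d \<Rightarrow> real"
  assumes g: "continuous_on tcube g" and z: "\<And>x i. x \<in> tcube \<Longrightarrow> x $ i = 0 \<or> x $ i = 2*pi \<Longrightarrow> g x = 0"
    and e: "e > 0"
  shows "\<exists>\<phi>. trig \<phi> \<and> (\<forall>x\<in>tcube. \<bar>\<phi> x - g x\<bar> < e)"
proof -
  let ?K = "circ ` (tcube :: (real^'d) set)"
  have K: "compact ?K" by (intro compact_continuous_image continuous_circ compact_tcube)
  have inj: "g x = g y" if "x \<in> tcube" "y \<in> tcube" "circ x = circ y" for x y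
  proof (cases "x = y")
    case False
    then obtain i where i: "x $ i \<noteq> y $ i" by (auto simp: vec_eq_iff)
    have "cos (x $ i) = cos (y $ i)" "sin (x $ i) = sin (y $ i)"
      using that(3) by (auto simp: circ_def vec_eq_iff)
    then have "x $ i = y $ i \<or> (x $ i = 0 \<and> y $ i = 2*pi) \<or> (x $ i = 2*pi \<and> y $ i = 0)"
      by (rule cos_sin_eq_cases) (use that in \<open>auto simp: tcube_def\<close>)
    then show ?thesis using i z[OF that(1), of i] z[OF that(2), of i] by auto
  qed simp
  define G where "G y = g (SOME x. x \<in> tcube \<and> circ x = y)" for y
  have G: "G (circ x) = g x" if "x \<in> tcube" for x
  proof -
    have "(SOME x'. x' \<in> tcube \<and> circ x' = circ x) \<in> tcube \<and> circ (SOME x'. x' \<in> tcube \<and> circ x' = circ x) = circ x"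
      by (rule someI[of _ x]) (use that in simp)
    then show ?thesis unfolding G_def using inj that by blast
  qed
  \<comment> \<open>A continuous map on a compact set is closed: the preimage of \<open>B\<close>
    under \<open>G\<close> is the image of the compact preimage under \<open>g\<close>.\<close>
  have "continuous_on ?K G"
    unfolding continuous_on_closed_vimage[OF compact_imp_closed[OF K]]
  proof (intro allI impI)
    fix B :: "real set" assume B: "closed B"
    have "G -` B \<inter> ?K = circ ` (g -` B \<inter> tcube)" using G by auto
    moreover have "closed (g -` B \<inter> tcube)"
      using g B continuous_on_closed_vimage[OF compact_imp_closed[OF compact_tcube]] by blast
    then have "compact (g -` B \<inter> tcube)"
      using closed_Int_compact[OF _ compact_tcube, of "g -` B \<inter> tcube"] by (simp add: Int_assoc)
    ultimately show "closed (G -` B \<inter> ?K)"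
      by (simp add: compact_imp_closed compact_continuous_image continuous_circ)
  qed
  then obtain p where p: "real_polynomial_function p" "\<And>y. y \<in> ?K \<Longrightarrow> \<bar>G y - p y\<bar> < e"
    using Stone_Weierstrass_real_polynomial_function[OF K _ e] by metis
  have "\<bar>p (circ x) - g x\<bar> < e" if "x \<in> tcube" for x
    using p(2)[of "circ x"] that by (simp add: G abs_minus_commute)
  then show ?thesis using trig_comp_circ[OF p(1)] by blast
qed

text \<open>A measurable function is an almost everywhere limit of continuous ones. The bound is
  uniform in \<open>n\<close> so that dominated convergence applies later; the extra 1 absorbs the
  error of the uniform approximation.\<close>

lemma trig_approx_AE:
  fixes m :: "real^'d \<Rightarrow> real"
  assumes m: "m \<in> borel_measurable tM" and B: "\<And>x. \<bar>m x\<bar> \<le> B"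
  shows "\<exists>\<phi>. (\<forall>n. trig (\<phi> n)) \<and> (\<forall>n. \<forall>x\<in>tcube. \<bar>\<phi> n x\<bar> \<le> B + 1) \<and> (AE x in tM. (\<lambda>n. \<phi> n x) \<longlonglongrightarrow> m x)"
proof -
  have B0: "0 \<le> B" using B[of 0] by linarith
  obtain N g where N: "negligible N" and g: "\<And>n. continuous_on UNIV (g n :: real^'d \<Rightarrow> real)"
    and lim: "\<And>x. x \<notin> N \<Longrightarrow> (\<lambda>n. g n x) \<longlonglongrightarrow> (if x \<in> tcube then m x else 0)"
    using m measurable_on_iff_borel_measurable[of tcube m] unfolding measurable_on_def by auto
  define U :: "(real^'d) set" where "U = box 0 (\<chi> i. 2*pi)"
  \<comment> \<open>Clipping enforces the bound \<open>B\<close>; the second factor vanishes on the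
    faces of the cube, as uniform approximation requires, and at each interior point it is
    eventually 1.\<close>
  define h where "h n x = max (-B) (min B (g n x)) * min 1 (real n * infdist x (- U))" for n x
  have U: "- U \<noteq> {}" "closed (- U)"
  proof -
    have "0 \<notin> U" by (simp add: U_def mem_box_cart)
    then show "- U \<noteq> {}" by blast
  qed (auto simp: U_def intro: open_box)
  have hc: "continuous_on tcube (h n)" for n
    unfolding h_def by (intro continuous_intros continuous_on_subset[OF g]) auto
  have hz: "h n x = 0" if "x \<in> tcube" "x $ i = 0 \<or> x $ i = 2*pi" for n x i
  proof -
    have "x \<in> - U" using that(2) by (auto simp: U_def mem_box_cart intro!: exI[of _ i])
    then show ?thesis by (simp add: h_def)
  qed
  have hb: "\<bar>h n x\<bar> \<le> B" for n x
  proof -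
    have 1: "\<bar>max (-B) (min B (g n x))\<bar> \<le> B" using B0 by (auto simp: max_def min_def)
    have 2: "\<bar>min 1 (real n * infdist x (- U))\<bar> \<le> 1" by (auto simp: min_def infdist_nonneg)
    have "\<bar>h n x\<bar> \<le> B * 1" unfolding h_def abs_mult by (intro mult_mono 1 2) (use B0 in auto)
    then show ?thesis by simp
  qed
  have "\<forall>n. \<exists>\<phi>. trig \<phi> \<and> (\<forall>x\<in>tcube. \<bar>\<phi> x - h n x\<bar> < inverse (real (Suc n)))"
    by (intro allI trig_uniform_approx hc hz) auto
  then obtain \<phi> where \<phi>: "\<And>n. trig (\<phi> n)" "\<And>n x. x \<in> tcube \<Longrightarrow> \<bar>\<phi> n x - h n x\<bar> < inverse (real (Suc n))"
    by metis
  have "\<bar>\<phi> n x\<bar> \<le> B + 1" if "x \<in> tcube" for n x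
  proof -
    have "inverse (real (Suc n)) \<le> 1" by (simp add: field_simps)
    then show ?thesis using \<phi>(2)[OF that, of n] hb[of n x] by linarith
  qed
  moreover have "AE x in tM. (\<lambda>n. \<phi> n x) \<longlonglongrightarrow> m x"
  proof -
    have neg: "negligible (N \<union> (tcube - U))"
      unfolding tcube_cbox U_def using N negligible_frontier_interval by (auto simp: negligible_Un)
    have "AE x in lebesgue. x \<notin> N \<union> (tcube - U)"
      using neg by (intro AE_not_in) (simp add: negligible_iff_null_sets)
    then have "AE x in lebesgue. x \<in> tcube \<longrightarrow> x \<notin> N \<union> (tcube - U)" by eventually_elim blast
    then have "AE x in tM. x \<notin> N \<union> (tcube - U)" by (subst AE_restrict_space_iff) simp_all
    moreover have "AE x in tM. x \<in> tcube" by (auto intro: AE_I2)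
    ultimately show ?thesis
    proof eventually_elim
      fix x assume x: "x \<notin> N \<union> (tcube - U)" "x \<in> tcube"
      then have xU: "x \<in> U" and xN: "x \<notin> N" by auto
      have gl: "(\<lambda>n. g n x) \<longlonglongrightarrow> m x" using lim[OF xN] x by simp
      have "infdist x (- U) > 0"
        using U xU in_closed_iff_infdist_zero[of "-U" x] infdist_nonneg[of x "-U"] by force
      then obtain n0 where n0: "1 < real n0 * infdist x (- U)" using reals_Archimedean3 by blast
      have "\<forall>\<^sub>F n in sequentially. max (-B) (min B (g n x)) = h n x"
        using eventually_ge_at_top[of n0]
      proof eventually_elim
        fix n assume "n0 \<le> n"
        then have "real n0 * infdist x (- U) \<le> real n * infdist x (- U)"
          by (intro mult_right_mono infdist_nonneg) auto
        then show "max (-B) (min B (g n x)) = h n x" using n0 by (simp add: h_def)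
      qed
      moreover have "(\<lambda>n. max (-B) (min B (g n x))) \<longlonglongrightarrow> max (-B) (min B (m x))"
        by (intro tendsto_intros gl)
      moreover have "max (-B) (min B (m x)) = m x" using B[of x] by auto
      ultimately have hl: "(\<lambda>n. h n x) \<longlonglongrightarrow> m x" by (metis Lim_transform_eventually)
      have "(\<lambda>n. \<phi> n x - h n x) \<longlonglongrightarrow> 0"
      proof (rule tendsto_rabs_zero_cancel, rule tendsto_sandwich[OF _ _ tendsto_const LIMSEQ_inverse_real_of_nat])
        show "\<forall>\<^sub>F n in sequentially. \<bar>\<phi> n x - h n x\<bar> \<le> inverse (real (Suc n))"
          using \<phi>(2)[OF x(2)] by (auto intro!: always_eventually less_imp_le)
      qed auto
      from tendsto_add[OF this hl] show "(\<lambda>n. \<phi> n x) \<longlonglongrightarrow> m x" by simp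
    qed
  qed
  ultimately show ?thesis using \<phi>(1) by blast
qed

lemma integrable_mult_bounded:
  fixes f \<phi> :: "real^'d \<Rightarrow> real"
  assumes f: "integrable tM f" and m: "\<phi> \<in> borel_measurable tM" and b: "\<And>x. \<bar>\<phi> x\<bar> \<le> B"
  shows "integrable tM (\<lambda>x. f x * \<phi> x)"
proof (rule Bochner_Integration.integrable_bound)
  show "integrable tM (\<lambda>x. B * f x)" using f by simp
  have "0 \<le> B" using b[of 0] by linarith
  then show "AE x in tM. norm (f x * \<phi> x) \<le> norm (B * f x)"
    by (auto simp: abs_mult mult.commute intro!: mult_right_mono b)
  have [measurable]: "f \<in> borel_measurable tM" using f by auto
  note [measurable] = m
  show "(\<lambda>x. f x * \<phi> x) \<in> borel_measurable tM" by measurable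
qed

lemma integrable_mult_trig: "integrable tM f \<Longrightarrow> trig \<phi> \<Longrightarrow> integrable tM (\<lambda>x. f x * \<phi> x)"
  using trig_bounded trig_measurable_tM integrable_mult_bounded by metis

lemma integral_mult_trig_eq_0:
  fixes f :: "real^'d \<Rightarrow> real"
  assumes f: "integrable tM f" and z: "\<And>k. fcoef f k = 0" and t: "trig \<phi>"
  shows "(\<integral>x. f x * \<phi> x \<partial>tM) = 0"
proof -
  have c: "(\<integral>x. of_real (f x) * cis (- kdot k x) \<partial>tM) = 0" for k
    using z[of k] by (simp add: fcoef_tM)
  show ?thesis
    using t
  proof (induction rule: trig.induct)
    case (cos k)
    then show ?case
      using arg_cong[OF c[of k], of Re] integral_Re[OF integrable_mult_cis'[OF f, of k]] by simp
  next
    case (sin k)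
    then show ?case
      using arg_cong[OF c[of k], of Im] integral_Im[OF integrable_mult_cis'[OF f, of k]] by simp
  next
    case (scale \<phi> c)
    then show ?case by (simp add: mult.left_commute)
  next
    case (add \<phi> \<psi>)
    then show ?case by (simp add: distrib_left integrable_mult_trig[OF f])
  qed
qed

text \<open>\<open>f\<close> is orthogonal to all trigonometric polynomials. Those approximating
  \<open>sgn f\<close> boundedly show that the integral of |f| vanishes.\<close>

lemma fcoef_eq_0_imp_AE:
  fixes f :: "real^'d \<Rightarrow> real"
  assumes f: "integrable tM f" and z: "\<And>k. fcoef f k = 0"
  shows "AE x in tM. f x = 0"
proof -
  have [measurable]: "f \<in> borel_measurable tM" using f by auto
  have "(\<lambda>x. sgn (f x)) \<in> borel_measurable tM" by measurable
  moreover have "\<bar>sgn (f x)\<bar> \<le> 1" for x by (simp add: sgn_if)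
  ultimately obtain \<phi> where \<phi>: "\<And>n. trig (\<phi> n)" "\<And>n x. x \<in> tcube \<Longrightarrow> \<bar>\<phi> n x\<bar> \<le> 1 + 1"
    and lim: "AE x in tM. (\<lambda>n. \<phi> n x) \<longlonglongrightarrow> sgn (f x)"
    using trig_approx_AE[of "\<lambda>x. sgn (f x)" 1] by blast
  note [measurable] = trig_measurable_tM[OF \<phi>(1)]
  have "(\<lambda>n. \<integral>x. f x * \<phi> n x \<partial>tM) \<longlonglongrightarrow> (\<integral>x. f x * sgn (f x) \<partial>tM)"
  proof (rule integral_dominated_convergence)
    show "integrable tM (\<lambda>x. \<bar>f x\<bar> * 2)" using f by simp
    show "AE x in tM. (\<lambda>n. f x * \<phi> n x) \<longlonglongrightarrow> f x * sgn (f x)"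
      using lim by eventually_elim (intro tendsto_intros)
    show "AE x in tM. norm (f x * \<phi> n x) \<le> \<bar>f x\<bar> * 2" for n
      by (rule AE_I2) (use \<phi>(2) in \<open>auto simp: abs_mult intro!: mult_left_mono\<close>)
  qed measurable
  then have "(\<integral>x. f x * sgn (f x) \<partial>tM) = 0"
    using integral_mult_trig_eq_0[OF f z \<phi>(1)] LIMSEQ_unique[OF _ tendsto_const] by simp
  then have "(\<integral>x. \<bar>f x\<bar> \<partial>tM) = 0" by (simp add: abs_sgn)
  then show ?thesis using integral_nonneg_eq_0_iff_AE[of tM "\<lambda>x. \<bar>f x\<bar>"] f by simp
qed

lemma L2T_eq_AE:
  assumes "L2T f" "L2T g" "\<And>k. fcoef f k = fcoef g k"
  shows "AE x in tM. f x = g x"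
  using fcoef_eq_0_imp_AE[of "\<lambda>x. f x - g x"] assms by (auto simp: L2T_integrable fcoef_diff)

section \<open>Multiplication operators on Fourier coefficients\<close>

definition hat :: "(real^'d \<Rightarrow> real) \<Rightarrow> ('d::finite) hl2" where "hat f = Hl2 (fcoef f)"

text \<open>A chosen representative, determined only up to null sets; pointwise statements about it
  are therefore always made almost everywhere.\<close>

definition RF :: "('d::finite) hl2 \<Rightarrow> real^'d \<Rightarrow> real" where
  "RF a = (SOME f. L2T f \<and> (\<forall>k. fcoef f k = cf a k))"

lemma L2T_bessel:
  fixes f :: "real^'d \<Rightarrow> real"
  assumes "L2T f" "finite F"
  shows "(\<Sum>k\<in>F. (cmod (fcoef f k))^2) \<le> (\<integral>x. (f x)^2 \<partial>tM) / (2*pi)^CARD('d)"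
  using bessel[of f F] assms by (simp add: L2T_iff L2T_measurable field_simps)

lemma cf_hat: "L2T f \<Longrightarrow> cf (hat f) k = fcoef f k"
  unfolding hat_def by (rule cf_Hl2[OF fcoef_uminus L2T_bessel])

lemma norm_hat_le:
  fixes f :: "real^'d \<Rightarrow> real"
  assumes "L2T f"
  shows "norm (hat f) \<le> sqrt ((\<integral>x. (f x)^2 \<partial>tM) / (2*pi)^CARD('d))"
proof (rule hl2_norm_leI)
  have "0 \<le> (\<integral>x. (f x)^2 \<partial>tM) / (2*pi)^CARD('d)" by (intro divide_nonneg_nonneg integral_nonneg_AE) auto
  then show "0 \<le> sqrt ((\<integral>x. (f x)^2 \<partial>tM) / (2*pi)^CARD('d))"
    "\<And>F. finite F \<Longrightarrow> (\<Sum>k\<in>F. (cmod (cf (hat f) k))^2) \<le> (sqrt ((\<integral>x. (f x)^2 \<partial>tM) / (2*pi)^CARD('d)))^2"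
    using L2T_bessel[OF assms] by (simp_all add: cf_hat assms)
qed

lemma hat_add: "L2T f \<Longrightarrow> L2T g \<Longrightarrow> hat (\<lambda>x. f x + g x) = hat f + hat g"
  by (rule hl2_eqI) (simp add: cf_hat L2T_add fcoef_add L2T_integrable)

lemma hat_diff: "L2T f \<Longrightarrow> L2T g \<Longrightarrow> hat (\<lambda>x. f x - g x) = hat f - hat g"
  by (rule hl2_eqI) (simp add: cf_hat L2T_diff fcoef_diff L2T_integrable)

lemma hat_scale: "L2T f \<Longrightarrow> hat (\<lambda>x. c * f x) = c *\<^sub>R hat f"
  by (rule hl2_eqI) (simp add: cf_hat L2T_scale fcoef_scale)

lemma RF: "L2T (RF a)" "fcoef (RF a) k = cf a k"
proof -
  have "\<exists>f. L2T f \<and> (\<forall>k. fcoef f k = cf a k)" using riesz_fischer[of a] by blast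
  from someI_ex[OF this, folded RF_def] show "L2T (RF a)" "fcoef (RF a) k = cf a k" by auto
qed

lemma hat_RF [simp]: "hat (RF a) = a"
  by (rule hl2_eqI) (simp add: cf_hat RF)

lemma L2T_zero: "L2T (\<lambda>x. 0)"
  using L2T_scale[OF RF(1), of 0] by simp

lemma hat_zero: "hat (\<lambda>x. 0) = 0"
  using hat_scale[OF RF(1), of 0] by simp

lemma L2T_sum: "(\<And>i. i \<in> I \<Longrightarrow> L2T (f i)) \<Longrightarrow> L2T (\<lambda>x. \<Sum>i\<in>I. f i x)"
  by (induction I rule: infinite_finite_induct) (auto intro: L2T_zero L2T_add)

lemma hat_sum: "(\<And>i. i \<in> I \<Longrightarrow> L2T (f i)) \<Longrightarrow> hat (\<lambda>x. \<Sum>i\<in>I. f i x) = (\<Sum>i\<in>I. hat (f i))"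
  by (induction I rule: infinite_finite_induct) (auto simp: hat_zero hat_add L2T_sum)

lemma hat_eq_imp_AE: "L2T f \<Longrightarrow> L2T g \<Longrightarrow> hat f = hat g \<Longrightarrow> AE x in tM. f x = g x"
  by (rule L2T_eq_AE) (auto simp flip: cf_hat)

lemma RF_AE_psum: "\<exists>r. AE x in tM. (\<lambda>j. psum a (r j) x) \<longlonglongrightarrow> RF a x"
proof -
  obtain f r where f: "L2T f" "\<And>k. fcoef f k = cf a k" and r: "AE x in tM. (\<lambda>j. psum a (r j) x) \<longlonglongrightarrow> f x"
    using riesz_fischer[of a] by blast
  have "AE x in tM. f x = RF a x" by (rule L2T_eq_AE) (auto simp: f RF)
  with r have "AE x in tM. (\<lambda>j. psum a (r j) x) \<longlonglongrightarrow> RF a x" by eventually_elim simp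
  then show ?thesis by blast
qed

section \<open>The smoothing operator (1 - Laplacian)^(-1/2), frequency shifts and multiplication
  operators\<close>

abbreviation NN :: "('d::finite) hl2 \<Rightarrow> 'd hl2" where "NN \<equiv> dg (\<lambda>k. 1 / lamk k)"

lemma mult_sym_N [simp]: "mult_sym (\<lambda>k. 1 / lamk k)"
  by (rule mult_symI[where B=1]) (use lamk_ge_1 in \<open>auto simp: abs_of_nonneg less_imp_le divide_le_eq_1\<close>)

lemma cf_NN [simp]: "cf (NN a) k = cf a k / lamk k"
  by (simp add: cf_dg)

lemma norm_NN_le: "norm (NN a) \<le> norm a"
  using norm_dg_le[of "\<lambda>k. 1 / lamk k" 1 a] lamk_ge_1
  by (auto simp: abs_of_nonneg less_imp_le divide_le_eq_1)

lemma ksq_add_le: "ksq (k + l) \<le> 2 * ksq k + 2 * ksq l"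
proof -
  have "(x + y)^2 \<le> 2 * x^2 + 2 * y^2" for x y :: real
    using sum_squares_bound[of x y] by (simp add: power2_sum)
  then show ?thesis
    unfolding ksq_def sum_distrib_left sum.distrib[symmetric] by (intro sum_mono) simp
qed

text \<open>A Peetre-type inequality: a fixed shift of the frequency changes the Sobolev weight by a
  bounded factor, which is why multiplication by a character is bounded on H1.\<close>

lemma lamk_ratio: "lamk (k + l) / lamk k \<le> sqrt (2 + 2 * ksq l)"
proof -
  have "1 + ksq (k + l) \<le> (2 + 2 * ksq l) * (1 + ksq k)"
  proof -
    have "0 \<le> ksq l * ksq k" by simp
    moreover have "(2 + 2 * ksq l) * (1 + ksq k) = 2 + 2 * ksq k + 2 * ksq l + 2 * (ksq l * ksq k)"
      by (simp add: algebra_simps)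
    ultimately show ?thesis using ksq_add_le[of k l] by linarith
  qed
  then have "lamk (k + l) \<le> sqrt (2 + 2 * ksq l) * lamk k"
    unfolding lamk_def by (subst real_sqrt_mult[symmetric]) simp
  then show ?thesis by (simp add: pos_divide_le_eq)
qed

text \<open>The second summand is the one that the Hermitian condition forces once the first is
  given. The coefficient may depend on the frequency so that conjugates by the Sobolev weight have
  the same shape.\<close>

definition shift_op :: "int^'d \<Rightarrow> (int^'d \<Rightarrow> complex) \<Rightarrow> ('d::finite) hl2 \<Rightarrow> 'd hl2" where
  "shift_op l p a = Hl2 (\<lambda>k. p k * cf a (k - l) + cnj (p (-k)) * cf a (k + l))"

lemma
  assumes p: "\<And>k. cmod (p k) \<le> B"
  shows cf_shift_op: "cf (shift_op l p a) k = p k * cf a (k - l) + cnj (p (-k)) * cf a (k + l)"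
    and bounded_linear_shift_op: "bounded_linear (shift_op l p)"
proof -
  have B0: "0 \<le> B" using p[of undefined] norm_ge_zero order_trans by blast
  have herm: "p (-k) * cf a (-k - l) + cnj (p (- (-k))) * cf a (-k + l) = cnj (p k * cf a (k - l) + cnj (p (-k)) * cf a (k + l))" for a k
    using cf_uminus[of a "k + l"] cf_uminus[of a "k - l"] by (simp add: minus_diff_commute)
  have bd: "(\<Sum>k\<in>F. (cmod (p k * cf a (k - l) + cnj (p (-k)) * cf a (k + l)))^2) \<le> (2 * B * norm a)^2"
    if "finite F" for F a
  proof -
    have sh: "(\<Sum>k\<in>F. (cmod (cf a (k + m)))^2) \<le> (norm a)^2" for m
    proof -
      have "(\<Sum>k\<in>F. (cmod (cf a (k + m)))^2) = (\<Sum>k\<in>(\<lambda>k. k + m) ` F. (cmod (cf a k))^2)"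
        by (subst sum.reindex) (auto simp: inj_on_def)
      also have "\<dots> \<le> (norm a)^2" by (rule hl2_sum_le_norm) (simp add: that)
      finally show ?thesis .
    qed
    have "(cmod (p k * cf a (k - l) + cnj (p (-k)) * cf a (k + l)))^2
        \<le> 2 * B^2 * (cmod (cf a (k + (-l))))^2 + 2 * B^2 * (cmod (cf a (k + l)))^2" for k
    proof -
      have "cmod (p k * cf a (k - l) + cnj (p (-k)) * cf a (k + l)) \<le> B * cmod (cf a (k + (-l))) + B * cmod (cf a (k + l))"
        by (rule order_trans[OF norm_triangle_ineq]) (auto simp: norm_mult intro!: add_mono mult_right_mono p)
      from power_mono[OF this, of 2]
      have "(cmod (p k * cf a (k - l) + cnj (p (-k)) * cf a (k + l)))^2 \<le> (B * cmod (cf a (k + (-l))) + B * cmod (cf a (k + l)))^2"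
        by simp
      also have "\<dots> \<le> 2 * (B * cmod (cf a (k + (-l))))^2 + 2 * (B * cmod (cf a (k + l)))^2"
        using sum_squares_bound[of "B * cmod (cf a (k + (-l)))" "B * cmod (cf a (k + l))"] by (simp add: power2_sum)
      finally show ?thesis by (simp add: power_mult_distrib)
    qed
    then have "(\<Sum>k\<in>F. (cmod (p k * cf a (k - l) + cnj (p (-k)) * cf a (k + l)))^2)
        \<le> (\<Sum>k\<in>F. 2 * B^2 * (cmod (cf a (k + (-l))))^2 + 2 * B^2 * (cmod (cf a (k + l)))^2)"
      by (rule sum_mono)
    also have "\<dots> = 2 * B^2 * (\<Sum>k\<in>F. (cmod (cf a (k + (-l))))^2) + 2 * B^2 * (\<Sum>k\<in>F. (cmod (cf a (k + l)))^2)"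
      by (simp add: sum.distrib sum_distrib_left)
    also have "\<dots> \<le> 2 * B^2 * (norm a)^2 + 2 * B^2 * (norm a)^2"
      by (intro add_mono mult_left_mono sh) auto
    finally show ?thesis by (simp add: power_mult_distrib)
  qed
  show cfs: "cf (shift_op l p a) k = p k * cf a (k - l) + cnj (p (-k)) * cf a (k + l)" for a k
    unfolding shift_op_def by (rule cf_Hl2[where C="(2 * B * norm a)^2"]) (use herm bd in auto)
  show "bounded_linear (shift_op l p)"
  proof (rule bounded_linear_intro[where K="2*B"])
    fix a :: "'a hl2" show "norm (shift_op l p a) \<le> norm a * (2 * B)"
      by (rule hl2_norm_leI) (use B0 bd cfs in \<open>auto simp: mult_ac\<close>)
  qed (auto intro!: hl2_eqI simp: cfs algebra_simps)
qed

definition Mop :: "(real^'d \<Rightarrow> real) \<Rightarrow> ('d::finite) hl2 \<Rightarrow> 'd hl2" where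
  "Mop \<phi> a = hat (\<lambda>x. \<phi> x * RF a x)"

lemma L2T_trig_mult: "trig \<phi> \<Longrightarrow> L2T f \<Longrightarrow> L2T (\<lambda>x. \<phi> x * f x)"
  using trig_bounded trig_periodic trig_measurable_lebesgue L2T_mult_bounded by metis

lemma fcoef_cos_mult:
  assumes "integrable tM f"
  shows "fcoef (\<lambda>x. cos (kdot l x) * f x) k = (fcoef f (k - l) + fcoef f (k + l)) / 2"
proof -
  have "complex_of_real (cos (kdot l x) * f x) * cis (- kdot k x)
      = (of_real (f x) * cis (- kdot (k - l) x) + of_real (f x) * cis (- kdot (k + l) x)) / 2" for x
    by (simp add: complex_eq_iff kdot_add kdot_diff cos_add cos_diff sin_add sin_diff algebra_simps)
  then show ?thesis
    unfolding fcoef_tM by (simp add: integrable_mult_cis'[OF assms] algebra_simps add_divide_distrib)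
qed

lemma fcoef_sin_mult:
  assumes "integrable tM f"
  shows "fcoef (\<lambda>x. sin (kdot l x) * f x) k = - \<i> / 2 * fcoef f (k - l) + \<i> / 2 * fcoef f (k + l)"
proof -
  have eq: "complex_of_real (sin (kdot l x) * f x) * cis (- kdot k x)
      = - \<i> / 2 * (of_real (f x) * cis (- kdot (k - l) x)) + \<i> / 2 * (of_real (f x) * cis (- kdot (k + l) x))" for x
    by (simp add: complex_eq_iff kdot_add kdot_diff cos_add cos_diff sin_add sin_diff field_simps)
  show ?thesis
    unfolding fcoef_tM eq by (simp add: integrable_mult_cis'[OF assms] algebra_simps)
qed

lemma hat_cos_mult: "L2T f \<Longrightarrow> hat (\<lambda>x. cos (kdot l x) * f x) = shift_op l (\<lambda>_. 1/2) (hat f)"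
  by (rule hl2_eqI)
     (simp add: cf_hat cf_shift_op[where B=1] L2T_trig_mult[OF trig.cos] fcoef_cos_mult L2T_integrable add_divide_distrib)

lemma hat_sin_mult: "L2T f \<Longrightarrow> hat (\<lambda>x. sin (kdot l x) * f x) = shift_op l (\<lambda>_. - \<i>/2) (hat f)"
  by (rule hl2_eqI)
     (simp add: cf_hat cf_shift_op[where B=1] L2T_trig_mult[OF trig.sin] fcoef_sin_mult L2T_integrable)

text \<open>Moving the shift past \<open>NN\<close> replaces the constant \<open>c\<close> by
  \<open>c\<close> times a quotient of weights, bounded by \<open>lamk_ratio\<close>.\<close>

lemma shift_op_NN:
  fixes l :: "int^'d::finite"
  shows "\<exists>Q. bounded_linear Q \<and> (\<forall>b. shift_op l (\<lambda>_. c) (NN b) = NN (Q b))"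
proof -
  define p where "p k = c * of_real (lamk k / lamk (k - l))" for k
  define B where "B = cmod c * sqrt (2 + 2 * ksq l)"
  have pB: "cmod (p k) \<le> B" for k
    using lamk_ratio[of "k - l" l] unfolding p_def B_def norm_mult norm_of_real
    by (intro mult_left_mono) (auto simp: abs_of_nonneg less_imp_le)
  have "lamk (-k - l) = lamk (k + l)" for k using lamk_uminus[of "k + l"] by simp
  then have "shift_op l (\<lambda>_. c) (NN b) = NN (shift_op l p b)" for b
    by (intro hl2_eqI) (simp add: cf_shift_op[of p, OF pB] cf_shift_op[of "\<lambda>_. c" "cmod c"] p_def field_simps)
  then show ?thesis using bounded_linear_shift_op[of p, OF pB] by blast
qed

text \<open>The second operator expresses boundedness on \<open>H1\<close>, whose elements have coefficients \<open>NN b\<close>.\<close>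
lemma trig_operator:
  fixes \<phi> :: "real^'d \<Rightarrow> real"
  assumes "trig \<phi>"
  shows "\<exists>Q Q1. bounded_linear Q \<and> bounded_linear Q1 \<and> (\<forall>f. L2T f \<longrightarrow> hat (\<lambda>x. \<phi> x * f x) = Q (hat f)) \<and>
    (\<forall>b. Q (NN b) = NN (Q1 b))"
  using assms
proof (induction rule: trig.induct)
  case (cos k)
  then show ?case
    using hat_cos_mult shift_op_NN[of k "1/2"] bounded_linear_shift_op[of "\<lambda>_. 1/2" 1 k] by fastforce
next
  case (sin k)
  then show ?case
    using hat_sin_mult shift_op_NN[of k "-\<i>/2"] bounded_linear_shift_op[of "\<lambda>_. -\<i>/2" 1 k] by fastforce
next
  case (scale \<phi> c)
  then obtain Q Q1 where Q: "bounded_linear Q" "bounded_linear Q1" "\<forall>f. L2T f \<longrightarrow> hat (\<lambda>x. \<phi> x * f x) = Q (hat f)"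
    "\<forall>b. Q (NN b) = NN (Q1 b)" by blast
  have "bounded_linear (\<lambda>a. c *\<^sub>R Q a)" "bounded_linear (\<lambda>a. c *\<^sub>R Q1 a)"
    using Q(1,2) by (auto intro: bounded_linear_compose[OF bounded_linear_scaleR_right])
  moreover have "L2T f \<Longrightarrow> hat (\<lambda>x. c * \<phi> x * f x) = c *\<^sub>R Q (hat f)" for f
    using hat_scale[OF L2T_trig_mult[OF scale.hyps]] Q(3) by (simp add: mult.assoc)
  moreover have "c *\<^sub>R Q (NN b) = NN (c *\<^sub>R Q1 b)" for b
    using Q(4) by (auto intro!: hl2_eqI)
  ultimately show ?case by (intro exI[of _ "\<lambda>a. c *\<^sub>R Q a"] exI[of _ "\<lambda>a. c *\<^sub>R Q1 a"]) simp
next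
  case (add \<phi> \<psi>)
  then obtain Q Q1 R R1 where Q: "bounded_linear Q" "bounded_linear Q1" "\<forall>f. L2T f \<longrightarrow> hat (\<lambda>x. \<phi> x * f x) = Q (hat f)"
    "\<forall>b. Q (NN b) = NN (Q1 b)" and R: "bounded_linear R" "bounded_linear R1" "\<forall>f. L2T f \<longrightarrow> hat (\<lambda>x. \<psi> x * f x) = R (hat f)"
    "\<forall>b. R (NN b) = NN (R1 b)" by blast
  have "bounded_linear (\<lambda>a. Q a + R a)" "bounded_linear (\<lambda>a. Q1 a + R1 a)"
    using Q(1,2) R(1,2) by (auto intro: bounded_linear_add)
  moreover have "L2T f \<Longrightarrow> hat (\<lambda>x. (\<phi> x + \<psi> x) * f x) = Q (hat f) + R (hat f)" for f
    using hat_add[OF L2T_trig_mult[OF add.hyps(1)] L2T_trig_mult[OF add.hyps(2)], of f f] Q(3) R(3)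
    by (simp add: distrib_right)
  moreover have "Q (NN b) + R (NN b) = NN (Q1 b + R1 b)" for b
    using Q(4) R(4) by (auto intro!: hl2_eqI simp: add_divide_distrib)
  ultimately show ?case by (intro exI[of _ "\<lambda>a. Q a + R a"] exI[of _ "\<lambda>a. Q1 a + R1 a"]) simp
qed

text \<open>The first conclusion frees \<open>Mop\<close> from the representative used in its
  definition: any L2 function with the given coefficients yields the same product. The last one is
  boundedness on H1.\<close>

lemma
  assumes "trig \<phi>"
  shows Mop_hat: "L2T f \<Longrightarrow> hat (\<lambda>x. \<phi> x * f x) = Mop \<phi> (hat f)"
    and bounded_linear_Mop: "bounded_linear (Mop \<phi>)"
    and Mop_NN: "\<exists>Q1. bounded_linear Q1 \<and> (\<forall>b. Mop \<phi> (NN b) = NN (Q1 b))"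
proof -
  obtain Q Q1 where Q: "bounded_linear Q" "bounded_linear Q1" "\<And>f. L2T f \<Longrightarrow> hat (\<lambda>x. \<phi> x * f x) = Q (hat f)"
    "\<And>b. Q (NN b) = NN (Q1 b)" using trig_operator[OF assms] by blast
  have "Mop \<phi> = Q" unfolding Mop_def by (rule ext) (simp add: Q(3)[OF RF(1)])
  with Q show "L2T f \<Longrightarrow> hat (\<lambda>x. \<phi> x * f x) = Mop \<phi> (hat f)" "bounded_linear (Mop \<phi>)"
    "\<exists>Q1. bounded_linear Q1 \<and> (\<forall>b. Mop \<phi> (NN b) = NN (Q1 b))" by auto
qed

lemma Mop_add: "trig \<phi> \<Longrightarrow> trig \<psi> \<Longrightarrow> Mop (\<lambda>x. \<phi> x + \<psi> x) a = Mop \<phi> a + Mop \<psi> a"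
  unfolding Mop_def by (simp add: distrib_right hat_add L2T_trig_mult RF)

lemma Mop_scale: "trig \<phi> \<Longrightarrow> Mop (\<lambda>x. c * \<phi> x) a = c *\<^sub>R Mop \<phi> a"
  unfolding Mop_def by (simp add: mult.assoc hat_scale L2T_trig_mult RF)

lemma Mop_mult: "trig \<phi> \<Longrightarrow> trig \<psi> \<Longrightarrow> Mop (\<lambda>x. \<phi> x * \<psi> x) a = Mop \<phi> (Mop \<psi> a)"
proof -
  assume t: "trig \<phi>" "trig \<psi>"
  have "Mop (\<lambda>x. \<phi> x * \<psi> x) a = hat (\<lambda>x. \<phi> x * (\<psi> x * RF a x))" unfolding Mop_def by (simp add: mult.assoc)
  also have "\<dots> = Mop \<phi> (Mop \<psi> a)" unfolding Mop_def[of \<psi>] by (rule Mop_hat) (auto intro: t L2T_trig_mult RF)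
  finally show ?thesis .
qed

lemma Mop_one [simp]: "Mop (\<lambda>x. 1) a = a"
  unfolding Mop_def by simp

lemma trig_qpot: "trig (qpot c)"
  unfolding qpot_def by (intro trig.add trig_const trig_sum trig.scale trig_cos_nth trig_sin_nth)

lemma qpot_scaleR: "qpot (s *\<^sub>R c) = (\<lambda>x. s * qpot c x)"
  by (rule ext) (simp add: qpot_def algebra_simps sum_distrib_left)

text \<open>The ideal multiplier is g/w, which exists almost everywhere but may be unbounded. It is
  truncated first and then replaced by a trigonometric polynomial.\<close>

lemma mult_trig_dense:
  fixes w g :: "real^'d \<Rightarrow> real"
  assumes w: "L2T w" and g: "L2T g" and nz: "AE x in tM. w x \<noteq> 0" and e: "e > 0"
  shows "\<exists>\<phi>. trig \<phi> \<and> (\<integral>x. (g x - \<phi> x * w x)^2 \<partial>tM) < e"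
proof -
  note [measurable] = L2T_measurable[OF w] L2T_measurable[OF g]
  have iw: "integrable tM (\<lambda>x. (w x)^2)" and ig: "integrable tM (\<lambda>x. (g x)^2)" using w g by (auto simp: L2T_iff)
  \<comment> \<open>Truncation at height \<open>n\<close> keeps |m w| below |g|, so a multiple of
    g^2 dominates the error.\<close>
  define m where "m n x = max (- real n) (min (real n) (g x / w x))" for n x
  have [measurable]: "m n \<in> borel_measurable tM" for n unfolding m_def by measurable
  have mb: "\<bar>m n x\<bar> \<le> real n" for n x by (auto simp: m_def)
  have sq: "(u + v)^2 \<le> 2 * u^2 + 2 * v^2" for u v :: real
    using sum_squares_bound[of u v] by (simp add: power2_sum)
  have mg: "\<bar>m n x * w x\<bar> \<le> \<bar>g x\<bar>" if "w x \<noteq> 0" for n x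
  proof -
    have clamp: "\<bar>max (-a) (min a t)\<bar> \<le> \<bar>t\<bar>" if "0 \<le> a" for a t :: real
      using that by (auto simp: max_def min_def abs_if)
    have "\<bar>m n x\<bar> \<le> \<bar>g x / w x\<bar>" unfolding m_def by (rule clamp) simp
    then have "\<bar>m n x\<bar> * \<bar>w x\<bar> \<le> \<bar>g x / w x\<bar> * \<bar>w x\<bar>" by (rule mult_right_mono) simp
    then show ?thesis using that by (simp add: abs_mult abs_divide)
  qed
  have "(\<lambda>n. \<integral>x. (g x - m n x * w x)^2 \<partial>tM) \<longlonglongrightarrow> (\<integral>x. 0 \<partial>(tM :: (real^'d) measure))"
  proof (rule integral_dominated_convergence)
    show "integrable tM (\<lambda>x. 4 * (g x)^2)" using ig by simp
    show "AE x in tM. (\<lambda>n. (g x - m n x * w x)^2) \<longlonglongrightarrow> 0"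
      using nz
    proof eventually_elim
      fix x assume wx: "w x \<noteq> 0"
      obtain n0 where n0: "\<bar>g x / w x\<bar> \<le> real n0" using real_arch_simple by blast
      have "\<forall>\<^sub>F n in sequentially. (g x - m n x * w x)^2 = 0"
        using eventually_ge_at_top[of n0]
      proof eventually_elim
        fix n assume "n0 \<le> n"
        then have "\<bar>g x / w x\<bar> \<le> real n" using n0 by linarith
        then have "m n x = g x / w x" unfolding m_def abs_le_iff by linarith
        then show "(g x - m n x * w x)^2 = 0" using wx by simp
      qed
      then show "(\<lambda>n. (g x - m n x * w x)^2) \<longlonglongrightarrow> 0" by (rule tendsto_eventually)
    qed
    show "AE x in tM. norm ((g x - m n x * w x)^2) \<le> 4 * (g x)^2" for n
      using nz
    proof eventually_elim
      fix x assume "w x \<noteq> 0"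
      then have "(m n x * w x)^2 \<le> (g x)^2" using mg[of x n] by (simp add: abs_le_square_iff)
      then show "norm ((g x - m n x * w x)^2) \<le> 4 * (g x)^2" using sq[of "g x" "- (m n x * w x)"] by simp
    qed
  qed measurable
  then have "\<forall>\<^sub>F n in sequentially. (\<integral>x. (g x - m n x * w x)^2 \<partial>tM) < e/4"
    using e by (intro order_tendstoD(2)) auto
  then obtain n where n: "(\<integral>x. (g x - m n x * w x)^2 \<partial>tM) < e/4"
    by (auto simp: eventually_sequentially)
  \<comment> \<open>For fixed \<open>n\<close> the approximants are uniformly bounded, so a constant
    times w^2 dominates. The two errors e/4 double when added, which gives \<open>e\<close>.\<close>
  obtain \<phi> where \<phi>: "\<And>j. trig (\<phi> j)" "\<And>j x. x \<in> tcube \<Longrightarrow> \<bar>\<phi> j x\<bar> \<le> real n + 1"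
    and lim: "AE x in tM. (\<lambda>j. \<phi> j x) \<longlonglongrightarrow> m n x"
    using trig_approx_AE[of "m n" "real n"] mb \<open>m n \<in> borel_measurable tM\<close> by blast
  note [measurable] = trig_measurable_tM[OF \<phi>(1)]
  have bnd: "((m n x - \<phi> j x) * w x)^2 \<le> (2 * real n + 1)^2 * (w x)^2" if "x \<in> tcube" for j x
  proof -
    have "\<bar>m n x - \<phi> j x\<bar> \<le> 2 * real n + 1" using mb[of n x] \<phi>(2)[OF that, of j] by linarith
    from power_mono[OF this, of 2] show ?thesis by (auto simp: power_mult_distrib intro!: mult_right_mono)
  qed
  have dom: "integrable tM (\<lambda>x. (2 * real n + 1)^2 * (w x)^2)" using iw by simp
  have bAE: "AE x in tM. norm (((m n x - \<phi> j x) * w x)^2) \<le> (2 * real n + 1)^2 * (w x)^2" for j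
    by (rule AE_I2) (use bnd in simp)
  have "(\<lambda>j. \<integral>x. ((m n x - \<phi> j x) * w x)^2 \<partial>tM) \<longlonglongrightarrow> (\<integral>x. ((m n x - m n x) * w x)^2 \<partial>tM)"
  proof (rule integral_dominated_convergence[OF _ _ dom _ bAE])
    show "AE x in tM. (\<lambda>j. ((m n x - \<phi> j x) * w x)^2) \<longlonglongrightarrow> ((m n x - m n x) * w x)^2"
      using lim by eventually_elim (intro tendsto_intros)
  qed measurable
  then have "\<forall>\<^sub>F j in sequentially. (\<integral>x. ((m n x - \<phi> j x) * w x)^2 \<partial>tM) < e/4"
    using e by (intro order_tendstoD(2)) auto
  then obtain j where j: "(\<integral>x. ((m n x - \<phi> j x) * w x)^2 \<partial>tM) < e/4"
    by (auto simp: eventually_sequentially)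
  have i1: "integrable tM (\<lambda>x. (g x - m n x * w x)^2)"
  proof (rule Bochner_Integration.integrable_bound)
    show "integrable tM (\<lambda>x. 2 * (g x)^2 + 2 * ((real n)^2 * (w x)^2))" using ig iw by simp
    show "AE x in tM. norm ((g x - m n x * w x)^2) \<le> norm (2 * (g x)^2 + 2 * ((real n)^2 * (w x)^2))"
    proof (rule AE_I2)
      fix x
      have "(m n x)^2 \<le> (real n)^2" using power_mono[OF mb[of n x], of 2] by simp
      then have "(m n x * w x)^2 \<le> (real n)^2 * (w x)^2" by (simp add: power_mult_distrib mult_right_mono)
      then show "norm ((g x - m n x * w x)^2) \<le> norm (2 * (g x)^2 + 2 * ((real n)^2 * (w x)^2))"
        using sq[of "g x" "- (m n x * w x)"] by simp
    qed
  qed measurable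
  have i2: "integrable tM (\<lambda>x. ((m n x - \<phi> j x) * w x)^2)"
    by (rule Bochner_Integration.integrable_bound[OF dom]) (measurable, use bAE[of j] in auto)
  have "(\<integral>x. (g x - \<phi> j x * w x)^2 \<partial>tM) \<le> (\<integral>x. 2 * (g x - m n x * w x)^2 + 2 * ((m n x - \<phi> j x) * w x)^2 \<partial>tM)"
  proof (rule integral_mono')
    show "integrable tM (\<lambda>x. 2 * (g x - m n x * w x)^2 + 2 * ((m n x - \<phi> j x) * w x)^2)" using i1 i2 by simp
    fix x show "(g x - \<phi> j x * w x)^2 \<le> 2 * (g x - m n x * w x)^2 + 2 * ((m n x - \<phi> j x) * w x)^2"
      using sq[of "g x - m n x * w x" "(m n x - \<phi> j x) * w x"] by (simp add: algebra_simps)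
  qed simp
  also have "\<dots> < e" using n j i1 i2 by simp
  finally show ?thesis using \<phi>(1) by blast
qed

lemma Mop_dense:
  fixes a b :: "('d::finite) hl2"
  assumes nz: "AE x in tM. RF a x \<noteq> 0" and e: "e > 0"
  shows "\<exists>\<phi>. trig \<phi> \<and> norm (b - Mop \<phi> a) < e"
proof -
  have K: "(2*pi)^CARD('d) > 0" by simp
  obtain \<phi> where \<phi>: "trig \<phi>" "(\<integral>x. (RF b x - \<phi> x * RF a x)^2 \<partial>tM) < e^2 * (2*pi)^CARD('d)"
    using mult_trig_dense[OF RF(1) RF(1) nz, of "e^2 * (2*pi)^CARD('d)" b] e K by auto
  have L: "L2T (\<lambda>x. \<phi> x * RF a x)" by (intro L2T_trig_mult \<phi> RF)
  have "b - Mop \<phi> a = hat (\<lambda>x. RF b x - \<phi> x * RF a x)"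
    using hat_diff[OF RF(1) L, of b] by (simp add: Mop_def)
  also have "norm \<dots> \<le> sqrt ((\<integral>x. (RF b x - \<phi> x * RF a x)^2 \<partial>tM) / (2*pi)^CARD('d))"
    by (intro norm_hat_le L2T_diff L RF)
  also have "\<dots> < sqrt (e^2)"
    using \<phi>(2) K by (intro real_sqrt_less_mono) (simp add: pos_divide_less_eq)
  finally show ?thesis using \<phi>(1) e by auto
qed

section \<open>From the cube to the whole space\<close>

lemma periodic_int_translate:
  assumes p: "periodic_T f"
  shows "f (x + (2*pi) *\<^sub>R (\<chi> i. real_of_int (z $ i))) = f x"
proof -
  have s: "f (x + (2*pi) *\<^sub>R (of_int n *\<^sub>R axis i 1)) = f x" for x and n :: int and i
  proof (induction n arbitrary: x rule: int_induct[where k=0])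
    case (step1 n)
    show ?case using step1.IH[of "x + (2*pi) *\<^sub>R axis i 1"] p
      by (simp add: periodic_T_def algebra_simps)
  next
    case (step2 n)
    have "f (x - (2*pi) *\<^sub>R axis i 1) = f x" for x
      using p[unfolded periodic_T_def, rule_format, of "x - (2*pi) *\<^sub>R axis i 1" i] by simp
    then show ?case using step2.IH[of "x - (2*pi) *\<^sub>R axis i 1"] 
      by (simp add: algebra_simps)
  qed simp
  have "f (x + (2*pi) *\<^sub>R (\<Sum>i\<in>I. of_int (z $ i) *\<^sub>R axis i 1)) = f x" if "finite I" for I x
    using that
  proof (induction I arbitrary: x rule: finite_induct)
    case (insert i I)
    then show ?case
      using insert.IH[of "x + (2*pi) *\<^sub>R (of_int (z $ i) *\<^sub>R axis i 1)"] s[of x "z $ i" i]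
      by (simp add: scaleR_add_right add.assoc)
  qed simp
  moreover have "(\<chi> i. real_of_int (z $ i)) = (\<Sum>i\<in>UNIV. of_int (z $ i) *\<^sub>R axis i 1)"
    using basis_expansion[of "\<chi> i. real_of_int (z $ i)"] by (simp add: scalar_mult_eq_scaleR)
  ultimately show ?thesis by simp
qed

text \<open>By periodicity the exceptional set is covered by the translates of one null set by the
  countable period lattice.\<close>

lemma AE_tM_imp_AE_lebesgue:
  fixes f :: "real^'d \<Rightarrow> real"
  assumes p: "periodic_T f" and ae: "AE x in tM. f x = 0"
  shows "AE x in lebesgue. f x = 0"
proof -
  have "AE x in lebesgue. x \<in> tcube \<longrightarrow> f x = 0" using ae by (simp add: AE_restrict_space_iff)
  then obtain N where N: "N \<in> null_sets lebesgue" "{x. \<not> (x \<in> tcube \<longrightarrow> f x = 0)} \<subseteq> N"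
    unfolding eventually_ae_filter by auto
  define tr :: "int^'d \<Rightarrow> real^'d" where "tr z = (2*pi) *\<^sub>R (\<chi> i. real_of_int (z $ i))" for z
  have neg: "negligible (\<Union>z. (+) (tr z) ` N)"
  proof (rule negligible_countable_Union)
    show "countable (range (\<lambda>z. (+) (tr z) ` N))" by (rule countable_image) simp
  qed (use N(1) in \<open>auto simp: negligible_iff_null_sets[symmetric] intro: negligible_translation\<close>)
  have "{x. f x \<noteq> 0} \<subseteq> (\<Union>z. (+) (tr z) ` N)"
  proof
    fix x assume "x \<in> {x. f x \<noteq> 0}"
    then have fx: "f x \<noteq> 0" by simp
    define z :: "int^'d" where "z = (\<chi> i. \<lfloor>x $ i / (2*pi)\<rfloor>)"
    define y where "y = x - tr z"
    have "0 \<le> y $ i \<and> y $ i \<le> 2*pi" for i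
    proof -
      define q where "q = x $ i / (2*pi)"
      have x: "x $ i = 2*pi * q" by (simp add: q_def)
      have "2*pi * of_int \<lfloor>q\<rfloor> \<le> 2*pi * q" "2*pi * q \<le> 2*pi * (of_int \<lfloor>q\<rfloor> + 1)"
        by (intro mult_left_mono; use real_of_int_floor_add_one_ge[of q] in simp)+
      then have "2*pi * of_int \<lfloor>x $ i / (2*pi)\<rfloor> \<le> x $ i" "x $ i \<le> 2*pi * (of_int \<lfloor>x $ i / (2*pi)\<rfloor> + 1)"
        unfolding x[symmetric] q_def by auto
      then show ?thesis by (simp add: y_def tr_def z_def algebra_simps)
    qed
    then have yc: "y \<in> tcube" by (simp add: tcube_def)
    have "f y = f x" using periodic_int_translate[OF p, of y z] by (simp add: y_def tr_def)
    then have "y \<in> N" using yc fx N(2) by auto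
    then have "x \<in> (+) (tr z) ` N" by (intro image_eqI[of _ _ y]) (auto simp: y_def)
    then show "x \<in> (\<Union>z. (+) (tr z) ` N)" by blast
  qed
  then have "negligible {x. f x \<noteq> 0}" using neg negligible_subset by blast
  then show ?thesis using AE_not_in[of "{x. f x \<noteq> 0}" lebesgue] by (simp add: negligible_iff_null_sets)
qed

section \<open>Mild solutions in the coefficient space\<close>

text \<open>The signed integral from 0, because mild solutions are required for negative times
  too.\<close>

definition prim :: "(real \<Rightarrow> 'a::banach) \<Rightarrow> real \<Rightarrow> 'a" where
  "prim f t = (if 0 \<le> t then integral {0..t} f else - integral {t..0} f)"

lemma prim_zero [simp]: "prim f 0 = 0" by (simp add: prim_def)

lemma prim_has_derivative:
  assumes f: "continuous_on UNIV f"
  shows "(prim f has_vector_derivative f t) (at t)"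
proof -
  define a b where "a = -\<bar>t\<bar> - 1" and "b = \<bar>t\<bar> + 1"
  have ab: "a < t" "t < b" "a < 0" "0 < b" by (auto simp: a_def b_def)
  have i: "f integrable_on {x..y}" for x y
    by (intro integrable_continuous_real continuous_on_subset[OF f]) auto
  have eq: "integral {a..s} f - integral {a..0} f = prim f s" if "s \<in> {a<..<b}" for s
  proof (cases "0 \<le> s")
    case True
    have "integral {a..0} f + integral {0..s} f = integral {a..s} f"
      by (rule Henstock_Kurzweil_Integration.integral_combine) (use True ab i in auto)
    then show ?thesis using True by (simp add: prim_def algebra_simps)
  next
    case False
    have "integral {a..s} f + integral {s..0} f = integral {a..0} f"
      by (rule Henstock_Kurzweil_Integration.integral_combine) (use False that i in auto)
    then show ?thesis using False by (simp add: prim_def algebra_simps)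
  qed
  have "((\<lambda>u. integral {a..u} f) has_vector_derivative f t) (at t within {a..b})"
    by (intro integral_has_vector_derivative continuous_on_subset[OF f]) (use ab in auto)
  then have "((\<lambda>u. integral {a..u} f) has_vector_derivative f t) (at t)"
    using at_within_Icc_at[of a t b] ab by simp
  then have "((\<lambda>u. integral {a..u} f - integral {a..0} f) has_vector_derivative f t - 0) (at t)"
    by (intro derivative_intros)
  then have "((\<lambda>u. integral {a..u} f - integral {a..0} f) has_vector_derivative f t) (at t)" by simp
  then show ?thesis
    by (rule has_vector_derivative_transform_within_open[where S="{a<..<b}"]) (use ab eq in auto)
qed

lemma prim_continuous: "continuous_on UNIV f \<Longrightarrow> continuous_on S (prim f)"
  by (rule continuous_at_imp_continuous_on) (blast intro: prim_has_derivative has_vector_derivative_continuous)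

lemma prim_add: "continuous_on UNIV f \<Longrightarrow> continuous_on UNIV g \<Longrightarrow> prim (\<lambda>s. f s + g s) t = prim f t + prim g t"
proof -
  assume "continuous_on UNIV f" "continuous_on UNIV g"
  then have "f integrable_on {x..y}" "g integrable_on {x..y}" for x y
    by (auto intro!: integrable_continuous_real elim: continuous_on_subset)
  then have "integral {x..y} (\<lambda>s. f s + g s) = integral {x..y} f + integral {x..y} g" for x y
    by (rule Henstock_Kurzweil_Integration.integral_add)
  then show ?thesis by (simp add: prim_def)
qed

lemma prim_scaleR: "prim (\<lambda>s. c *\<^sub>R f s) t = c *\<^sub>R prim f t"
  by (simp add: prim_def)

text \<open>Each integration gains the factor 1/(n+1) that builds the factorial in the series of
  iterated integrals. Negative times are reduced to positive ones by reflection.\<close>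

lemma norm_prim_le:
  assumes f: "continuous_on UNIV f" and b: "\<And>s. norm (f s) \<le> c * \<bar>s\<bar> ^ n"
  shows "norm (prim f t) \<le> c * \<bar>t\<bar> ^ Suc n / real (Suc n)"
proof -
  have p: "((\<lambda>s. c * s ^ Suc n / real (Suc n)) has_vector_derivative c * s ^ n) (at s)" for s
    using DERIV_cmult[OF DERIV_pow[of "Suc n" s], of "c / real (Suc n)"]
    by (simp add: has_real_derivative_iff_has_vector_derivative del: of_nat_Suc)
  have c: "continuous_on {0..r} (\<lambda>s. c * s ^ Suc n / real (Suc n))" for r
    by (intro continuous_intros) auto
  consider "t = 0" | "t > 0" | "t < 0" by linarith
  then show ?thesis
  proof cases
    case 2
    have "norm (prim f t - prim f 0) \<le> c * t ^ Suc n / real (Suc n) - c * 0 ^ Suc n / real (Suc n)"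
      by (rule differentiable_bound_general[OF 2 prim_continuous[OF f] c prim_has_derivative[OF f] p])
         (use b in \<open>metis abs_of_pos\<close>)
    then show ?thesis using 2 by simp
  next
    case 3
    have r: "((\<lambda>s. prim f (- s)) has_vector_derivative - f (- s)) (at s)" for s
      using vector_diff_chain_at[of uminus "-1" s "prim f" "f (-s)"] prim_has_derivative[OF f, of "-s"]
        has_vector_derivative_minus[OF has_vector_derivative_id[of "at s"]]
      by (simp add: o_def)
    have "norm (prim f (- (-t)) - prim f (- 0)) \<le> c * (-t) ^ Suc n / real (Suc n) - c * 0 ^ Suc n / real (Suc n)"
    proof (rule differentiable_bound_general[of 0 "-t" "\<lambda>s. prim f (- s)", OF _ _ c r p])
      show "continuous_on {0..- t} (\<lambda>s. prim f (- s))"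
        by (rule continuous_at_imp_continuous_on) (blast intro: r has_vector_derivative_continuous)
      show "norm (- f (- x)) \<le> c * x ^ n" if "0 < x" for x
        using b[of "-x"] that by simp
    qed (use 3 in auto)
    then show ?thesis using 3 by simp
  qed simp
qed

text \<open>The Dyson series of iterated integrals, dominated by the exponential series.
  \<open>K\<close> is assumed continuous only along continuous paths, since the free group is
  strongly but not norm continuous.\<close>

lemma linear_ode_flow:
  fixes K :: "real \<Rightarrow> 'a::banach \<Rightarrow> 'a"
  assumes lin: "\<And>t. linear (K t)" and bd: "\<And>t x. norm (K t x) \<le> l * norm x" and l: "0 \<le> l"
    and cont: "\<And>y. continuous_on UNIV y \<Longrightarrow> continuous_on UNIV (\<lambda>t. K t (y t))"
  shows "\<exists>Y. (\<forall>x. Y 0 x = x) \<and> (\<forall>t. bounded_linear (Y t)) \<and>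
    (\<forall>t x. ((\<lambda>t. Y t x) has_vector_derivative K t (Y t x)) (at t)) \<and>
    (\<forall>t x. norm (Y t x) \<le> exp (l * \<bar>t\<bar>) * norm x)"
proof -
  \<comment> \<open>\<open>D n x t\<close> is the n-fold iterated integral, that is, the n-th Picard
    increment.\<close>
  define D where "D = rec_nat (\<lambda>x t. x) (\<lambda>n d x. prim (\<lambda>s. K s (d x s)))"
  have D0: "D 0 x t = x" for x t by (simp add: D_def)
  have DS: "D (Suc n) x = prim (\<lambda>s. K s (D n x s))" for n x by (simp add: D_def)
  have Dc: "continuous_on UNIV (D n x)" for n x
  proof (induction n)
    case 0 then show ?case by (simp add: D0)
  next
    case (Suc n) then show ?case unfolding DS by (intro prim_continuous cont)
  qed
  have Dd: "((\<lambda>t. D (Suc n) x t) has_vector_derivative K t (D n x t)) (at t)" for n x t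
    unfolding DS by (rule prim_has_derivative[OF cont[OF Dc]])
  have Db: "norm (D n x t) \<le> norm x * (l * \<bar>t\<bar>) ^ n / fact n" for n x t
  proof (induction n arbitrary: t)
    case 0 then show ?case by (simp add: D0)
  next
    case (Suc n)
    have "norm (K s (D n x s)) \<le> (l * norm x * l ^ n / fact n) * \<bar>s\<bar> ^ n" for s
      using order_trans[OF bd mult_left_mono[OF Suc.IH l], of s s] by (simp add: power_mult_distrib mult_ac)
    from norm_prim_le[OF cont[OF Dc] this]
    have "norm (D (Suc n) x t) \<le> (l * norm x * l ^ n / fact n) * \<bar>t\<bar> ^ Suc n / real (Suc n)"
      unfolding DS .
    also have "\<dots> = norm x * (l * \<bar>t\<bar>) ^ Suc n / fact (Suc n)"
      by (simp add: power_mult_distrib field_simps)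
    finally show ?case .
  qed
  have Dlin: "linear (\<lambda>x. D n x t)" for n t
  proof (induction n arbitrary: t)
    case 0 then show ?case by (simp add: D0 linear_iff)
  next
    case (Suc n)
    show ?case
    proof (rule linearI)
      fix x y :: 'a and r :: real
      have "K s (D n (x + y) s) = K s (D n x s) + K s (D n y s)" for s
        using linear_add[OF Suc.IH] linear_add[OF lin] by metis
      then show "D (Suc n) (x + y) t = D (Suc n) x t + D (Suc n) y t"
        by (simp add: DS prim_add cont Dc)
      have "K s (D n (r *\<^sub>R x) s) = r *\<^sub>R K s (D n x s)" for s
        using linear_scale[OF Suc.IH] linear_scale[OF lin] by metis
      then show "D (Suc n) (r *\<^sub>R x) t = r *\<^sub>R D (Suc n) x t"
        by (simp add: DS prim_scaleR)
    qed
  qed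
  have es: "(\<lambda>n. norm x * r ^ n / fact n) sums (exp r * norm x)" for x :: 'a and r :: real
    using sums_mult[OF exp_converges[of r], of "norm x"] by (simp add: divide_inverse mult_ac)
  have sm: "summable (\<lambda>n. D n x t)" for x t
    by (rule summable_comparison_test'[OF sums_summable[OF es] Db])
  define Y where "Y t x = (\<Sum>n. D n x t)" for t x
  have Yb: "norm (Y t x) \<le> exp (l * \<bar>t\<bar>) * norm x" for t x
    unfolding Y_def sums_unique[OF es] by (intro norm_suminf_le Db sums_summable[OF es])
  have Ylin: "bounded_linear (Y t)" for t
  proof (rule bounded_linear_intro[where K="exp (l * \<bar>t\<bar>)"])
    show "Y t (x + y) = Y t x + Y t y" for x y
      unfolding Y_def using suminf_add[OF sm sm, of x t y t] linear_add[OF Dlin] by simp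
    show "Y t (r *\<^sub>R x) = r *\<^sub>R Y t x" for r x
      unfolding Y_def using suminf_scaleR_right[OF sm, of r x t] linear_scale[OF Dlin] by simp
    show "norm (Y t x) \<le> norm x * exp (l * \<bar>t\<bar>)" for x using Yb by (simp add: mult.commute)
  qed
  have Y0: "Y 0 x = x" for x
  proof -
    have "D n x 0 = (if n = 0 then x else 0)" for n by (cases n) (simp_all add: D0 DS)
    then have "Y 0 x = (\<Sum>n. if n = 0 then x else 0)" unfolding Y_def by simp
    also have "\<dots> = x" using sums_unique[OF sums_single[of 0 "\<lambda>_. x"]] by simp
    finally show ?thesis .
  qed
  have Yd: "((\<lambda>t. Y t x) has_vector_derivative K t (Y t x)) (at t)" for t x
  proof -
    define R where "R = \<bar>t\<bar> + 1"
    let ?S = "{-R<..<R}"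
    define f' where "f' n s h = (case n of 0 \<Rightarrow> 0 | Suc m \<Rightarrow> h *\<^sub>R K s (D m x s))" for n s and h :: real
    have ul: "uniform_limit ?S (\<lambda>n s. \<Sum>i<n. D i x s) (\<lambda>s. \<Sum>i. D i x s) sequentially"
    proof (rule Weierstrass_m_test[OF _ sums_summable[OF es]])
      fix n s assume "s \<in> ?S"
      have "norm (D n x s) \<le> norm x * (l * \<bar>s\<bar>) ^ n / fact n" by (rule Db)
      also have "\<dots> \<le> norm x * (l * R) ^ n / fact n"
        by (intro divide_right_mono mult_left_mono power_mono) (use \<open>s \<in> ?S\<close> l in auto)
      finally show "norm (D n x s) \<le> norm x * (l * R) ^ n / fact n" .
    qed
    have "\<exists>g. \<forall>s\<in>?S. (\<lambda>n. D n x s) sums g s \<and> (g has_derivative (\<lambda>h. h *\<^sub>R K s (Y s x))) (at s within ?S)"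
    proof (rule has_derivative_series[where f'=f'])
      show "(D n x has_derivative f' n s) (at s within ?S)" for n s
      proof (cases n)
        case 0
        have "D 0 x = (\<lambda>_. x)" by (rule ext) (rule D0)
        then show ?thesis using 0 by (simp add: f'_def[abs_def])
      next
        case (Suc m)
        then show ?thesis using has_vector_derivative_at_within[OF Dd[of m x s]]
          by (simp add: f'_def[abs_def] has_vector_derivative_def)
      qed
      show "\<forall>\<^sub>F n in sequentially. \<forall>s\<in>?S. \<forall>h. norm ((\<Sum>i<n. f' i s h) - h *\<^sub>R K s (Y s x)) \<le> e * norm h"
        if e: "e > 0" for e
      proof -
        have "\<forall>\<^sub>F n in sequentially. \<forall>s\<in>?S. dist (\<Sum>i<n. D i x s) (\<Sum>i. D i x s) < e / (l + 1)"
          by (rule uniform_limitD[OF ul]) (use e l in auto)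
        then obtain N where N: "\<And>n s. n \<ge> N \<Longrightarrow> s \<in> ?S \<Longrightarrow> dist (\<Sum>i<n. D i x s) (\<Sum>i. D i x s) < e / (l + 1)"
          unfolding eventually_sequentially by metis
        have "norm ((\<Sum>i<Suc n. f' i s h) - h *\<^sub>R K s (Y s x)) \<le> e * norm h" if n: "n \<ge> N" and s: "s \<in> ?S" for n s h
        proof -
          \<comment> \<open>Differentiation lowers the index by one: the derivative of the first
            \<open>Suc n\<close> terms is \<open>K\<close> applied to the sum of the first
            \<open>n\<close>, so uniform convergence of the sums gives that of the
            derivatives.\<close>
          have "(\<Sum>i<Suc n. f' i s h) = h *\<^sub>R K s (\<Sum>i<n. D i x s)"
            by (subst sum.lessThan_Suc_shift) (simp add: f'_def linear_sum[OF lin] scaleR_sum_right)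
          then have "(\<Sum>i<Suc n. f' i s h) - h *\<^sub>R K s (Y s x) = h *\<^sub>R K s ((\<Sum>i<n. D i x s) - Y s x)"
            by (simp add: linear_diff[OF lin] scaleR_diff_right)
          also have "norm \<dots> \<le> \<bar>h\<bar> * (l * (e / (l + 1)))"
            unfolding norm_scaleR
            by (intro mult_left_mono order_trans[OF bd] l) (use N[OF n s] in \<open>auto simp: dist_norm Y_def intro: less_imp_le\<close>)
          also have "\<dots> \<le> \<bar>h\<bar> * e" using e l by (intro mult_left_mono) (auto simp: field_simps)
          finally show ?thesis by (simp only: real_norm_def mult.commute)
        qed
        then have "\<forall>m\<ge>Suc N. \<forall>s\<in>?S. \<forall>h. norm ((\<Sum>i<m. f' i s h) - h *\<^sub>R K s (Y s x)) \<le> e * norm h"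
          by (metis Suc_le_D Suc_le_mono)
        then show ?thesis unfolding eventually_sequentially by blast
      qed
      show "t \<in> ?S" by (auto simp: R_def)
      show "(\<lambda>n. D n x t) sums Y t x" unfolding Y_def by (rule summable_sums[OF sm])
    qed simp
    then obtain g where g: "\<And>s. s \<in> ?S \<Longrightarrow> (\<lambda>n. D n x s) sums g s"
      "\<And>s. s \<in> ?S \<Longrightarrow> (g has_derivative (\<lambda>h. h *\<^sub>R K s (Y s x))) (at s within ?S)" by blast
    have gY: "g s = Y s x" if "s \<in> ?S" for s using g(1)[OF that] unfolding Y_def by (rule sums_unique)
    have tS: "t \<in> ?S" by (auto simp: R_def)
    have "(g has_vector_derivative K t (Y t x)) (at t)"
      using g(2)[OF tS] at_within_open[OF tS] unfolding has_vector_derivative_def by simp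
    then show ?thesis
      by (rule has_vector_derivative_transform_within_open[OF _ _ tS]) (use gY in auto)
  qed
  show ?thesis using Y0 Ylin Yd Yb by blast
qed

section \<open>States in energy coordinates and Duhamel's formula\<close>

type_synonym 'd cstate = "'d hl2 \<times> 'd hl2"

text \<open>The pair \<open>(u, v)\<close> holds the coefficients of \<open>\<surd>(1 - \<Delta>) w\<close> and of the velocity: in these
  coordinates the free group is a rotation on each Fourier mode.\<close>
definition shat :: "('d::finite) state \<Rightarrow> 'd cstate" where
  "shat W = (Hl2 (\<lambda>k. of_real (lamk k) * fcoef (fst W) k), hat (snd W))"

definition st :: "('d::finite) cstate \<Rightarrow> 'd state" where
  "st z = (RF (NN (fst z)), RF (snd z))"

lemma sob_weight_1: "sob_weight 1 f k = (cmod (of_real (lamk k) * fcoef f k))^2"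
  by (simp add: sob_weight_def norm_mult power_mult_distrib lamk_sq add_nonneg_nonneg abs_of_nonneg)

lemma sob_weight_0: "sob_weight 0 f k = (cmod (fcoef f k))^2"
proof -
  have "1 + ksq k \<noteq> 0" using ksq_nonneg[of k] by linarith
  then show ?thesis by (simp add: sob_weight_def)
qed

lemma H1L2_L2T: "H1L2 W \<Longrightarrow> L2T (fst W)" "H1L2 W \<Longrightarrow> L2T (snd W)"
  by (auto simp: H1L2_def HsT_def)

lemma cf_fst_shat: "H1L2 W \<Longrightarrow> cf (fst (shat W)) k = of_real (lamk k) * fcoef (fst W) k"
proof -
  assume "H1L2 W"
  then have "(\<lambda>k. (cmod (of_real (lamk k) * fcoef (fst W) k))^2) summable_on UNIV"
    by (simp add: H1L2_def HsT_def flip: sob_weight_1)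
  then show ?thesis by (simp add: shat_def Hl2_inverse fcoef_uminus)
qed

lemma cf_snd_shat: "H1L2 W \<Longrightarrow> cf (snd (shat W)) k = fcoef (snd W) k"
  by (simp add: shat_def cf_hat H1L2_L2T)

lemma NN_fst_shat: "H1L2 W \<Longrightarrow> NN (fst (shat W)) = hat (fst W)"
  by (rule hl2_eqI) (simp add: cf_fst_shat cf_hat H1L2_L2T)

lemma H1L2_st: "H1L2 (st z)"
proof -
  have "sob_weight 1 (RF (NN (fst z))) = (\<lambda>k. (cmod (cf (fst z) k))^2)"
    by (rule ext) (simp add: sob_weight_1 RF)
  then show ?thesis by (simp add: H1L2_def HsT_def RF st_def cf_summable)
qed

lemma shat_st [simp]: "shat (st z) = z"
  by (intro prod_eqI hl2_eqI, simp_all add: cf_fst_shat cf_snd_shat H1L2_st, simp_all add: st_def RF)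

lemma snorm_sdiff:
  fixes W W' :: "('d::finite) state"
  assumes "H1L2 W" "H1L2 W'"
  shows "snorm (sdiff W W') = sqrt ((2*pi)^CARD('d)) * norm (shat W - shat W')"
proof -
  have 1: "sob_weight 1 (fst (sdiff W W')) = (\<lambda>k. (cmod (cf (fst (shat W - shat W')) k))^2)"
    by (rule ext)
       (simp add: sob_weight_1 sdiff_def fcoef_diff L2T_integrable H1L2_L2T assms cf_fst_shat right_diff_distrib)
  have 2: "sob_weight 0 (snd (sdiff W W')) = (\<lambda>k. (cmod (cf (snd (shat W - shat W')) k))^2)"
    by (rule ext)
       (simp add: sob_weight_0 sdiff_def fcoef_diff L2T_integrable H1L2_L2T assms cf_snd_shat)
  have "norm (shat W - shat W') = sqrt ((norm (fst (shat W - shat W')))^2 + (norm (snd (shat W - shat W')))^2)"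
    by (simp add: norm_prod_def)
  then show ?thesis
    unfolding snorm_def 1 2 by (simp add: real_sqrt_mult hl2_norm_sq)
qed

text \<open>\<open>P\<close> and \<open>Q\<close> are the differential equation for the path pulled
  back by the free group, mode by mode. They avoid the unbounded generator; integrating and rotating
  forward again gives the mild formulation.\<close>

lemma mild_sol_of_path:
  fixes Z :: "real \<Rightarrow> ('d::finite) cstate"
  assumes W0: "H1L2 W0" and q: "trig q" and Z0: "Z 0 = shat W0"
    and cont: "\<And>t. isCont Z t"
    and P: "\<And>k s. ((\<lambda>s. of_real (cos (lamk k * s)) * cf (fst (Z s)) k - of_real (sin (lamk k * s)) * cf (snd (Z s)) k)
       has_vector_derivative - of_real (sin (lamk k * s)) * cf (Mop q (NN (fst (Z s)))) k) (at s)"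
    and Q: "\<And>k s. ((\<lambda>s. of_real (sin (lamk k * s)) * cf (fst (Z s)) k + of_real (cos (lamk k * s)) * cf (snd (Z s)) k)
       has_vector_derivative of_real (cos (lamk k * s)) * cf (Mop q (NN (fst (Z s)))) k) (at s)"
  shows "mild_sol q W0 (\<lambda>t. st (Z t))"
proof -
  have cZ: "continuous_on S Z" for S by (rule continuous_at_imp_continuous_on) (use cont in blast)
  have gc: "continuous_on S (\<lambda>s. cf (Mop q (NN (fst (Z s)))) k)" for S k
    by (intro bounded_linear.continuous_on[OF bounded_linear_cf] bounded_linear.continuous_on[OF bounded_linear_Mop[OF q]]
        bounded_linear.continuous_on[OF bounded_linear_dg[OF mult_sym_N]] continuous_on_fst cZ)
  have g: "fcoef (\<lambda>x. q x * fst (st (Z s)) x) k = cf (Mop q (NN (fst (Z s)))) k" for s k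
    by (simp add: Mop_def st_def cf_hat L2T_trig_mult[OF q] RF)
  show ?thesis
    unfolding mild_sol_def
  proof (intro conjI allI)
    show "H1L2 (st (Z t))" for t by (rule H1L2_st)
    show "((\<lambda>s. snorm (sdiff (st (Z s)) (st (Z t)))) \<longlongrightarrow> 0) (at t)" for t
    proof -
      have "((\<lambda>s. sqrt ((2*pi)^CARD('d)) * norm (Z s - Z t)) \<longlongrightarrow> sqrt ((2*pi)^CARD('d)) * norm (Z t - Z t)) (at t)"
        using cont[of t] unfolding isCont_def by (intro tendsto_intros)
      then show ?thesis by (simp add: snorm_sdiff H1L2_st)
    qed
    fix t :: real and k :: "int^'d"
    define l where "l = lamk k"
    have l: "l \<noteq> 0" by (simp add: l_def)
    define U V where "U s = cf (fst (Z s)) k" and "V s = cf (snd (Z s)) k" for s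
    define G where "G s = cf (Mop q (NN (fst (Z s)))) k" for s
    let ?P = "\<lambda>s. of_real (cos (l * s)) * U s - of_real (sin (l * s)) * V s"
    let ?Q = "\<lambda>s. of_real (sin (l * s)) * U s + of_real (cos (l * s)) * V s"
    have P': "(?P has_vector_derivative - of_real (sin (l * s)) * G s) (at s)"
      and Q': "(?Q has_vector_derivative of_real (cos (l * s)) * G s) (at s)" for s
      using P[of k s] Q[of k s] by (simp_all add: l_def U_def V_def G_def)
    have Gc: "continuous_on S G" for S unfolding G_def by (rule gc)
    \<comment> \<open>By the subtraction formula the integrand is the derivative of a combination of
      \<open>?P\<close> and \<open>?Q\<close> whose coefficients depend on \<open>t\<close> only, so
      the fundamental theorem evaluates it.\<close>
    have 1: "(CLBINT s=0..t. complex_of_real (sin (l*(t-s)) / l) * G s)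
      = (1 / of_real l) * (of_real (cos (l*t)) * ?P t + of_real (sin (l*t)) * ?Q t)
        - (1 / of_real l) * (of_real (cos (l*t)) * ?P 0 + of_real (sin (l*t)) * ?Q 0)"
      unfolding zero_ereal_def
    proof (rule interval_integral_FTC_finite)
      show "continuous_on {min 0 t..max 0 t} (\<lambda>s. complex_of_real (sin (l*(t-s)) / l) * G s)"
        by (intro continuous_intros Gc) (use l in auto)
      fix s
      have "((\<lambda>s. (1 / of_real l) * (of_real (cos (l*t)) * ?P s + of_real (sin (l*t)) * ?Q s)) has_vector_derivative
          (1 / of_real l) * (of_real (cos (l*t)) * (- of_real (sin (l * s)) * G s) + of_real (sin (l*t)) * (of_real (cos (l * s)) * G s))) (at s)"
        by (intro has_vector_derivative_mult_right has_vector_derivative_add P' Q')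
      moreover have "sin (l * (t - s)) = sin (l*t) * cos (l * s) - cos (l*t) * sin (l * s)"
        by (simp add: right_diff_distrib sin_diff)
      then have "(1 / of_real l) * (of_real (cos (l*t)) * (- of_real (sin (l * s)) * G s) + of_real (sin (l*t)) * (of_real (cos (l * s)) * G s))
          = complex_of_real (sin (l*(t-s)) / l) * G s"
        by (simp only:) (simp add: algebra_simps diff_divide_distrib)
      ultimately have "((\<lambda>s. (1 / of_real l) * (of_real (cos (l*t)) * ?P s + of_real (sin (l*t)) * ?Q s)) has_vector_derivative
          complex_of_real (sin (l*(t-s)) / l) * G s) (at s)"
        by (simp only:)
      then show "((\<lambda>s. (1 / of_real l) * (of_real (cos (l*t)) * ?P s + of_real (sin (l*t)) * ?Q s)) has_vector_derivative
          complex_of_real (sin (l*(t-s)) / l) * G s) (at s within {min 0 t..max 0 t})"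
        by (rule has_vector_derivative_at_within)
    qed
    have 2: "(CLBINT s=0..t. complex_of_real (cos (l*(t-s))) * G s)
      = (- of_real (sin (l*t)) * ?P t + of_real (cos (l*t)) * ?Q t) - (- of_real (sin (l*t)) * ?P 0 + of_real (cos (l*t)) * ?Q 0)"
      unfolding zero_ereal_def
    proof (rule interval_integral_FTC_finite)
      show "continuous_on {min 0 t..max 0 t} (\<lambda>s. complex_of_real (cos (l*(t-s))) * G s)"
        by (intro continuous_intros Gc)
      fix s
      have "((\<lambda>s. - of_real (sin (l*t)) * ?P s + of_real (cos (l*t)) * ?Q s) has_vector_derivative
          - of_real (sin (l*t)) * (- of_real (sin (l * s)) * G s) + of_real (cos (l*t)) * (of_real (cos (l * s)) * G s)) (at s)"
        by (intro has_vector_derivative_mult_right has_vector_derivative_add P' Q')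
      moreover have "cos (l * (t - s)) = cos (l*t) * cos (l * s) + sin (l*t) * sin (l * s)"
        by (simp add: right_diff_distrib cos_diff)
      then have "- of_real (sin (l*t)) * (- of_real (sin (l * s)) * G s) + of_real (cos (l*t)) * (of_real (cos (l * s)) * G s)
          = complex_of_real (cos (l*(t-s))) * G s"
        by (simp only:) (simp add: algebra_simps)
      ultimately have "((\<lambda>s. - of_real (sin (l*t)) * ?P s + of_real (cos (l*t)) * ?Q s) has_vector_derivative
          complex_of_real (cos (l*(t-s))) * G s) (at s)"
        by (simp only:)
      then show "((\<lambda>s. - of_real (sin (l*t)) * ?P s + of_real (cos (l*t)) * ?Q s) has_vector_derivative
          complex_of_real (cos (l*(t-s))) * G s) (at s within {min 0 t..max 0 t})"
        by (rule has_vector_derivative_at_within)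
    qed
    have cs: "complex_of_real (cos (l*t)) * of_real (cos (l*t)) + of_real (sin (l*t)) * of_real (sin (l*t)) = 1"
      by (simp only: of_real_mult[symmetric] of_real_add[symmetric] sin_cos_squared_add3 of_real_1)
    have A: "of_real (cos (l*t)) * ?P t + of_real (sin (l*t)) * ?Q t = U t"
    proof -
      have "of_real (cos (l*t)) * ?P t + of_real (sin (l*t)) * ?Q t
        = (of_real (cos (l*t)) * of_real (cos (l*t)) + of_real (sin (l*t)) * of_real (sin (l*t))) * U t"
        by (simp add: algebra_simps)
      then show ?thesis by (simp add: cs)
    qed
    have B: "- of_real (sin (l*t)) * ?P t + of_real (cos (l*t)) * ?Q t = V t"
    proof -
      have "- of_real (sin (l*t)) * ?P t + of_real (cos (l*t)) * ?Q t
        = (of_real (cos (l*t)) * of_real (cos (l*t)) + of_real (sin (l*t)) * of_real (sin (l*t))) * V t"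
        by (simp add: algebra_simps)
      then show ?thesis by (simp add: cs)
    qed
    have U0: "U 0 = of_real l * fcoef (fst W0) k" and V0: "V 0 = fcoef (snd W0) k"
      by (simp_all add: U_def V_def Z0 l_def cf_fst_shat cf_snd_shat W0)
    have Ut: "fcoef (fst (st (Z t))) k = U t / of_real l" and Vt: "fcoef (snd (st (Z t))) k = V t"
      by (simp_all add: st_def RF U_def V_def l_def)
    show "let l = lamk k; a = fcoef (fst W0) k; b = fcoef (snd W0) k;
             g = (\<lambda>s. fcoef (\<lambda>x. q x * fst (st (Z s)) x) k)
         in fcoef (fst (st (Z t))) k =
            complex_of_real (cos (l * t)) * a + complex_of_real (sin (l * t) / l) * b +
            (CLBINT s=0..t. complex_of_real (sin (l * (t - s)) / l) * g s) \<and>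
            fcoef (snd (st (Z t))) k =
            complex_of_real (- l * sin (l * t)) * a + complex_of_real (cos (l * t)) * b +
            (CLBINT s=0..t. complex_of_real (cos (l * (t - s))) * g s)"
      unfolding Let_def g l_def[symmetric] G_def[symmetric] 1 2 A B Ut Vt
      using l by (simp add: U0 V0 field_simps)
  qed
qed

section \<open>Approximate reachability\<close>

lemma cf_has_vector_derivative:
  "(f has_vector_derivative f') F \<Longrightarrow> ((\<lambda>s. cf (f s) k) has_vector_derivative cf f' k) F"
  by (rule bounded_linear.has_vector_derivative[OF bounded_linear_cf])

text \<open>The control list is chosen before the initial state, so that one bounded linear map
  describes its effect on all states; boundedness is what propagates approximation errors through
  later controls.\<close>

definition adm :: "real \<Rightarrow> (('d::finite) cstate \<Rightarrow> 'd cstate) \<Rightarrow> bool" where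
  "adm t F \<longleftrightarrow> bounded_linear F \<and> (\<exists>p. (\<forall>x\<in>set p. fst x > 0) \<and> sum_list (map fst p) = t \<and>
     (\<forall>W0. H1L2 W0 \<longrightarrow> (\<exists>W. evolve p W0 W \<and> H1L2 W \<and> shat W = F (shat W0))))"

lemma evolve_append: "evolve p W0 W1 \<Longrightarrow> evolve p' W1 W2 \<Longrightarrow> evolve (p @ p') W0 W2"
proof (induction p arbitrary: W0)
  case (Cons x p)
  obtain \<tau> c where x: "x = (\<tau>, c)" by (cases x)
  obtain Wt where "mild_sol (qpot c) W0 Wt" "evolve p (Wt \<tau>) W1" using Cons.prems(1) x by auto
  moreover from this have "evolve (p @ p') (Wt \<tau>) W2" by (intro Cons.IH[OF _ Cons.prems(2)])
  ultimately show ?case unfolding x append_Cons evolve.simps by blast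
qed simp

lemma adm_step:
  assumes "\<tau> > 0" "bounded_linear F"
    and "\<And>W0. H1L2 W0 \<Longrightarrow> \<exists>Wt. mild_sol (qpot c) W0 Wt \<and> shat (Wt \<tau>) = F (shat W0)"
  shows "adm \<tau> F"
  unfolding adm_def
proof (intro conjI exI[of _ "[(\<tau>, c)]"] allI impI)
  fix W0 :: "'a state" assume "H1L2 W0"
  then obtain Wt where Wt: "mild_sol (qpot c) W0 Wt" "shat (Wt \<tau>) = F (shat W0)" using assms(3) by blast
  then have "H1L2 (Wt \<tau>)" by (simp add: mild_sol_def)
  with Wt show "\<exists>W. evolve [(\<tau>, c)] W0 W \<and> H1L2 W \<and> shat W = F (shat W0)"
    by (intro exI[of _ "Wt \<tau>"]) auto
qed (use assms in auto)

lemma adm_comp: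
  assumes "adm s F" "adm t G"
  shows "adm (s + t) (\<lambda>x. G (F x))"
proof -
  obtain p where p: "\<forall>x\<in>set p. fst x > 0" "sum_list (map fst p) = s"
    "\<And>W0. H1L2 W0 \<Longrightarrow> \<exists>W. evolve p W0 W \<and> H1L2 W \<and> shat W = F (shat W0)"
    using assms(1) by (auto simp: adm_def)
  obtain p' where p': "\<forall>x\<in>set p'. fst x > 0" "sum_list (map fst p') = t"
    "\<And>W0. H1L2 W0 \<Longrightarrow> \<exists>W. evolve p' W0 W \<and> H1L2 W \<and> shat W = G (shat W0)"
    using assms(2) by (auto simp: adm_def)
  have "\<exists>W. evolve (p @ p') W0 W \<and> H1L2 W \<and> shat W = G (F (shat W0))" if W0: "H1L2 W0" for W0
  proof -
    obtain W1 where W1: "evolve p W0 W1" "H1L2 W1" "shat W1 = F (shat W0)" using p(3)[OF W0] by blast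
    obtain W2 where W2: "evolve p' W1 W2" "H1L2 W2" "shat W2 = G (shat W1)" using p'(3)[OF W1(2)] by blast
    show ?thesis using evolve_append[OF W1(1) W2(1)] W1 W2 by metis
  qed
  moreover have "bounded_linear (\<lambda>x. G (F x))"
    using assms bounded_linear_compose by (auto simp: adm_def)
  ultimately show ?thesis unfolding adm_def using p p' by (intro conjI exI[of _ "p @ p'"]) auto
qed

lemma adm_id: "adm 0 (\<lambda>x. x)"
  unfolding adm_def by (intro conjI exI[of _ "[]"]) (auto simp: bounded_linear_ident)

text \<open>The time may exceed \<open>T\<close> by \<open>\<epsilon>\<close> but never fall short
  of it, as in the T+ convention. Hence instantaneous impulses become statements with
  \<open>T = 0\<close>.\<close>

definition reaches :: "real \<Rightarrow> ('d::finite) cstate \<Rightarrow> 'd cstate \<Rightarrow> bool" where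
  "reaches T x y \<longleftrightarrow> (\<forall>\<epsilon>>0. \<exists>t F. adm t F \<and> T \<le> t \<and> t \<le> T + \<epsilon> \<and> norm (F x - y) < \<epsilon>)"

lemma adm_reaches: "adm t F \<Longrightarrow> reaches t x (F x)"
  unfolding reaches_def by (intro allI impI exI[of _ t] exI[of _ F]) auto

lemma reaches_refl: "reaches 0 x x"
  using adm_reaches[OF adm_id] .

text \<open>The second control is fixed first; the accuracy demanded of the first one then depends
  on the operator bound of the second.\<close>

lemma reaches_trans:
  assumes "reaches S x y" "reaches T y z"
  shows "reaches (S + T) x z"
  unfolding reaches_def
proof (intro allI impI)
  fix e :: real assume e: "e > 0"
  obtain t G where G: "adm t G" "T \<le> t" "t \<le> T + e/2" "norm (G y - z) < e/2"
    using assms(2) e unfolding reaches_def by (meson half_gt_zero)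
  have bl: "bounded_linear G" using G(1) by (simp add: adm_def)
  then obtain K where K: "K > 0" "\<And>x. norm (G x) \<le> norm x * K" using bounded_linear.pos_bounded by blast
  define d where "d = min (e/2) (e / (2*K))"
  have d: "d > 0" using e K by (simp add: d_def)
  obtain s F where F: "adm s F" "S \<le> s" "s \<le> S + d" "norm (F x - y) < d"
    using assms(1) d unfolding reaches_def by meson
  have "norm (G (F x) - G y) \<le> norm (F x - y) * K"
    using K(2)[of "F x - y"] by (simp add: linear_diff[OF bounded_linear.linear[OF bl]])
  also have "\<dots> < d * K" using F(4) K(1) by (rule mult_strict_right_mono)
  also have "\<dots> \<le> e / (2*K) * K" using K(1) by (intro mult_right_mono) (auto simp: d_def)
  also have "\<dots> = e/2" using K(1) by simp
  finally have "norm (G (F x) - G y) < e/2" .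
  then have "norm (G (F x) - z) < e"
    using norm_triangle_ineq[of "G (F x) - G y" "G y - z"] G(4) by simp
  moreover have "s \<le> S + e/2" using F(3) by (simp add: d_def)
  ultimately show "\<exists>t F. adm t F \<and> S + T \<le> t \<and> t \<le> S + T + e \<and> norm (F x - z) < e"
    using adm_comp[OF F(1) G(1)] F(2) G(2,3) by (intro exI[of _ "s + t"] exI[of _ "\<lambda>x. G (F x)"]) auto
qed

lemma reaches_trans0: "reaches S x y \<Longrightarrow> reaches 0 y z \<Longrightarrow> reaches S x z"
  using reaches_trans[of S x y 0 z] by simp

text \<open>A diagonal argument: strategies that need the extra times \<open>\<tau> n\<close> cost
  nothing in the limit.\<close>

lemma reaches_limit:
  assumes r: "\<And>n::nat. reaches (T + \<tau> n) x (y n)" and \<tau>: "\<And>n. 0 \<le> \<tau> n" "\<tau> \<longlonglongrightarrow> 0" and y: "y \<longlonglongrightarrow> z"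
  shows "reaches T x z"
  unfolding reaches_def
proof (intro allI impI)
  fix e :: real assume e: "e > 0"
  have "\<forall>\<^sub>F n in sequentially. \<tau> n < e/2" using order_tendstoD(2)[OF \<tau>(2), of "e/2"] e by simp
  moreover have "\<forall>\<^sub>F n in sequentially. dist (y n) z < e/2" using tendstoD[OF y, of "e/2"] e by simp
  ultimately have "\<forall>\<^sub>F n in sequentially. \<tau> n < e/2 \<and> dist (y n) z < e/2" by (rule eventually_conj)
  then obtain n where n: "\<tau> n < e/2" "dist (y n) z < e/2" by (auto simp: eventually_sequentially)
  obtain t F where F: "adm t F" "T + \<tau> n \<le> t" "t \<le> T + \<tau> n + e/2" "norm (F x - y n) < e/2"
    using r[of n] e unfolding reaches_def by (meson half_gt_zero)
  have "norm (F x - z) < e"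
    using norm_triangle_ineq[of "F x - y n" "y n - z"] F(4) n(2) by (simp add: dist_norm)
  then show "\<exists>t F. adm t F \<and> T \<le> t \<and> t \<le> T + e \<and> norm (F x - z) < e"
    using F n \<tau>(1)[of n] by (intro exI[of _ t] exI[of _ F]) auto
qed

lemma reaches_closed: "(\<And>n::nat. reaches T x (y n)) \<Longrightarrow> y \<longlonglongrightarrow> z \<Longrightarrow> reaches T x z"
  using reaches_limit[of T "\<lambda>_. 0" x y z] by simp

lemma approx_ctrl_of_reaches:
  fixes W0 :: "('d::finite) state"
  assumes W0: "H1L2 W0" and r: "\<And>y. reaches T (shat W0) y"
  shows "approx_ctrl T W0"
  unfolding approx_ctrl_def approx_reach_def
proof (intro allI impI)
  fix Wf :: "'d state" and e :: real assume Wf: "H1L2 Wf" and e: "e > 0"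
  let ?c = "sqrt ((2*pi)^CARD('d))"
  have c: "?c > 0" by simp
  define d where "d = min e (e / ?c)"
  have d: "d > 0" using e c by (simp add: d_def)
  obtain t F where F: "adm t F" "T \<le> t" "t \<le> T + d" "norm (F (shat W0) - shat Wf) < d"
    using r[of "shat Wf"] d unfolding reaches_def by meson
  obtain p W where p: "\<forall>x\<in>set p. fst x > 0" "sum_list (map fst p) = t" "evolve p W0 W" "H1L2 W" "shat W = F (shat W0)"
    using F(1) W0 unfolding adm_def by metis
  have "snorm (sdiff W Wf) = ?c * norm (F (shat W0) - shat Wf)"
    using snorm_sdiff[OF p(4) Wf] p(5) by simp
  also have "\<dots> < ?c * d" using F(4) c by (rule mult_strict_left_mono)
  also have "\<dots> \<le> ?c * (e / ?c)" using c by (intro mult_left_mono) (auto simp: d_def)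
  also have "\<dots> = e" using c by simp
  finally have "snorm (sdiff W Wf) < e" .
  moreover have "t \<le> T + e" using F(3) by (simp add: d_def)
  ultimately show "\<exists>T1 p W. T \<le> T1 \<and> T1 \<le> T + e \<and> (\<forall>x\<in>set p. fst x > 0) \<and> sum_list (map fst p) = T1 \<and>
      evolve p W0 W \<and> snorm (sdiff W Wf) < e"
    using F(2) p by (intro exI[of _ t] exI[of _ p] exI[of _ W]) auto
qed

subsection \<open>The wave flow\<close>

text \<open>The frequency of the mode under the control \<open>u_0 = 1\<close>, which cancels the -1
  in Laplacian - 1 and leaves the wave equation.\<close>

definition kap :: "int^'d \<Rightarrow> real" where "kap k = sqrt (ksq k)"

lemma kap_uminus [simp]: "kap (-k) = kap k" by (simp add: kap_def)
lemma kap_nonneg [simp]: "0 \<le> kap k" by (simp add: kap_def)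
lemma kap_sq: "(kap k)^2 = ksq k" by (simp add: kap_def)
lemma kap_zero [simp]: "kap 0 = 0" by (simp add: kap_def)
lemma kap_ge_1: "k \<noteq> 0 \<Longrightarrow> 1 \<le> kap k" using ksq_ge_1[of k] by (simp add: kap_def)
lemma kap_le_lamk: "kap k \<le> lamk k" by (simp add: kap_def lamk_def)
lemma lamk_le_kap: "lamk k \<le> 1 + kap k"
proof -
  have "(lamk k)^2 \<le> (1 + kap k)^2" by (simp add: lamk_sq power2_sum kap_sq)
  then show ?thesis by (rule power2_le_imp_le) simp
qed

definition wC :: "real \<Rightarrow> int^'d \<Rightarrow> real" where "wC t k = cos (kap k * t)"
text \<open>The propagator from velocity to position. At frequency 0 it is the limit value
  \<open>t\<close>, which is the linear growth of the mean.\<close>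

definition wS :: "real \<Rightarrow> int^'d \<Rightarrow> real" where "wS t k = (if k = 0 then t else sin (kap k * t) / kap k)"

lemma wS_eq: "kap k * wS t k = sin (kap k * t)"
  using kap_ge_1[of k] by (auto simp: wS_def)

lemma wC_uminus [simp]: "wC t (-k) = wC t k" by (simp add: wC_def)
lemma wS_uminus [simp]: "wS t (-k) = wS t k" by (simp add: wS_def)
lemma abs_wC_le: "\<bar>wC t k\<bar> \<le> 1" by (simp add: wC_def)

lemma abs_wS_le: "\<bar>wS t k\<bar> \<le> \<bar>t\<bar>"
proof (cases "k = 0")
  case False
  have "\<bar>sin (kap k * t)\<bar> \<le> kap k * \<bar>t\<bar>" using abs_sin_x_le_abs_x[of "kap k * t"] by (simp add: abs_mult)
  then show ?thesis using kap_ge_1[OF False] False by (simp add: wS_def abs_divide pos_divide_le_eq mult.commute)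
qed (simp add: wS_def)

text \<open>\<open>wS\<close> gains one derivative: multiplied by |k| it is a sine, and
  \<open>lamk k\<close> exceeds |k| by at most 1.\<close>

lemma lamk_wS_le: "\<bar>lamk k * wS t k\<bar> \<le> 1 + \<bar>t\<bar>"
proof -
  have "\<bar>lamk k * wS t k\<bar> \<le> (1 + kap k) * \<bar>wS t k\<bar>"
    unfolding abs_mult using lamk_le_kap[of k] by (intro mult_right_mono) (auto simp: abs_of_pos)
  also have "\<dots> = \<bar>wS t k\<bar> + \<bar>sin (kap k * t)\<bar>"
    by (simp add: distrib_right abs_mult flip: wS_eq)
  also have "\<dots> \<le> \<bar>t\<bar> + 1" by (intro add_mono abs_wS_le) simp
  finally show ?thesis by simp
qed

lemma ksq_wS_le: "\<bar>ksq k * wS t k / lamk k\<bar> \<le> 1"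
proof -
  have "\<bar>ksq k * wS t k / lamk k\<bar> = (kap k / lamk k) * \<bar>sin (kap k * t)\<bar>"
    by (simp add: abs_mult power2_eq_square abs_divide abs_of_pos flip: wS_eq kap_sq)
  also have "\<dots> \<le> 1 * 1"
    by (intro mult_mono) (auto simp: divide_le_eq_1 kap_le_lamk)
  finally show ?thesis by simp
qed

lemma mult_sym_wC [simp]: "mult_sym (wC t)" by (rule mult_symI[OF _ abs_wC_le]) simp
lemma mult_sym_wS [simp]: "mult_sym (wS t)" by (rule mult_symI[OF _ abs_wS_le]) simp
lemma mult_sym_lamk_wS [simp]: "mult_sym (\<lambda>k. lamk k * wS t k)" by (rule mult_symI[OF _ lamk_wS_le]) simp
lemma mult_sym_ksq_wS [simp]: "mult_sym (\<lambda>k. ksq k * wS t k / lamk k)" by (rule mult_symI[OF _ ksq_wS_le]) simp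

lemma wC_deriv: "((\<lambda>t. wC t k) has_real_derivative - ksq k * wS t k) (at t)"
  unfolding wC_def by (auto intro!: derivative_eq_intros simp flip: wS_eq simp: kap_sq[symmetric] power2_eq_square)

lemma wS_deriv: "((\<lambda>t. wS t k) has_real_derivative wC t k) (at t)"
proof (cases "k = 0")
  case True
  then show ?thesis by (auto simp: wS_def wC_def)
next
  case False
  then show ?thesis unfolding wS_def wC_def using kap_ge_1[OF False]
    by (auto intro!: derivative_eq_intros)
qed

lemma wC_tendsto: "((\<lambda>t. wC t k) \<longlongrightarrow> wC t k) (at t)"
  using DERIV_isCont[OF wC_deriv] by (simp add: isCont_def)
lemma wS_tendsto: "((\<lambda>t. wS t k) \<longlongrightarrow> wS t k) (at t)"
  using DERIV_isCont[OF wS_deriv] by (simp add: isCont_def)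

text \<open>The wave group conjugated to energy coordinates: the off-diagonal entries acquire the
  factors \<open>lamk k\<close> and \<open>1 / lamk k\<close>, and both products stay bounded in
  \<open>k\<close>.\<close>

definition wv :: "real \<Rightarrow> ('d::finite) cstate \<Rightarrow> 'd cstate" where
  "wv t z = (dg (wC t) (fst z) + dg (\<lambda>k. lamk k * wS t k) (snd z),
             dg (wC t) (snd z) - dg (\<lambda>k. ksq k * wS t k / lamk k) (fst z))"

lemma bounded_linear_fst_dg: "mult_sym m \<Longrightarrow> bounded_linear (\<lambda>z. dg m (fst z))"
  and bounded_linear_snd_dg: "mult_sym m \<Longrightarrow> bounded_linear (\<lambda>z. dg m (snd z))"
  by (auto intro: bounded_linear_compose[OF bounded_linear_dg] bounded_linear_fst bounded_linear_snd)

lemma bounded_linear_wv: "bounded_linear (wv t)"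
  unfolding wv_def[abs_def]
  by (intro bounded_linear_Pair bounded_linear_add bounded_linear_sub bounded_linear_fst_dg bounded_linear_snd_dg) simp_all

lemma wv_zero [simp]: "wv 0 z = z"
  by (intro prod_eqI hl2_eqI) (simp_all add: wv_def cf_dg, simp_all add: wC_def wS_def)

lemma eventually_abs_le_at: "\<forall>\<^sub>F s in at t. \<bar>s\<bar> \<le> \<bar>t\<bar> + (1::real)"
proof -
  have "((\<lambda>s. \<bar>s\<bar>) \<longlongrightarrow> \<bar>t\<bar>) (at t)" by (intro tendsto_intros)
  then have "\<forall>\<^sub>F s in at t. \<bar>s\<bar> < \<bar>t\<bar> + 1" by (rule order_tendstoD(2)) simp
  then show ?thesis by eventually_elim simp
qed

lemma isCont_wv: "isCont (\<lambda>t. wv t z) t"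
  unfolding isCont_def wv_def
proof (intro tendsto_Pair tendsto_add tendsto_diff)
  show "((\<lambda>t. dg (wC t) a) \<longlongrightarrow> dg (wC t) a) (at t)" for a :: "'a hl2"
    by (rule tendsto_dg[where B=1]) (simp_all add: abs_wC_le wC_tendsto)
  show "((\<lambda>t. dg (wC t) a) \<longlongrightarrow> dg (wC t) a) (at t)" for a :: "'a hl2" by fact
  show "((\<lambda>t. dg (\<lambda>k. lamk k * wS t k) (snd z)) \<longlongrightarrow> dg (\<lambda>k. lamk k * wS t k) (snd z)) (at t)"
  proof (rule tendsto_dg[where B="\<bar>t\<bar> + 2"])
    show "\<forall>\<^sub>F s in at t. mult_sym (\<lambda>k::int^'a. lamk k * wS s k) \<and> (\<forall>k::int^'a. \<bar>lamk k * wS s k\<bar> \<le> \<bar>t\<bar> + 2)"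
      using eventually_abs_le_at[of t]
    proof eventually_elim
      fix s assume "\<bar>s\<bar> \<le> \<bar>t\<bar> + 1"
      then have "\<bar>lamk k * wS s k\<bar> \<le> \<bar>t\<bar> + 2" for k :: "int^'a" using lamk_wS_le[of k s] by linarith
      then show "mult_sym (\<lambda>k::int^'a. lamk k * wS s k) \<and> (\<forall>k::int^'a. \<bar>lamk k * wS s k\<bar> \<le> \<bar>t\<bar> + 2)" by simp
    qed
  qed (auto intro: tendsto_intros wS_tendsto)
  show "((\<lambda>t. dg (\<lambda>k. ksq k * wS t k / lamk k) (fst z)) \<longlongrightarrow> dg (\<lambda>k. ksq k * wS t k / lamk k) (fst z)) (at t)"
  proof (rule tendsto_dg[where B=1])
    show "\<forall>\<^sub>F s in at t. mult_sym (\<lambda>k::int^'a. ksq k * wS s k / lamk k) \<and> (\<forall>k::int^'a. \<bar>ksq k * wS s k / lamk k\<bar> \<le> 1)"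
      by (intro always_eventually allI conjI mult_sym_ksq_wS ksq_wS_le)
  qed (auto intro!: tendsto_intros wS_tendsto)
qed

lemma qpot_one: "qpot (1, 0, 0) = (\<lambda>x. 1)"
  by (rule ext) (simp add: qpot_def)

lemma has_vector_derivative_of_real': 
  "(f has_real_derivative f') (at s) \<Longrightarrow> ((\<lambda>s. complex_of_real (f s)) has_vector_derivative of_real f') (at s)"
  by (rule has_vector_derivative_of_real) (simp add: has_real_derivative_iff_has_vector_derivative)

lemma adm_wv: "t > 0 \<Longrightarrow> adm t (wv t)"
proof (rule adm_step[where c="(1, 0, 0)", OF _ bounded_linear_wv])
  fix W0 :: "'a state" assume W0: "H1L2 W0"
  let ?z = "shat W0"
  have "mild_sol (qpot (1, 0, 0)) W0 (\<lambda>t. st (wv t ?z))"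
  proof (rule mild_sol_of_path[OF W0 trig_qpot])
    show "wv 0 ?z = ?z" "isCont (\<lambda>t. wv t ?z) t" for t by (simp_all add: isCont_wv)
    fix k :: "int^'a" and s :: real
    let ?l = "lamk k" and ?u = "cf (fst ?z) k" and ?v = "cf (snd ?z) k"
    let ?U = "\<lambda>s. of_real (wC s k) * ?u + of_real (?l * wS s k) * ?v"
    let ?V = "\<lambda>s. of_real (wC s k) * ?v - of_real (ksq k * wS s k / ?l) * ?u"
    have UV: "cf (fst (wv s ?z)) k = ?U s" "cf (snd (wv s ?z)) k = ?V s" for s
      by (simp_all add: wv_def cf_dg)
    have g: "cf (Mop (qpot (1, 0, 0)) (NN (fst (wv s ?z)))) k = ?U s / ?l" for s
      by (simp add: qpot_one UV)
    have U': "(?U has_vector_derivative ?l * ?V s) (at s)"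
    proof -
      have "(?U has_vector_derivative of_real (- ksq k * wS s k) * ?u + of_real (?l * wC s k) * ?v) (at s)"
        by (intro has_vector_derivative_add has_vector_derivative_mult_left has_vector_derivative_of_real' wC_deriv DERIV_cmult wS_deriv)
      then show ?thesis by (simp add: algebra_simps)
    qed
    have V': "(?V has_vector_derivative - ?l * ?U s + ?U s / ?l) (at s)"
    proof -
      have "(?V has_vector_derivative of_real (- ksq k * wS s k) * ?v - of_real (ksq k * wC s k / ?l) * ?u) (at s)"
        by (intro has_vector_derivative_diff has_vector_derivative_mult_left has_vector_derivative_of_real' wC_deriv
            DERIV_cdivide DERIV_cmult wS_deriv)
      moreover have "of_real (- ksq k * wS s k) * ?v - of_real (ksq k * wC s k / ?l) * ?u = - ?l * ?U s + ?U s / ?l"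
      proof -
        \<comment> \<open>This identity splits the wave generator into the free part and the
          contribution of the constant potential 1.\<close>
        have k: "ksq k = ?l^2 - 1" by (simp add: lamk_sq)
        show ?thesis unfolding k by (simp add: field_simps power2_eq_square)
      qed
      ultimately show ?thesis by simp
    qed
    have c: "((\<lambda>s. complex_of_real (cos (?l * s))) has_vector_derivative of_real (- ?l * sin (?l * s))) (at s)"
      and sn: "((\<lambda>s. complex_of_real (sin (?l * s))) has_vector_derivative of_real (?l * cos (?l * s))) (at s)"
      by (rule has_vector_derivative_of_real', auto intro!: derivative_eq_intros)+
    show "((\<lambda>s. of_real (cos (?l * s)) * cf (fst (wv s ?z)) k - of_real (sin (?l * s)) * cf (snd (wv s ?z)) k)
       has_vector_derivative - of_real (sin (?l * s)) * cf (Mop (qpot (1, 0, 0)) (NN (fst (wv s ?z)))) k) (at s)"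
      unfolding UV g
      using has_vector_derivative_diff[OF has_vector_derivative_mult[OF c U'] has_vector_derivative_mult[OF sn V']]
      by (simp add: algebra_simps add_divide_distrib diff_divide_distrib)
    show "((\<lambda>s. of_real (sin (?l * s)) * cf (fst (wv s ?z)) k + of_real (cos (?l * s)) * cf (snd (wv s ?z)) k)
       has_vector_derivative of_real (cos (?l * s)) * cf (Mop (qpot (1, 0, 0)) (NN (fst (wv s ?z)))) k) (at s)"
      unfolding UV g
      using has_vector_derivative_add[OF has_vector_derivative_mult[OF sn U'] has_vector_derivative_mult[OF c V']]
      by (simp add: algebra_simps add_divide_distrib diff_divide_distrib)
  qed
  then show "\<exists>Wt. mild_sol (qpot (1, 0, 0)) W0 Wt \<and> shat (Wt t) = wv t (shat W0)"
    by (intro exI[of _ "\<lambda>t. st (wv t ?z)"]) simp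
qed

lemma reaches_wv: "t > 0 \<Longrightarrow> reaches t z (wv t z)"
  by (rule adm_reaches[OF adm_wv])

section \<open>Impulses\<close>

lemma norm_diff_le_vector_derivative:
  assumes "\<And>x. x \<in> {a..b} \<Longrightarrow> (f has_vector_derivative f' x) (at x within {a..b})"
    and "\<And>x. x \<in> {a..b} \<Longrightarrow> norm (f' x) \<le> B" and "a \<le> b"
  shows "norm (f b - f a) \<le> B * (b - a)"
proof -
  have "norm (f b - f a) \<le> B * norm (b - a)"
  proof (rule differentiable_bound[of "{a..b}" f "\<lambda>x h. h *\<^sub>R f' x"])
    show "onorm (\<lambda>h. h *\<^sub>R f' x) \<le> B" if "x \<in> {a..b}" for x
      by (rule onorm_le) (use assms(2)[OF that] in \<open>simp add: mult.commute[of B] mult_left_mono\<close>)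
  qed (use assms in \<open>auto simp: has_vector_derivative_def\<close>)
  then show ?thesis using assms(3) by simp
qed

text \<open>The free group generated by \<open>A\<close>, which in energy coordinates rotates each
  mode with frequency \<open>lamk k\<close>.\<close>

definition rot :: "real \<Rightarrow> ('d::finite) cstate \<Rightarrow> 'd cstate" where
  "rot t z = (dg (\<lambda>k. cos (lamk k * t)) (fst z) + dg (\<lambda>k. sin (lamk k * t)) (snd z),
              dg (\<lambda>k. cos (lamk k * t)) (snd z) - dg (\<lambda>k. sin (lamk k * t)) (fst z))"

lemma mult_sym_cos_sin [simp]:
  "mult_sym (\<lambda>k. cos (lamk k * t))" "mult_sym (\<lambda>k. sin (lamk k * t))"
  by (rule mult_symI[where B=1]; simp)+

lemma bounded_linear_rot: "bounded_linear (rot t)"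
  unfolding rot_def[abs_def]
  by (intro bounded_linear_Pair bounded_linear_add bounded_linear_sub bounded_linear_fst_dg bounded_linear_snd_dg) simp_all

lemmas linear_rot = bounded_linear.linear[OF bounded_linear_rot]

lemma norm_rot_le: "norm (rot t z) \<le> 4 * norm z"
proof -
  have c: "norm (dg (\<lambda>k. cos (lamk k * t)) a) \<le> norm a" and s: "norm (dg (\<lambda>k. sin (lamk k * t)) a) \<le> norm a" for a :: "'a hl2"
    using norm_dg_le[of "\<lambda>k. cos (lamk k * t)" 1 a] norm_dg_le[of "\<lambda>k. sin (lamk k * t)" 1 a] by simp_all
  have "norm (rot t z) \<le> norm (fst (rot t z)) + norm (snd (rot t z))"
    using norm_Pair_le[of "fst (rot t z)" "snd (rot t z)"] by simp
  also have "\<dots> \<le> (norm (fst z) + norm (snd z)) + (norm (snd z) + norm (fst z))"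
    unfolding rot_def fst_conv snd_conv
    by (intro add_mono order_trans[OF norm_triangle_ineq] order_trans[OF norm_triangle_ineq4] c s)
  also have "\<dots> \<le> 4 * norm z" using norm_fst_le[of "fst z" "snd z"] norm_snd_le[of "snd z" "fst z"] by simp
  finally show ?thesis .
qed

lemma cf_rot:
  "cf (fst (rot t z)) k = of_real (cos (lamk k * t)) * cf (fst z) k + of_real (sin (lamk k * t)) * cf (snd z) k"
  "cf (snd (rot t z)) k = of_real (cos (lamk k * t)) * cf (snd z) k - of_real (sin (lamk k * t)) * cf (fst z) k"
  by (simp_all add: rot_def cf_dg)

lemma rot_rot: "rot s (rot t z) = rot (s + t) z"
  by (intro prod_eqI hl2_eqI) (simp_all add: cf_rot distrib_left cos_add sin_add, simp_all add: algebra_simps)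

lemma rot_zero [simp]: "rot 0 z = z"
  by (intro prod_eqI hl2_eqI) (simp_all add: cf_rot)

lemma isCont_rot: "isCont (\<lambda>t. rot t z) t"
  unfolding isCont_def rot_def
proof (intro tendsto_Pair tendsto_add tendsto_diff)
  show "((\<lambda>t. dg (\<lambda>k. cos (lamk k * t)) a) \<longlongrightarrow> dg (\<lambda>k. cos (lamk k * t)) a) (at t)" for a :: "'a hl2"
    by (rule tendsto_dg[where B=1]) (auto intro!: tendsto_intros)
  then show "((\<lambda>t. dg (\<lambda>k. cos (lamk k * t)) (snd z)) \<longlongrightarrow> dg (\<lambda>k. cos (lamk k * t)) (snd z)) (at t)" .
  show "((\<lambda>t. dg (\<lambda>k. sin (lamk k * t)) a) \<longlongrightarrow> dg (\<lambda>k. sin (lamk k * t)) a) (at t)" for a :: "'a hl2"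
    by (rule tendsto_dg[where B=1]) (auto intro!: tendsto_intros)
  then show "((\<lambda>t. dg (\<lambda>k. sin (lamk k * t)) (fst z)) \<longlongrightarrow> dg (\<lambda>k. sin (lamk k * t)) (fst z)) (at t)" .
qed

text \<open>Strong continuity and a uniform operator bound give joint continuity in time and
  state.\<close>

lemma tendsto_rot:
  assumes f: "(f \<longlongrightarrow> f t) (at t)" and y: "(y \<longlongrightarrow> y t) (at t)"
  shows "((\<lambda>s. rot (f s) (y s)) \<longlongrightarrow> rot (f t) (y t)) (at t)"
proof -
  have "((\<lambda>s. rot (f s) (y t)) \<longlongrightarrow> rot (f t) (y t)) (at t)"
    using isCont_tendsto_compose[OF isCont_rot f] .
  moreover have "((\<lambda>s. rot (f s) (y s - y t)) \<longlongrightarrow> 0) (at t)"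
  proof (rule Lim_null_comparison)
    show "\<forall>\<^sub>F s in at t. norm (rot (f s) (y s - y t)) \<le> 4 * norm (y s - y t)"
      by (intro always_eventually allI norm_rot_le)
    have "((\<lambda>s. 4 * norm (y s - y t)) \<longlongrightarrow> 4 * norm (y t - y t)) (at t)" by (intro tendsto_intros y)
    then show "((\<lambda>s. 4 * norm (y s - y t)) \<longlongrightarrow> 0) (at t)" by simp
  qed
  ultimately have "((\<lambda>s. rot (f s) (y t) + rot (f s) (y s - y t)) \<longlongrightarrow> rot (f t) (y t) + 0) (at t)"
    by (rule tendsto_add)
  then show ?thesis by (simp add: linear_diff[OF linear_rot])
qed

definition pot :: "(real^'d \<Rightarrow> real) \<Rightarrow> ('d::finite) cstate \<Rightarrow> 'd cstate" where
  "pot q z = (0, Mop q (NN (fst z)))"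

text \<open>\<open>pot q\<close> writes into the velocity and reads only the position, so its square
  is 0 and \<open>kick q\<close> is its exponential.\<close>

definition kick :: "(real^'d \<Rightarrow> real) \<Rightarrow> ('d::finite) cstate \<Rightarrow> 'd cstate" where
  "kick q z = z + pot q z"

lemma bounded_linear_pot: "trig q \<Longrightarrow> bounded_linear (pot q)"
  unfolding pot_def[abs_def]
  by (intro bounded_linear_Pair bounded_linear_zero bounded_linear_compose[OF bounded_linear_Mop]
      bounded_linear_fst_dg) simp_all

lemma Mop_bound: "trig q \<Longrightarrow> \<exists>B\<ge>0. \<forall>a. norm (Mop q a) \<le> B * norm a"
  using bounded_linear.nonneg_bounded[OF bounded_linear_Mop] by (metis mult.commute)

lemma norm_pot_le:
  assumes "\<And>a. norm (Mop q a) \<le> B * norm a" "0 \<le> B"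
  shows "norm (pot q z) \<le> B * norm z"
proof -
  have "norm (pot q z) \<le> B * norm (NN (fst z))" using assms(1) by (simp add: pot_def)
  also have "\<dots> \<le> B * norm z"
    using order_trans[OF norm_NN_le norm_fst_le[of "fst z" "snd z"]] assms(2) by (intro mult_left_mono) auto
  finally show ?thesis .
qed

text \<open>Interaction picture: pulled back by the free group, the controlled equation has a
  bounded generator. The constant 16 is the product of two bounds 4 from
  \<open>norm_rot_le\<close>.\<close>

lemma control_flow:
  fixes c :: "('d::finite) control"
  assumes B: "\<And>a. norm (Mop (qpot c) a) \<le> B * norm a" "0 \<le> B"
  shows "\<exists>Y. (\<forall>z. Y 0 z = z) \<and>
    (\<forall>t z. ((\<lambda>t. Y t z) has_vector_derivative rot (- t) (pot (qpot c) (rot t (Y t z)))) (at t)) \<and>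
    (\<forall>t z. norm (Y t z) \<le> exp (16 * B * \<bar>t\<bar>) * norm z) \<and> (\<forall>\<tau>>0. adm \<tau> (\<lambda>z. rot \<tau> (Y \<tau> z)))"
proof -
  let ?q = "qpot c" and ?K = "\<lambda>t z. rot (- t) (pot (qpot c) (rot t z))"
  note q = trig_qpot[of c]
  have lin: "linear (?K t)" for t
    by (intro bounded_linear.linear bounded_linear_compose[OF bounded_linear_rot]
        bounded_linear_compose[OF bounded_linear_pot[OF q]] bounded_linear_rot)
  have bd: "norm (?K t z) \<le> 16 * B * norm z" for t z
  proof -
    have "norm (?K t z) \<le> 4 * (B * (4 * norm z))"
      by (intro order_trans[OF norm_rot_le] mult_left_mono order_trans[OF norm_pot_le[OF B]] norm_rot_le B) auto
    then show ?thesis by simp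
  qed
  have cont: "continuous_on UNIV (\<lambda>t. ?K t (y t))" if y: "continuous_on UNIV y" for y :: "real \<Rightarrow> 'd cstate"
  proof (rule continuous_at_imp_continuous_on, rule ballI)
    fix t :: real
    have yt: "(y \<longlongrightarrow> y t) (at t)" using y by (simp add: continuous_on_eq_continuous_at isCont_def)
    have "((\<lambda>t. rot t (y t)) \<longlongrightarrow> rot t (y t)) (at t)" by (rule tendsto_rot[OF tendsto_ident_at yt])
    from bounded_linear.tendsto[OF bounded_linear_pot[OF q] this]
    have "((\<lambda>t. pot ?q (rot t (y t))) \<longlongrightarrow> pot ?q (rot t (y t))) (at t)" .
    from tendsto_rot[OF tendsto_minus[OF tendsto_ident_at] this]
    show "isCont (\<lambda>t. ?K t (y t)) t" by (simp add: isCont_def)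
  qed
  from linear_ode_flow[of ?K, OF lin bd _ cont] B(2)
  obtain Y where Y: "\<And>z. Y 0 z = z" "\<And>t. bounded_linear (Y t)"
    "\<And>t z. ((\<lambda>t. Y t z) has_vector_derivative ?K t (Y t z)) (at t)"
    "\<And>t z. norm (Y t z) \<le> exp (16 * B * \<bar>t\<bar>) * norm z" by auto
  have "adm \<tau> (\<lambda>z. rot \<tau> (Y \<tau> z))" if "\<tau> > 0" for \<tau>
  proof (rule adm_step[OF that bounded_linear_compose[OF bounded_linear_rot Y(2)]])
    fix W0 :: "'d state" assume W0: "H1L2 W0"
    let ?z = "shat W0"
    let ?Z = "\<lambda>t. rot t (Y t ?z)"
    have "mild_sol ?q W0 (\<lambda>t. st (?Z t))"
    proof (rule mild_sol_of_path[OF W0 q])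
      show "?Z 0 = ?z" by (simp add: Y)
      show "isCont ?Z t" for t
        unfolding isCont_def
        by (rule tendsto_rot[OF tendsto_ident_at])
           (use has_vector_derivative_continuous[OF Y(3)] in \<open>auto simp: isCont_def\<close>)
      fix k :: "int^'d" and s :: real
      let ?g = "\<lambda>s. cf (Mop ?q (NN (fst (?Z s)))) k"
      have unrot: "rot (- s) (?Z s) = Y s ?z" for s by (simp add: rot_rot)
      have "(\<lambda>s. of_real (cos (lamk k * s)) * cf (fst (?Z s)) k - of_real (sin (lamk k * s)) * cf (snd (?Z s)) k)
          = (\<lambda>s. cf (fst (rot (- s) (?Z s))) k)"
        by (rule ext) (simp add: cf_rot)
      then have 1: "(\<lambda>s. of_real (cos (lamk k * s)) * cf (fst (?Z s)) k - of_real (sin (lamk k * s)) * cf (snd (?Z s)) k)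
          = (\<lambda>s. cf (fst (Y s ?z)) k)" by (simp only: unrot)
      have "(\<lambda>s. of_real (sin (lamk k * s)) * cf (fst (?Z s)) k + of_real (cos (lamk k * s)) * cf (snd (?Z s)) k)
          = (\<lambda>s. cf (snd (rot (- s) (?Z s))) k)"
        by (rule ext) (simp add: cf_rot)
      then have 2: "(\<lambda>s. of_real (sin (lamk k * s)) * cf (fst (?Z s)) k + of_real (cos (lamk k * s)) * cf (snd (?Z s)) k)
          = (\<lambda>s. cf (snd (Y s ?z)) k)" by (simp only: unrot)
      have g1: "cf (fst (?K s (Y s ?z))) k = - of_real (sin (lamk k * s)) * ?g s"
        and g2: "cf (snd (?K s (Y s ?z))) k = of_real (cos (lamk k * s)) * ?g s"
        by (simp_all add: cf_rot pot_def)
      show "((\<lambda>s. of_real (cos (lamk k * s)) * cf (fst (?Z s)) k - of_real (sin (lamk k * s)) * cf (snd (?Z s)) k)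
          has_vector_derivative - of_real (sin (lamk k * s)) * ?g s) (at s)"
        unfolding 1 g1[symmetric]
        by (intro cf_has_vector_derivative bounded_linear.has_vector_derivative[OF bounded_linear_fst] Y)
      show "((\<lambda>s. of_real (sin (lamk k * s)) * cf (fst (?Z s)) k + of_real (cos (lamk k * s)) * cf (snd (?Z s)) k)
          has_vector_derivative of_real (cos (lamk k * s)) * ?g s) (at s)"
        unfolding 2 g2[symmetric]
        by (intro cf_has_vector_derivative bounded_linear.has_vector_derivative[OF bounded_linear_snd] Y)
    qed
    then show "\<exists>Wt. mild_sol ?q W0 Wt \<and> shat (Wt \<tau>) = rot \<tau> (Y \<tau> ?z)"
      by (intro exI[of _ "\<lambda>t. st (?Z t)"]) simp
  qed
  with Y show ?thesis by blast
qed

lemma abs_cos_minus_1_le: "\<bar>cos x - 1\<bar> \<le> \<bar>x\<bar>" for x :: real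
proof -
  have "\<bar>cos x - 1\<bar> = 2 * (\<bar>sin (x/2)\<bar> * \<bar>sin (x/2)\<bar>)"
    using cos_double_sin[of "x/2"] by (simp add: power2_eq_square abs_mult flip: abs_mult)
  also have "\<dots> \<le> 2 * (\<bar>x/2\<bar> * 1)"
    by (intro mult_left_mono mult_mono abs_sin_x_le_abs_x) auto
  finally show ?thesis by simp
qed

text \<open>Reading the state through \<open>NN\<close> spends one derivative, in exchange for which
  the free flow moves the position at most linearly in \<open>s\<close>, uniformly over all
  frequencies.\<close>

lemma norm_NN_rot_diff: "norm (NN (fst (rot s z)) - NN (fst z)) \<le> 2 * \<bar>s\<bar> * norm z"
proof -
  have ms: "\<bar>(cos (lamk k * s) - 1) / lamk k\<bar> \<le> \<bar>s\<bar>" "\<bar>sin (lamk k * s) / lamk k\<bar> \<le> \<bar>s\<bar>" for k :: "int^'a"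
    using abs_cos_minus_1_le[of "lamk k * s"] abs_sin_x_le_abs_x[of "lamk k * s"]
    by (simp_all add: abs_divide abs_mult abs_of_pos pos_divide_le_eq mult.commute)
  have m: "mult_sym (\<lambda>k::int^'a. (cos (lamk k * s) - 1) / lamk k)" "mult_sym (\<lambda>k::int^'a. sin (lamk k * s) / lamk k)"
    by (rule mult_symI, simp, rule ms)+
  have "NN (fst (rot s z)) - NN (fst z) = dg (\<lambda>k. (cos (lamk k * s) - 1) / lamk k) (fst z) + dg (\<lambda>k. sin (lamk k * s) / lamk k) (snd z)"
    by (rule hl2_eqI) (simp add: cf_rot cf_dg m, simp add: field_simps)
  also have "norm \<dots> \<le> \<bar>s\<bar> * norm (fst z) + \<bar>s\<bar> * norm (snd z)"
    by (intro order_trans[OF norm_triangle_ineq] add_mono norm_dg_le m ms)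
  also have "\<dots> \<le> \<bar>s\<bar> * norm z + \<bar>s\<bar> * norm z"
    using norm_fst_le[of "fst z" "snd z"] norm_snd_le[of "snd z" "fst z"] by (intro add_mono mult_left_mono) auto
  finally show ?thesis by simp
qed

lemma norm_NN_rot_pot:
  "norm (NN (fst (rot s (0, b)))) \<le> \<bar>s\<bar> * norm b"
proof -
  have ms: "\<bar>sin (lamk k * s) / lamk k\<bar> \<le> \<bar>s\<bar>" for k :: "int^'a"
    using abs_sin_x_le_abs_x[of "lamk k * s"]
    by (simp_all add: abs_divide abs_mult abs_of_pos pos_divide_le_eq mult.commute)
  have m: "mult_sym (\<lambda>k::int^'a. sin (lamk k * s) / lamk k)"
    by (rule mult_symI, simp, rule ms)
  have "NN (fst (rot s (0, b))) = dg (\<lambda>k. sin (lamk k * s) / lamk k) b"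
    by (rule hl2_eqI) (simp add: cf_rot cf_dg m)
  then show ?thesis using norm_dg_le[OF m ms, of b] by simp
qed

definition kickable :: "(real^'d \<Rightarrow> real) \<Rightarrow> bool" where
  "kickable \<phi> \<longleftrightarrow> (\<forall>z::('d::finite) cstate. reaches 0 z (kick \<phi> z))"

text \<open>An impulse is the limit of the constant control \<open>c / \<tau>\<close> acting during the short time \<open>\<tau>\<close>.\<close>
lemma kickable_qpot: "kickable (qpot c)"
  unfolding kickable_def
proof
  fix z :: "'a cstate"
  obtain B where B: "0 \<le> B" "\<And>a. norm (Mop (qpot c) a) \<le> B * norm a"
    using Mop_bound[OF trig_qpot[of c]] by blast
  \<comment> \<open>Over a time \<open>\<tau>\<close> with potential of size
    \<open>B / \<tau>\<close> the growth exponent is \<open>16 * B\<close>, independent of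
    \<open>\<tau>\<close>.\<close>
  define M where "M = exp (16 * B)"
  define D where "D = 4 * (B * ((B * (4 * (M * norm z))) + 2 * norm z))"
  have M0: "M > 0" by (simp add: M_def)
  have D0: "0 \<le> D" unfolding D_def using B M0 by (intro mult_nonneg_nonneg add_nonneg_nonneg) auto
  let ?P = "pot (qpot c) z"
  have est: "\<exists>F. adm \<tau> F \<and> norm (F z - kick (qpot c) z) \<le> 4 * (\<tau> * D + \<eta>) + norm (rot \<tau> (kick (qpot c) z) - kick (qpot c) z)"
    if \<tau>: "0 < \<tau>" and \<eta>: "\<And>s. 0 \<le> s \<Longrightarrow> s \<le> \<tau> \<Longrightarrow> norm (rot (- s) ?P - ?P) \<le> \<eta>" for \<tau> \<eta>
  proof -
    have Mt: "Mop (qpot ((1/\<tau>) *\<^sub>R c)) a = (1/\<tau>) *\<^sub>R Mop (qpot c) a" for a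
      unfolding qpot_scaleR by (rule Mop_scale[OF trig_qpot])
    have pt: "pot (qpot ((1/\<tau>) *\<^sub>R c)) y = (1/\<tau>) *\<^sub>R pot (qpot c) y" for y
      by (simp add: pot_def Mt)
    have Bt: "norm (Mop (qpot ((1/\<tau>) *\<^sub>R c)) a) \<le> B / \<tau> * norm a" for a
      unfolding Mt using B(2)[of a] \<tau> by (simp add: divide_right_mono)
    obtain Y where Y: "\<And>z. Y 0 z = z"
      "\<And>t z. ((\<lambda>t. Y t z) has_vector_derivative rot (- t) (pot (qpot ((1/\<tau>) *\<^sub>R c)) (rot t (Y t z)))) (at t)"
      "\<And>t z. norm (Y t z) \<le> exp (16 * (B / \<tau>) * \<bar>t\<bar>) * norm z" "adm \<tau> (\<lambda>z. rot \<tau> (Y \<tau> z))"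
      using control_flow[of "(1/\<tau>) *\<^sub>R c" "B / \<tau>", OF Bt divide_nonneg_pos[OF B(1) \<tau>]] \<tau> by blast
    define b where "b s = Mop (qpot c) (NN (fst (rot s (Y s z))))" for s
    have Yd: "((\<lambda>t. Y t z) has_vector_derivative (1/\<tau>) *\<^sub>R rot (- s) (0, b s)) (at s)" for s
      using Y(2)[of z s] unfolding pt linear_scale[OF linear_rot] by (simp add: b_def pot_def)
    have YM: "norm (Y s z) \<le> M * norm z" if "0 \<le> s" "s \<le> \<tau>" for s
    proof -
      have "16 * (B / \<tau>) * \<bar>s\<bar> \<le> 16 * (B / \<tau>) * \<tau>" using that B(1) \<tau> by (intro mult_left_mono) auto
      then have "exp (16 * (B / \<tau>) * \<bar>s\<bar>) \<le> M" using \<tau> by (simp add: M_def)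
      then show ?thesis using Y(3)[of s z] mult_right_mono[OF _ norm_ge_zero[of z]] order_trans by blast
    qed
    have bM: "norm (b s) \<le> B * (4 * (M * norm z))" if "0 \<le> s" "s \<le> \<tau>" for s
    proof -
      have "norm (NN (fst (rot s (Y s z)))) \<le> norm (fst (rot s (Y s z)))" by (rule norm_NN_le)
      also have "\<dots> \<le> norm (rot s (Y s z))" by (metis norm_fst_le prod.collapse)
      also have "\<dots> \<le> 4 * norm (Y s z)" by (rule norm_rot_le)
      also have "\<dots> \<le> 4 * (M * norm z)" using YM[OF that] by simp
      finally have "B * norm (NN (fst (rot s (Y s z)))) \<le> B * (4 * (M * norm z))" by (rule mult_left_mono) (rule B)
      then show ?thesis unfolding b_def by (rule order_trans[OF B(2)])
    qed
    \<comment> \<open>The strong control changes the position only through the velocity: its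
      derivative is 1/\<tau> times a quantity of order \<tau>, hence bounded uniformly in
      \<open>\<tau>\<close>.\<close>
    have step: "norm (NN (fst (rot s (Y s z))) - NN (fst (rot s z))) \<le> s * (B * (4 * (M * norm z)))"
      if s: "0 \<le> s" "s \<le> \<tau>" for s
    proof -
      let ?f = "\<lambda>\<sigma>. NN (fst (rot s (Y \<sigma> z)))"
      have fd: "(?f has_vector_derivative (1/\<tau>) *\<^sub>R NN (fst (rot (s - \<sigma>) (0, b \<sigma>)))) (at \<sigma>)" for \<sigma>
      proof -
        have "bounded_linear (\<lambda>x. NN (fst (rot s x)))"
          by (intro bounded_linear_compose[OF bounded_linear_dg[OF mult_sym_N]] bounded_linear_compose[OF bounded_linear_fst] bounded_linear_rot)
        from bounded_linear.has_vector_derivative[OF this Yd[of \<sigma>]]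
        show ?thesis
          by (simp add: linear_scale[OF linear_rot] rot_rot linear_scale[OF bounded_linear.linear[OF bounded_linear_dg[OF mult_sym_N]]])
      qed
      have "norm (?f s - ?f 0) \<le> (B * (4 * (M * norm z))) * (s - 0)"
      proof (rule norm_diff_le_vector_derivative)
        show "(?f has_vector_derivative (1/\<tau>) *\<^sub>R NN (fst (rot (s - \<sigma>) (0, b \<sigma>)))) (at \<sigma> within {0..s})" for \<sigma>
          by (rule has_vector_derivative_at_within[OF fd])
        show "norm ((1/\<tau>) *\<^sub>R NN (fst (rot (s - \<sigma>) (0, b \<sigma>)))) \<le> B * (4 * (M * norm z))" if "\<sigma> \<in> {0..s}" for \<sigma>
        proof -
          have "norm (NN (fst (rot (s - \<sigma>) (0, b \<sigma>)))) \<le> \<bar>s - \<sigma>\<bar> * norm (b \<sigma>)" by (rule norm_NN_rot_pot)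
          also have "\<dots> \<le> \<tau> * (B * (4 * (M * norm z)))"
            using that s by (intro mult_mono bM) auto
          finally show ?thesis using \<tau> by (simp add: pos_divide_le_eq mult.commute)
        qed
      qed (use s in auto)
      then show ?thesis using s by (simp add: Y mult.commute)
    qed
    have dev: "norm ((1/\<tau>) *\<^sub>R rot (- s) (0, b s) - (1/\<tau>) *\<^sub>R ?P) \<le> (\<tau> * D + \<eta>) / \<tau>" if s: "0 \<le> s" "s \<le> \<tau>" for s
    proof -
      let ?b0 = "Mop (qpot c) (NN (fst z))"
      have "b s - ?b0 = Mop (qpot c) (NN (fst (rot s (Y s z))) - NN (fst z))"
        unfolding b_def by (simp add: linear_diff[OF bounded_linear.linear[OF bounded_linear_Mop[OF trig_qpot]]])
      then have "norm (b s - ?b0) \<le> B * norm (NN (fst (rot s (Y s z))) - NN (fst z))" using B(2) by simp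
      also have "\<dots> \<le> B * (s * (B * (4 * (M * norm z))) + 2 * \<bar>s\<bar> * norm z)"
      proof (intro mult_left_mono B)
        have "NN (fst (rot s (Y s z))) - NN (fst z) = (NN (fst (rot s (Y s z))) - NN (fst (rot s z))) + (NN (fst (rot s z)) - NN (fst z))"
          by simp
        also have "norm \<dots> \<le> s * (B * (4 * (M * norm z))) + 2 * \<bar>s\<bar> * norm z"
          by (intro order_trans[OF norm_triangle_ineq] add_mono step norm_NN_rot_diff s)
        finally show "norm (NN (fst (rot s (Y s z))) - NN (fst z)) \<le> s * (B * (4 * (M * norm z))) + 2 * \<bar>s\<bar> * norm z" .
      qed
      also have "\<dots> = s * (D / 4)" using s by (simp add: D_def algebra_simps)
      finally have bb: "norm (b s - ?b0) \<le> s * (D / 4)" .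
      have "rot (- s) (0, b s) - ?P = rot (- s) (0, b s - ?b0) + (rot (- s) ?P - ?P)"
      proof -
        have "(0, b s) = (0, b s - ?b0) + ?P" by (simp add: pot_def)
        then show ?thesis using linear_add[OF linear_rot, of "-s" "(0, b s - ?b0)" ?P] by simp
      qed
      also have "norm \<dots> \<le> 4 * (s * (D / 4)) + \<eta>"
        using bb by (intro order_trans[OF norm_triangle_ineq] add_mono \<eta> s order_trans[OF norm_rot_le] mult_left_mono) auto
      also have "\<dots> \<le> \<tau> * D + \<eta>" using s D0 by (simp add: mult_right_mono)
      finally show ?thesis using \<tau> by (simp add: divide_right_mono flip: scaleR_diff_right)
    qed
    \<comment> \<open>Subtracting the ideal linear ramp from 0 to \<open>?P\<close> leaves a path
      with small derivative, so its increment measures the distance to the impulse.\<close>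
    let ?h = "\<lambda>s. Y s z - (s / \<tau>) *\<^sub>R ?P"
    have hd: "(?h has_vector_derivative (1/\<tau>) *\<^sub>R rot (- s) (0, b s) - (1/\<tau>) *\<^sub>R ?P) (at s)" for s
    proof -
      have "((\<lambda>s. s / \<tau>) has_real_derivative 1 / \<tau>) (at s)"
        by (rule DERIV_cdivide[OF DERIV_ident])
      then show ?thesis
        using Yd[of s] \<tau> by (auto intro!: derivative_eq_intros simp: has_real_derivative_iff_has_vector_derivative)
    qed
    have "norm (?h \<tau> - ?h 0) \<le> ((\<tau> * D + \<eta>) / \<tau>) * (\<tau> - 0)"
      by (rule norm_diff_le_vector_derivative[OF has_vector_derivative_at_within[OF hd] dev]) (use \<tau> in auto)
    then have close: "norm (Y \<tau> z - kick (qpot c) z) \<le> \<tau> * D + \<eta>"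
      using \<tau> by (simp add: Y kick_def diff_diff_eq add.commute[of z])
    have "rot \<tau> (Y \<tau> z) - kick (qpot c) z = rot \<tau> (Y \<tau> z - kick (qpot c) z) + (rot \<tau> (kick (qpot c) z) - kick (qpot c) z)"
      by (simp add: linear_diff[OF linear_rot])
    also have "norm \<dots> \<le> 4 * (\<tau> * D + \<eta>) + norm (rot \<tau> (kick (qpot c) z) - kick (qpot c) z)"
      by (intro order_trans[OF norm_triangle_ineq] add_mono order_trans[OF norm_rot_le] mult_left_mono close order_refl) auto
    finally show ?thesis using Y(4) by blast
  qed
  show "reaches 0 z (kick (qpot c) z)"
    unfolding reaches_def
  proof (intro allI impI)
    fix e :: real assume e: "e > 0"
    have lim: "((\<lambda>s. rot s y) \<longlongrightarrow> rot 0 y) (at 0)" for y :: "'a cstate"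
      by (rule isCont_rot[unfolded isCont_def])
    have near: "\<exists>d>0. \<forall>s. s \<noteq> 0 \<longrightarrow> \<bar>s\<bar> < d \<longrightarrow> norm (rot s y - y) < r" if "r > 0" for r and y :: "'a cstate"
      using lim[of y, unfolded LIM_def dist_norm, rule_format, OF that] by auto
    have "\<exists>d1>0. \<forall>s. s \<noteq> 0 \<longrightarrow> \<bar>s\<bar> < d1 \<longrightarrow> norm (rot s ?P - ?P) < e/16"
      "\<exists>d2>0. \<forall>s. s \<noteq> 0 \<longrightarrow> \<bar>s\<bar> < d2 \<longrightarrow> norm (rot s (kick (qpot c) z) - kick (qpot c) z) < e/4"
      by (rule near, use e in simp)+
    then obtain d1 d2 where d1: "d1 > 0" "\<And>s. s \<noteq> 0 \<Longrightarrow> \<bar>s\<bar> < d1 \<Longrightarrow> norm (rot s ?P - ?P) < e/16"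
      and d2: "d2 > 0" "\<And>s. s \<noteq> 0 \<Longrightarrow> \<bar>s\<bar> < d2 \<Longrightarrow> norm (rot s (kick (qpot c) z) - kick (qpot c) z) < e/4"
      by blast
    \<comment> \<open>The errors add up to less than 4 * (e/16 + e/16) + e/4, which is below
      \<open>e\<close>.\<close>
    define \<tau> where "\<tau> = min (min (d1/2) (d2/2)) (min e (e / (16 * (D + 1))))"
    have \<tau>: "\<tau> > 0" "\<tau> < d1" "\<tau> < d2" "\<tau> \<le> e" using d1(1) d2(1) e D0 by (auto simp: \<tau>_def)
    have "\<tau> * D \<le> e / (16 * (D + 1)) * (D + 1)" using D0 \<tau>(1) by (intro mult_mono) (auto simp: \<tau>_def)
    also have "\<dots> = e / 16" using D0 by (simp add: divide_simps)
    finally have tD: "\<tau> * D \<le> e / 16" .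
    have "norm (rot (- s) ?P - ?P) \<le> e/16" if "0 \<le> s" "s \<le> \<tau>" for s
      using d1(2)[of "-s"] that \<tau> e by (cases "s = 0") (auto intro: less_imp_le)
    from est[OF \<tau>(1) this] obtain F where F: "adm \<tau> F"
      "norm (F z - kick (qpot c) z) \<le> 4 * (\<tau> * D + e/16) + norm (rot \<tau> (kick (qpot c) z) - kick (qpot c) z)" by blast
    have "norm (F z - kick (qpot c) z) < e"
      using F(2) tD d2(2)[of \<tau>] \<tau> e by auto
    then show "\<exists>t F. adm t F \<and> 0 \<le> t \<and> t \<le> 0 + e \<and> norm (F z - kick (qpot c) z) < e"
      using F(1) \<tau> by (intro exI[of _ \<tau>] exI[of _ F]) auto
  qed
qed

section \<open>The algebra of impulses\<close>

lemma kick_Pair: "kick q (u, v) = (u, v + Mop q (NN u))"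
  by (simp add: kick_def pot_def)

lemma dg_zero [simp]: "dg (\<lambda>_. 0) a = 0"
  by (rule hl2_eqI) (simp add: cf_dg mult_symI[where B=0])

lemma dg_one [simp]: "dg (\<lambda>_. 1) a = a"
  by (rule hl2_eqI) (simp add: cf_dg mult_symI[where B=1])

text \<open>Impulses leave the position untouched, so successive ones simply add.\<close>

lemma kickable_add:
  assumes "trig \<phi>" "trig \<psi>" "kickable \<phi>" "kickable \<psi>"
  shows "kickable (\<lambda>x. \<phi> x + \<psi> x)"
  unfolding kickable_def
proof
  fix z :: "'a cstate"
  have "kick \<psi> (kick \<phi> z) = kick (\<lambda>x. \<phi> x + \<psi> x) z"
    by (cases z) (simp add: kick_Pair Mop_add assms)
  then show "reaches 0 z (kick (\<lambda>x. \<phi> x + \<psi> x) z)"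
    using assms(3,4) reaches_trans0 unfolding kickable_def by metis
qed

lemma wC_zero [simp]: "wC 0 k = 1" and wS_zero [simp]: "wS 0 k = 0"
  by (simp_all add: wC_def wS_def)

lemma wC_minus_1_le: "\<bar>(wC t k - 1) / lamk k\<bar> \<le> \<bar>t\<bar>"
proof -
  have "\<bar>wC t k - 1\<bar> \<le> \<bar>kap k * t\<bar>" unfolding wC_def by (rule abs_cos_minus_1_le)
  also have "\<dots> \<le> lamk k * \<bar>t\<bar>" using kap_le_lamk[of k] by (simp add: abs_mult mult_right_mono)
  finally show ?thesis by (simp add: abs_divide abs_of_pos pos_divide_le_eq mult.commute)
qed

text \<open>Conjugating the wave flow during a time \<open>\<tau>\<close> by opposite impulses \<open>\<plusminus> s \<phi>\<close> with \<open>s^2 \<tau> = 1\<close>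
  leaves, as \<open>\<tau>\<close> tends to 0, the second bracket of the generator with \<open>\<phi>\<close>: an impulse \<open>- \<phi>^2\<close>.\<close>
lemma kickable_neg_square:
  assumes t: "trig \<phi>" and k: "\<And>s. kickable (\<lambda>x. s * \<phi> x)"
  shows "kickable (\<lambda>x. - (\<phi> x * \<phi> x))"
  unfolding kickable_def
proof
  fix z :: "'a cstate"
  obtain u v where z: "z = (u, v)" by (cases z)
  let ?Q = "Mop \<phi>"
  note blQ = bounded_linear_Mop[OF t]
  note lQ = bounded_linear.linear[OF blQ]
  \<comment> \<open>Boundedness on H1 writes the velocity created by the first impulse as
    \<open>NN (Q1 u)\<close>; without this gain of a derivative, the terms of order
    \<open>s n\<close> need not tend to 0.\<close>
  obtain Q1 where Q1: "bounded_linear Q1" "\<And>b. ?Q (NN b) = NN (Q1 b)" using Mop_NN[OF t] by blast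
  define s where "s n = real (Suc n)" for n
  define \<tau> where "\<tau> n = 1 / (s n)^2" for n
  have s: "s n > 0" for n by (simp add: s_def)
  have \<tau>: "\<tau> n > 0" for n using s[of n] by (simp add: \<tau>_def)
  have s\<tau>: "s n * \<tau> n = inverse (s n)" and s2\<tau>: "(s n)^2 * \<tau> n = 1" for n
    using s[of n] by (simp_all add: \<tau>_def power2_eq_square field_simps)
  have inv0: "(\<lambda>n. inverse (s n)) \<longlonglongrightarrow> 0" unfolding s_def by (rule LIMSEQ_inverse_real_of_nat)
  have \<tau>0: "\<tau> \<longlonglongrightarrow> 0"
    using tendsto_power[OF inv0, of 2] by (simp add: \<tau>_def[abs_def] power_inverse divide_inverse)
  have atz: "filterlim \<tau> (at 0) sequentially"
    using \<tau>0 \<tau> by (auto simp: filterlim_at intro!: always_eventually less_imp_neq[THEN not_sym])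
  have C1: "(\<lambda>n. wC (\<tau> n) k) \<longlonglongrightarrow> 1" for k :: "int^'a"
    using filterlim_compose[OF wC_tendsto[of k 0] atz] by simp
  have S0: "(\<lambda>n. wS (\<tau> n) k) \<longlonglongrightarrow> 0" for k :: "int^'a"
    using filterlim_compose[OF wS_tendsto[of k 0] atz] by simp
  \<comment> \<open>The factor s^2 equals 1/\<tau>, so this is the derivative of \<open>wS\<close>
    at time 0.\<close>
  have S1: "(\<lambda>n. (s n)^2 * wS (\<tau> n) k) \<longlonglongrightarrow> 1" for k :: "int^'a"
  proof -
    have "((\<lambda>h. (wS (0 + h) k - wS 0 k) / h) \<longlongrightarrow> wC 0 k) (at 0)"
      using wS_deriv[of k 0] by (simp add: DERIV_def)
    then have "((\<lambda>h. wS h k / h) \<longlongrightarrow> 1) (at 0)" by simp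
    from filterlim_compose[OF this atz] show ?thesis by (simp add: \<tau>_def mult.commute)
  qed
  have A1: "(\<lambda>n. dg (wC (\<tau> n)) a) \<longlonglongrightarrow> a" for a :: "'a hl2"
    using tendsto_dg[of "\<lambda>n. wC (\<tau> n)" 1 sequentially "\<lambda>_. 1" a] C1 mult_symI[of "\<lambda>_. 1" 1]
    by (simp add: abs_wC_le)
  have \<tau>1: "\<tau> n \<le> 1" for n
  proof -
    have "1 \<le> (s n)^2" by (intro one_le_power) (simp add: s_def)
    then show ?thesis using s[of n] by (simp add: \<tau>_def pos_divide_le_eq)
  qed
  have A2: "(\<lambda>n. dg (\<lambda>k. ksq k * wS (\<tau> n) k / lamk k) a) \<longlonglongrightarrow> 0" for a :: "'a hl2"
  proof -
    have "(\<lambda>n. ksq k * wS (\<tau> n) k / lamk k) \<longlonglongrightarrow> ksq k * 0 / lamk k" for k :: "int^'a"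
      by (intro tendsto_intros S0) simp
    moreover have "\<forall>\<^sub>F n in sequentially. mult_sym (\<lambda>k::int^'a. ksq k * wS (\<tau> n) k / lamk k) \<and>
        (\<forall>k::int^'a. \<bar>ksq k * wS (\<tau> n) k / lamk k\<bar> \<le> 1)"
      by (intro always_eventually allI conjI mult_sym_ksq_wS ksq_wS_le)
    ultimately show ?thesis
      using tendsto_dg[of "\<lambda>n k. ksq k * wS (\<tau> n) k / lamk k" 1 sequentially "\<lambda>_. 0" a] mult_symI[of "\<lambda>_. 0" 1]
      by simp
  qed
  have A6: "(\<lambda>n. dg (\<lambda>k. lamk k * wS (\<tau> n) k) a) \<longlonglongrightarrow> 0" for a :: "'a hl2"
  proof -
    have "(\<lambda>n. lamk k * wS (\<tau> n) k) \<longlonglongrightarrow> lamk k * 0" for k :: "int^'a"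
      by (intro tendsto_intros S0)
    moreover have "\<bar>lamk k * wS (\<tau> n) k\<bar> \<le> 2" for k :: "int^'a" and n
      using lamk_wS_le[of k "\<tau> n"] \<tau>[of n] \<tau>1[of n] by linarith
    ultimately show ?thesis
      using tendsto_dg[of "\<lambda>n k. lamk k * wS (\<tau> n) k" 2 sequentially "\<lambda>_. 0" a] mult_symI[of "\<lambda>_. 0" 1]
      by simp
  qed
  have null: "(\<lambda>n. inverse (s n) * norm a) \<longlonglongrightarrow> 0" for a :: "'a hl2"
    using tendsto_mult_left_zero[OF inv0] by simp
  \<comment> \<open>The factor \<open>NN\<close> turns the deviation of \<open>wC\<close> from 1
    into a multiplier of size \<open>\<tau> n\<close>, and s times \<tau> is 1/s.\<close>
  have A3: "(\<lambda>n. s n *\<^sub>R (dg (wC (\<tau> n)) (NN b) - NN b)) \<longlonglongrightarrow> 0" for b :: "'a hl2"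
  proof (rule Lim_null_comparison[OF always_eventually null[of b]], rule allI)
    fix n
    have ms: "mult_sym (\<lambda>k::int^'a. (wC (\<tau> n) k - 1) / lamk k)"
      by (rule mult_symI[OF _ wC_minus_1_le]) simp
    have "dg (wC (\<tau> n)) (NN b) - NN b = dg (\<lambda>k. (wC (\<tau> n) k - 1) / lamk k) b"
      by (rule hl2_eqI) (simp add: cf_dg ms, simp add: field_simps)
    also have "norm \<dots> \<le> \<bar>\<tau> n\<bar> * norm b" by (rule norm_dg_le[OF ms wC_minus_1_le])
    finally have "s n * norm (dg (wC (\<tau> n)) (NN b) - NN b) \<le> s n * (\<tau> n * norm b)"
      using s[of n] \<tau>[of n] by simp
    then show "norm (s n *\<^sub>R (dg (wC (\<tau> n)) (NN b) - NN b)) \<le> inverse (s n) * norm b"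
      using s[of n] s\<tau>[of n] by (simp add: mult.assoc[symmetric])
  qed
  have A4: "(\<lambda>n. s n *\<^sub>R dg (wS (\<tau> n)) a) \<longlonglongrightarrow> 0" for a :: "'a hl2"
  proof (rule Lim_null_comparison[OF always_eventually null[of a]], rule allI)
    fix n
    have "s n * norm (dg (wS (\<tau> n)) a) \<le> s n * (\<tau> n * norm a)"
      using norm_dg_le[OF mult_sym_wS abs_wS_le, of "\<tau> n" a] s[of n] \<tau>[of n] by simp
    then show "norm (s n *\<^sub>R dg (wS (\<tau> n)) a) \<le> inverse (s n) * norm a"
      using s[of n] s\<tau>[of n] by (simp add: mult.assoc[symmetric])
  qed
  have A5: "(\<lambda>n. (s n)^2 *\<^sub>R dg (wS (\<tau> n)) a) \<longlonglongrightarrow> a" for a :: "'a hl2"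
  proof -
    have b: "\<bar>(s n)^2 * wS (\<tau> n) k\<bar> \<le> 1" for n and k :: "int^'a"
    proof -
      have "(s n)^2 * \<bar>wS (\<tau> n) k\<bar> \<le> (s n)^2 * \<tau> n"
        using abs_wS_le[of "\<tau> n" k] \<tau>[of n] by (intro mult_left_mono) auto
      then show ?thesis by (simp add: s2\<tau> abs_mult)
    qed
    have m: "mult_sym (\<lambda>k::int^'a. (s n)^2 * wS (\<tau> n) k)" for n by (rule mult_symI[OF _ b]) simp
    have "dg (\<lambda>k. (s n)^2 * wS (\<tau> n) k) a = (s n)^2 *\<^sub>R dg (wS (\<tau> n)) a" for n
      by (rule hl2_eqI) (simp add: cf_dg m mult.assoc)
    then show ?thesis
      using tendsto_dg[of "\<lambda>n k. (s n)^2 * wS (\<tau> n) k" 1 sequentially "\<lambda>_. 1" a] S1 mult_symI[of "\<lambda>_. 1" 1]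
      by (simp add: m b)
  qed
  let ?g = "?Q (NN u)"
  define y where "y n = kick (\<lambda>x. - s n * \<phi> x) (wv (\<tau> n) (kick (\<lambda>x. s n * \<phi> x) z))" for n
  have fy: "fst (y n) = dg (wC (\<tau> n)) u + dg (\<lambda>k. lamk k * wS (\<tau> n) k) v + s n *\<^sub>R dg (wS (\<tau> n)) (Q1 u)" for n
  proof -
    have "dg (\<lambda>k. lamk k * wS (\<tau> n) k) (v + s n *\<^sub>R NN (Q1 u)) = dg (\<lambda>k. lamk k * wS (\<tau> n) k) v + s n *\<^sub>R dg (wS (\<tau> n)) (Q1 u)"
      by (rule hl2_eqI) (simp add: cf_dg algebra_simps)
    then show ?thesis by (simp add: y_def z kick_def pot_def wv_def Mop_scale[OF t] Q1(2))
  qed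
  \<comment> \<open>The two terms of order \<open>s n\<close> are already paired into differences
    here. In the limit only \<open>v\<close> and the last term, of order s^2 \<tau> = 1, survive;
    the latter is the second bracket.\<close>
  have sy: "snd (y n) = dg (wC (\<tau> n)) v - dg (\<lambda>k. ksq k * wS (\<tau> n) k / lamk k) u
      + s n *\<^sub>R (dg (wC (\<tau> n)) (NN (Q1 u)) - NN (Q1 u)) - ?Q (s n *\<^sub>R (dg (wC (\<tau> n)) (NN u) - NN u))
      - ?Q (s n *\<^sub>R dg (wS (\<tau> n)) v) - ?Q ((s n)^2 *\<^sub>R dg (wS (\<tau> n)) ?g)" for n
  proof -
    have N1: "NN (fst (wv (\<tau> n) (u, v + s n *\<^sub>R ?g))) = dg (wC (\<tau> n)) (NN u) + (dg (wS (\<tau> n)) v + s n *\<^sub>R dg (wS (\<tau> n)) ?g)"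
      by (rule hl2_eqI) (simp add: wv_def cf_dg field_simps)
    have N2: "dg (wC (\<tau> n)) (v + s n *\<^sub>R ?g) = dg (wC (\<tau> n)) v + s n *\<^sub>R dg (wC (\<tau> n)) (NN (Q1 u))"
      unfolding Q1(2) by (rule hl2_eqI) (simp add: cf_dg algebra_simps)
    have "snd (y n) = snd (wv (\<tau> n) (u, v + s n *\<^sub>R ?g)) + (- s n) *\<^sub>R ?Q (NN (fst (wv (\<tau> n) (u, v + s n *\<^sub>R ?g))))"
      using Mop_scale[OF t, of "s n"] Mop_scale[OF t, of "- s n"] by (simp add: y_def z kick_def pot_def)
    also have "snd (wv (\<tau> n) (u, v + s n *\<^sub>R ?g)) = dg (wC (\<tau> n)) v + s n *\<^sub>R dg (wC (\<tau> n)) (NN (Q1 u)) - dg (\<lambda>k. ksq k * wS (\<tau> n) k / lamk k) u"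
      unfolding wv_def snd_conv fst_conv N2 ..
    finally show ?thesis
      unfolding N1
      by (simp add: linear_add[OF lQ] linear_diff[OF lQ] linear_scale[OF lQ] Q1(2) scaleR_add_right scaleR_diff_right power2_eq_square)
  qed
  have "reaches (0 + \<tau> n) z (y n)" for n
  proof -
    have "reaches (\<tau> n) z (wv (\<tau> n) (kick (\<lambda>x. s n * \<phi> x) z))"
      using reaches_trans[OF _ reaches_wv[OF \<tau>[of n]]] k[of "s n"] unfolding kickable_def by fastforce
    from reaches_trans0[OF this] have "reaches (\<tau> n) z (y n)"
      using k[of "- s n"] unfolding kickable_def y_def by blast
    then show ?thesis by simp
  qed
  moreover have "y \<longlonglongrightarrow> kick (\<lambda>x. - (\<phi> x * \<phi> x)) z"
  proof -
    have "(\<lambda>n. fst (y n)) \<longlonglongrightarrow> u + 0 + 0" unfolding fy by (intro tendsto_add A1 A6 A4)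
    moreover have "(\<lambda>n. snd (y n)) \<longlonglongrightarrow> v - 0 + 0 - ?Q 0 - ?Q 0 - ?Q ?g"
      unfolding sy by (intro tendsto_add tendsto_diff bounded_linear.tendsto[OF blQ] A1 A2 A3 A4 A5)
    ultimately have "(\<lambda>n. (fst (y n), snd (y n))) \<longlonglongrightarrow> (u + 0 + 0, v - 0 + 0 - ?Q 0 - ?Q 0 - ?Q ?g)"
      by (rule tendsto_Pair)
    moreover have "kick (\<lambda>x. - (\<phi> x * \<phi> x)) z = (u, v - ?Q ?g)"
      using Mop_scale[OF trig_mult[OF t t], of "-1" "NN u"] Mop_mult[OF t t, of "NN u"] by (simp add: z kick_Pair)
    ultimately show ?thesis by (simp add: linear_0[OF lQ])
  qed
  ultimately show "reaches 0 z (kick (\<lambda>x. - (\<phi> x * \<phi> x)) z)"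
    using \<tau> \<tau>0 by (intro reaches_limit[of 0 \<tau> z y]) (auto intro: less_imp_le)
qed

text \<open>Invariance under all real factors is the property to propagate, since the bracket with a
  function yields its square with a negative sign only.\<close>

definition fully_kickable :: "(real^'d \<Rightarrow> real) \<Rightarrow> bool" where
  "fully_kickable \<phi> \<longleftrightarrow> trig (\<phi> :: real^('d::finite) \<Rightarrow> real) \<and> (\<forall>s. kickable (\<lambda>x. s * \<phi> x))"

lemma fully_kickable_qpot: "fully_kickable (qpot c)"
  unfolding fully_kickable_def using trig_qpot kickable_qpot[of "_ *\<^sub>R c"] by (simp add: qpot_scaleR)

lemma fully_kickable_scale: "fully_kickable \<phi> \<Longrightarrow> fully_kickable (\<lambda>x. r * \<phi> x)"
  unfolding fully_kickable_def by (simp add: trig.scale flip: mult.assoc)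

lemma fully_kickable_add: "fully_kickable \<phi> \<Longrightarrow> fully_kickable \<psi> \<Longrightarrow> fully_kickable (\<lambda>x. \<phi> x + \<psi> x)"
proof -
  assume f: "fully_kickable \<phi>" "fully_kickable \<psi>"
  then have t: "trig \<phi>" "trig \<psi>" by (auto simp: fully_kickable_def)
  have "kickable (\<lambda>x. s * \<phi> x + s * \<psi> x)" for s
    by (rule kickable_add) (use f t in \<open>auto simp: fully_kickable_def intro: trig.scale\<close>)
  then show "fully_kickable (\<lambda>x. \<phi> x + \<psi> x)" unfolding fully_kickable_def by (simp add: distrib_left trig.add t)
qed

lemma fully_kickable_diff: "fully_kickable \<phi> \<Longrightarrow> fully_kickable \<psi> \<Longrightarrow> fully_kickable (\<lambda>x. \<phi> x - \<psi> x)"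
  using fully_kickable_add[OF _ fully_kickable_scale[of \<psi> "-1"], of \<phi>] by simp

lemma fully_kickable_const: "fully_kickable (\<lambda>x. c)"
  using fully_kickable_scale[OF fully_kickable_qpot[of "(1, 0, 0)"], of c] by (simp add: qpot_one)

lemma fully_kickable_neg_square:
  assumes "fully_kickable \<phi>" "0 \<le> c"
  shows "kickable (\<lambda>x. - c * (\<phi> x * \<phi> x))"
proof -
  have f: "fully_kickable (\<lambda>x. sqrt c * \<phi> x)" by (rule fully_kickable_scale[OF assms(1)])
  have "kickable (\<lambda>x. - ((sqrt c * \<phi> x) * (sqrt c * \<phi> x)))"
    by (rule kickable_neg_square) (use f in \<open>auto simp: fully_kickable_def\<close>)
  moreover have "(\<lambda>x. - ((sqrt c * \<phi> x) * (sqrt c * \<phi> x))) = (\<lambda>x. - c * (\<phi> x * \<phi> x))"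
    using assms(2) by (auto simp: mult_ac)
  ultimately show ?thesis by simp
qed

text \<open>The missing positive multiples of f^2 come from the partner \<open>g\<close>: s f^2 = s
  - s g^2 uses only a constant and a negative square.\<close>

lemma fully_kickable_square:
  assumes f: "fully_kickable f" and g: "fully_kickable g" and fg: "\<And>x. f x * f x + g x * g x = 1"
  shows "fully_kickable (\<lambda>x. f x * f x)"
  unfolding fully_kickable_def
proof (intro conjI allI)
  have t: "trig f" "trig g" using f g by (auto simp: fully_kickable_def)
  then show "trig (\<lambda>x. f x * f x)" by (intro trig_mult)
  fix s :: real
  show "kickable (\<lambda>x. s * (f x * f x))"
  proof (cases "s \<le> 0")
    case True
    then show ?thesis using fully_kickable_neg_square[OF f, of "-s"] by simp
  next
    case False
    have "kickable (\<lambda>x. s * 1 + - s * (g x * g x))"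
      using fully_kickable_const[of 1] False
      by (intro kickable_add fully_kickable_neg_square g trig.scale trig_mult t trig_const) (auto simp: fully_kickable_def)
    moreover have "(\<lambda>x. s * 1 + - s * (g x * g x)) = (\<lambda>x. s * (f x * f x))"
    proof
      fix x
      have "f x * f x = 1 - g x * g x" using fg[of x] by simp
      then show "s * 1 + - s * (g x * g x) = s * (f x * f x)" by (simp only:) (simp add: right_diff_distrib)
    qed
    ultimately show ?thesis by simp
  qed
qed

text \<open>Polarisation: a negative multiple of (f + h)^2, with the two squares added back, leaves
  -2 c f h. Taking \<open>h\<close> as \<open>g\<close> or \<open>- g\<close> yields both
  signs.\<close>

lemma fully_kickable_mult:
  assumes f: "fully_kickable f" and g: "fully_kickable g" and f2: "fully_kickable (\<lambda>x. f x * f x)" and g2: "fully_kickable (\<lambda>x. g x * g x)"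
  shows "fully_kickable (\<lambda>x. f x * g x)"
proof -
  have neg: "kickable (\<lambda>x. - (2 * c) * (f x * h x))"
    if h: "fully_kickable h" and h2: "fully_kickable (\<lambda>x. h x * h x)" and c: "0 \<le> c" for c h
  proof -
    have fh: "fully_kickable (\<lambda>x. f x + h x)" by (rule fully_kickable_add[OF f h])
    have sq: "fully_kickable (\<lambda>x. f x * f x + h x * h x)" by (rule fully_kickable_add[OF f2 h2])
    have "kickable (\<lambda>x. - c * ((f x + h x) * (f x + h x)) + c * (f x * f x + h x * h x))"
      using fh sq c by (intro kickable_add fully_kickable_neg_square trig.scale trig_mult) (auto simp: fully_kickable_def)
    moreover have "(\<lambda>x. - c * ((f x + h x) * (f x + h x)) + c * (f x * f x + h x * h x)) = (\<lambda>x. - (2 * c) * (f x * h x))"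
      by (rule ext) (simp add: algebra_simps)
    ultimately show ?thesis by simp
  qed
  show ?thesis
    unfolding fully_kickable_def
  proof (intro conjI allI)
    show "trig (\<lambda>x. f x * g x)" using f g by (auto simp: fully_kickable_def intro: trig_mult)
    fix s :: real
    show "kickable (\<lambda>x. s * (f x * g x))"
    proof (cases "s \<le> 0")
      case True
      then show ?thesis using neg[OF g g2, of "- s / 2"] by simp
    next
      case False
      have "fully_kickable (\<lambda>x. - 1 * g x)" by (rule fully_kickable_scale[OF g])
      moreover have "fully_kickable (\<lambda>x. (- 1 * g x) * (- 1 * g x))" using g2 by simp
      ultimately show ?thesis using neg[of "\<lambda>x. - 1 * g x" "s / 2"] False by simp
    qed
  qed
qed

text \<open>Each frequency carries a pair with cos^2 + sin^2 = 1, so all squares are available and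
  the addition formulas reduce to products.\<close>

lemma fully_kickable_cos_sin_add:
  assumes k: "fully_kickable (\<lambda>x. cos (kdot k x))" "fully_kickable (\<lambda>x. sin (kdot k x))"
    and l: "fully_kickable (\<lambda>x. cos (kdot l x))" "fully_kickable (\<lambda>x. sin (kdot l x))"
  shows "fully_kickable (\<lambda>x. cos (kdot (k + l) x))" "fully_kickable (\<lambda>x. sin (kdot (k + l) x))"
proof -
  have sq: "fully_kickable (\<lambda>x. cos (kdot j x) * cos (kdot j x))" "fully_kickable (\<lambda>x. sin (kdot j x) * sin (kdot j x))"
    if "fully_kickable (\<lambda>x. cos (kdot j x))" "fully_kickable (\<lambda>x. sin (kdot j x))" for j :: "int^'a"
    using fully_kickable_square[OF that] fully_kickable_square[OF that(2,1)]
    by (simp_all add: sin_cos_squared_add3 add.commute[of "sin _ * sin _"])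
  note sqk = sq[OF k] and sql = sq[OF l]
  show "fully_kickable (\<lambda>x. cos (kdot (k + l) x))"
    unfolding kdot_add cos_add
    by (rule fully_kickable_diff[OF fully_kickable_mult[OF k(1) l(1) sqk(1) sql(1)] fully_kickable_mult[OF k(2) l(2) sqk(2) sql(2)]])
  show "fully_kickable (\<lambda>x. sin (kdot (k + l) x))"
    unfolding kdot_add sin_add
    by (rule fully_kickable_add[OF fully_kickable_mult[OF k(2) l(1) sqk(2) sql(1)] fully_kickable_mult[OF k(1) l(2) sqk(1) sql(2)]])
qed

lemma int_vec_induct:
  fixes P :: "int^'d::finite \<Rightarrow> bool"
  assumes z: "P 0" and ax: "\<And>i. P (axis i 1)" and ad: "\<And>k l. P k \<Longrightarrow> P l \<Longrightarrow> P (k + l)" and ne: "\<And>k. P k \<Longrightarrow> P (- k)"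
  shows "P k"
proof -
  have a: "P (axis i n)" for i and n :: int
  proof (induction n rule: int_induct[where k=0])
    case base
    have "axis i 0 = (0 :: int^'d)" by (simp add: vec_eq_iff axis_def)
    then show ?case using z by (simp only:)
  next
    case (step1 n)
    have "axis i (n + 1) = (axis i n + axis i 1 :: int^'d)" by (simp add: vec_eq_iff axis_def)
    then show ?case using ad[OF step1.IH ax[of i]] by simp
  next
    case (step2 n)
    have "axis i (n - 1) = (axis i n + - axis i 1 :: int^'d)" by (simp add: vec_eq_iff axis_def)
    then show ?case using ad[OF step2.IH ne[OF ax[of i]]] by simp
  qed
  have "P (\<Sum>i\<in>I. axis i (k $ i))" for I
    by (induction I rule: infinite_finite_induct) (auto intro: z ad a)
  moreover have "k = (\<Sum>i\<in>UNIV. axis i (k $ i))"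
    by (simp add: vec_eq_iff axis_def)
  ultimately show ?thesis by metis
qed

lemma fully_kickable_cos_sin: "fully_kickable (\<lambda>x. cos (kdot k x)) \<and> fully_kickable (\<lambda>x. sin (kdot k x))"
proof (induction k rule: int_vec_induct)
  case 1
  then show ?case by (simp add: fully_kickable_const)
next
  case (2 i)
  have "qpot (0, 0, axis i 1) = (\<lambda>x. cos (x $ i))" "qpot (0, axis i 1, 0) = (\<lambda>x. sin (x $ i))"
    by (auto simp: qpot_def axis_def if_distrib[of "\<lambda>r. r * _"] cong: if_cong)
  then show ?case using fully_kickable_qpot[of "(0, 0, axis i 1)"] fully_kickable_qpot[of "(0, axis i 1, 0)"] by (simp add: kdot_axis)
next
  case (3 k l)
  then show ?case using fully_kickable_cos_sin_add[of k l] by blast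
next
  case (4 k)
  then show ?case using fully_kickable_scale[of "\<lambda>x. sin (kdot k x)" "-1"] by (simp add: kdot_uminus)
qed

lemma fully_kickable_trig: "trig \<phi> \<Longrightarrow> fully_kickable \<phi>"
  by (induction rule: trig.induct) (auto simp: fully_kickable_cos_sin intro: fully_kickable_scale fully_kickable_add)

lemma reaches_kick: "trig \<phi> \<Longrightarrow> reaches 0 z (kick \<phi> z)"
proof -
  assume "trig \<phi>"
  then have "kickable (\<lambda>x. 1 * \<phi> x)" using fully_kickable_trig[of \<phi>] unfolding fully_kickable_def by blast
  then show ?thesis unfolding kickable_def mult_1 by blast
qed

section \<open>Controllability\<close>

text \<open>Each nonzero \<open>k\<close> excludes the multiples of pi/|k|; altogether only
  countably many times are excluded.\<close>

lemma exists_injective_time: "\<exists>\<delta>>0. \<forall>k::int^'d::finite. wS \<delta> k \<noteq> 0"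
proof -
  let ?C = "(\<lambda>(k::int^'d, n::int). of_int n * pi / kap k) ` UNIV"
  have "countable ?C" by (rule countable_image) simp
  moreover have "uncountable {0<..<1::real}" by (simp add: uncountable_open_interval)
  ultimately have "\<not> {0<..<1::real} \<subseteq> ?C" using countable_subset by blast
  then obtain \<delta> where "\<delta> \<in> {0<..<1}" and \<delta>C: "\<delta> \<notin> ?C" by blast
  then have \<delta>: "\<delta> > 0" by simp
  have "wS \<delta> k \<noteq> 0" for k :: "int^'d"
  proof
    assume z: "wS \<delta> k = 0"
    then have k: "k \<noteq> 0" using \<delta> by (auto simp: wS_def)
    then have kk: "kap k > 0" using kap_ge_1[of k] by linarith
    have "sin (kap k * \<delta>) = 0" using z wS_eq[of k \<delta>] by simp
    then obtain n :: int where "kap k * \<delta> = of_int n * pi" using sin_zero_iff_int2 by blast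
    then have "\<delta> = of_int n * pi / kap k" using kk by (simp add: field_simps)
    then have "\<delta> \<in> ?C" by (intro image_eqI[of _ _ "(k, n)"]) auto
    with \<delta>C show False ..
  qed
  with \<delta> show ?thesis by blast
qed

lemma finite_imp_AE_lborel:
  fixes S :: "real set"
  assumes "finite S" shows "AE x in lborel. x \<notin> S"
  by (rule AE_not_in) (simp add: countable_imp_null_set_lborel countable_finite assms)

text \<open>At almost every point only finitely many parameters are exceptional; Fubini exchanges the
  point and the parameter.\<close>
lemma AE_poly_nonzero:
  fixes f :: "nat \<Rightarrow> real^'d::finite \<Rightarrow> real"
  assumes m: "\<And>i. f i \<in> borel_measurable tM" and nz: "AE x in tM. f n x \<noteq> 0"
  shows "AE M in lborel. AE x in tM. (\<Sum>i\<le>n. M ^ i * f i x) \<noteq> 0"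
proof -
  interpret F: finite_measure "tM :: (real^'d) measure" by (rule finite_measure_tM)
  interpret P: pair_sigma_finite "tM :: (real^'d) measure" "lborel :: real measure" ..
  note [measurable] = m
  have "AE x in tM. AE M in lborel. (\<Sum>i\<le>n. M ^ i * f i x) \<noteq> 0"
    using nz
  proof eventually_elim
    fix x assume x: "f n x \<noteq> 0"
    have "finite {M::real. (\<Sum>i\<le>n. f i x * M ^ i) = 0}"
      by (rule polyfun_roots_finite[where c="\<lambda>i. f i x" and k=n]) (use x in auto)
    from finite_imp_AE_lborel[OF this] show "AE M in lborel. (\<Sum>i\<le>n. M ^ i * f i x) \<noteq> 0"
      by (simp add: mult.commute)
  qed
  then show ?thesis
    by (subst (asm) P.AE_commute) measurable
qed

lemma AE_lborel_imp_ex: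
  fixes a b :: real
  assumes "AE M in lborel. P M" "a < b"
  shows "\<exists>M. a < M \<and> M < b \<and> P M"
proof (rule ccontr)
  assume "\<nexists>M. a < M \<and> M < b \<and> P M"
  with assms(1) have "AE M in lborel. M \<notin> {a<..<b}" by (auto elim!: eventually_mono)
  then have "emeasure lborel {a<..<b} = 0"
    by (subst (asm) AE_iff_measurable[of "{a<..<b}"]) auto
  then show False using assms(2) by simp
qed

lemma reaches_velocity:
  assumes nz: "AE x in tM. RF (NN u) x \<noteq> 0"
  shows "reaches 0 (u, v) (u, v')"
proof -
  have "\<exists>\<phi>. trig \<phi> \<and> norm ((v' - v) - Mop \<phi> (NN u)) < inverse (real (Suc n))" for n
    by (rule Mop_dense[OF nz]) simp
  then obtain \<phi> where \<phi>: "\<And>n. trig (\<phi> n)" "\<And>n. norm ((v' - v) - Mop (\<phi> n) (NN u)) < inverse (real (Suc n))"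
    by metis
  have "(\<lambda>n. v' - v - Mop (\<phi> n) (NN u)) \<longlonglongrightarrow> 0"
    by (rule Lim_null_comparison[OF always_eventually LIMSEQ_inverse_real_of_nat]) (use \<phi>(2) in \<open>auto intro: less_imp_le\<close>)
  from tendsto_diff[OF tendsto_const[of v'] this] have "(\<lambda>n. v + Mop (\<phi> n) (NN u)) \<longlonglongrightarrow> v'"
    by (simp add: algebra_simps)
  then have "(\<lambda>n. kick (\<phi> n) (u, v)) \<longlonglongrightarrow> (u, v')"
    unfolding kick_Pair by (intro tendsto_Pair tendsto_const)
  then show ?thesis using reaches_closed reaches_kick[OF \<phi>(1)] by metis
qed

definition one_hat :: "('d::finite) hl2" where "one_hat = hat (\<lambda>x. 1)"

lemma L2T_one: "L2T (\<lambda>x::real^'d. 1)"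
  unfolding L2T_iff by (auto simp: periodic_T_def intro!: tM_integrable_bounded[where B=1])

lemma fcoef_one: "fcoef (\<lambda>x::real^'d. 1) k = (if k = 0 then 1 else 0)"
proof -
  have "(\<integral>x. cis (- kdot k x) \<partial>tM) = (\<integral>x. cis (kdot (- k) x) \<partial>(tM :: (real^'d) measure))" by (simp add: kdot_uminus)
  also have "\<dots> = (if - k = 0 then (2*pi)^CARD('d) else 0)" by (rule integral_cis_kdot)
  finally show ?thesis unfolding fcoef_tM by (auto simp: power_mult_distrib)
qed

lemma cf_one_hat: "cf one_hat k = (if k = 0 then 1 else 0)"
  unfolding one_hat_def by (simp add: cf_hat L2T_one fcoef_one)

text \<open>Velocity is set, the wave equation runs for \<open>\<delta>\<close>, and velocity is set
  again. The last correction needs an arrival position with null zero set, which is obtained by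
  adding a small constant to the target.\<close>

lemma reaches_everything:
  assumes nz: "AE x in tM. RF (NN u) x \<noteq> 0" and \<delta>: "\<delta> > 0" "\<And>k::int^'d::finite. wS \<delta> k \<noteq> 0"
  shows "reaches \<delta> (u, v) (U, V :: 'd hl2)"
proof -
  define y where "y = U - dg (wC \<delta>) u"
  \<comment> \<open>The inverse of \<open>wS \<delta>\<close> is unbounded in \<open>k\<close>, so
    the required velocity exists in L2 only after cutting the target to finitely many modes.\<close>
  define ind where "ind n k = (if k \<in> ksqs n then 1 else 0 :: real)" for n and k :: "int^'d"
  have ks: "- k \<in> ksqs n \<longleftrightarrow> k \<in> ksqs n" for k :: "int^'d" and n by (simp add: ksqs_def)
  have indm: "mult_sym (ind n)" for n by (rule mult_symI[where B=1]) (auto simp: ind_def ks)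
  define q where "q n k = ind n k / (lamk k * wS \<delta> k)" for n and k :: "int^'d"
  have qm: "mult_sym (q n)" for n
  proof (rule mult_symI)
    show "q n (- k) = q n k" for k by (simp add: q_def ind_def ks)
    show "\<bar>q n k\<bar> \<le> (\<Sum>k\<in>ksqs n. \<bar>q n k\<bar>)" for k
    proof (cases "k \<in> ksqs n")
      case True
      then show ?thesis by (intro member_le_sum) auto
    next
      case False
      then show ?thesis by (simp add: q_def ind_def sum_nonneg)
    qed
  qed
  define Uf where "Uf n = dg (wC \<delta>) u + dg (ind n) y" for n
  \<comment> \<open>The cut-off keeps the zero mode, so the constant perturbation is hit
    exactly.\<close>
  have one0: "0 \<in> ksqs n" for n by (simp add: ksqs_def)
  have hit: "fst (wv \<delta> (u, dg (q n) (y + M *\<^sub>R one_hat))) = Uf n + M *\<^sub>R one_hat" for n M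
    by (rule hl2_eqI)
       (use \<delta>(2) in \<open>auto simp: wv_def cf_dg qm indm Uf_def q_def ind_def cf_one_hat one0 field_simps\<close>)
  have "\<exists>M. 0 < M \<and> M < inverse (real (Suc n)) \<and> (AE x in tM. RF (NN (Uf n + M *\<^sub>R one_hat)) x \<noteq> 0)" for n
  proof -
    \<comment> \<open>A polynomial of degree 1 in \<open>M\<close> with top coefficient 1: almost
      every small \<open>M\<close> leaves a null zero set.\<close>
    define f where "f i = (if i = 0 then RF (NN (Uf n)) else (\<lambda>x. 1))" for i :: nat
    have fL: "L2T (f i)" for i by (simp add: f_def RF L2T_one)
    have "AE M in lborel. AE x in tM. (\<Sum>i\<le>1. M ^ i * f i x) \<noteq> 0"
      by (rule AE_poly_nonzero[OF L2T_measurable[OF fL]]) (simp add: f_def)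
    from AE_lborel_imp_ex[OF this, of 0 "inverse (real (Suc n))"]
    obtain M where M: "0 < M" "M < inverse (real (Suc n))" "AE x in tM. (\<Sum>i\<le>1. M ^ i * f i x) \<noteq> 0" by auto
    have "hat (\<lambda>x. RF (NN (Uf n)) x + M * 1) = NN (Uf n + M *\<^sub>R one_hat)"
    proof -
      have "hat (\<lambda>x. RF (NN (Uf n)) x + M * 1) = NN (Uf n) + M *\<^sub>R one_hat"
        using hat_add[OF RF(1) L2T_scale[OF L2T_one], of "NN (Uf n)" M]
        by (simp only: one_hat_def hat_RF hat_scale[OF L2T_one])
      also have "\<dots> = NN (Uf n + M *\<^sub>R one_hat)"
        by (rule hl2_eqI) (simp add: cf_one_hat add_divide_distrib)
      finally show ?thesis .
    qed
    then have "AE x in tM. RF (NN (Uf n + M *\<^sub>R one_hat)) x = RF (NN (Uf n)) x + M * 1"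
      by (intro hat_eq_imp_AE RF(1) L2T_add L2T_scale L2T_one) simp
    with M(3) have "AE x in tM. RF (NN (Uf n + M *\<^sub>R one_hat)) x \<noteq> 0"
      by eventually_elim (simp add: f_def)
    with M show ?thesis by blast
  qed
  then obtain M where M: "\<And>n. 0 < M n" "\<And>n. M n < inverse (real (Suc n))"
    "\<And>n. AE x in tM. RF (NN (Uf n + M n *\<^sub>R one_hat)) x \<noteq> 0" by metis
  have r: "reaches \<delta> (u, v) (Uf n + M n *\<^sub>R one_hat, V)" for n
  proof -
    let ?v = "dg (q n) (y + M n *\<^sub>R one_hat)"
    have "reaches 0 (u, v) (u, ?v)" by (rule reaches_velocity[OF nz])
    from reaches_trans[OF this reaches_wv[OF \<delta>(1)]]
    have 1: "reaches \<delta> (u, v) (wv \<delta> (u, ?v))" by simp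
    have "wv \<delta> (u, ?v) = (Uf n + M n *\<^sub>R one_hat, snd (wv \<delta> (u, ?v)))" using hit by (metis prod.collapse)
    with 1 have "reaches \<delta> (u, v) (Uf n + M n *\<^sub>R one_hat, snd (wv \<delta> (u, ?v)))" by simp
    then show ?thesis by (rule reaches_trans0) (rule reaches_velocity[OF M(3)])
  qed
  have "(\<lambda>n. Uf n + M n *\<^sub>R one_hat) \<longlonglongrightarrow> U"
  proof -
    have "M \<longlonglongrightarrow> 0"
      by (rule Lim_null_comparison[OF always_eventually LIMSEQ_inverse_real_of_nat])
         (use M(1,2) in \<open>auto simp: abs_of_pos intro: less_imp_le\<close>)
    have lim: "(\<lambda>n. ind n k) \<longlonglongrightarrow> 1" for k
    proof -
      obtain n0 where "k \<in> ksqs n0" using ksqs_cover by blast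
      then have "\<forall>\<^sub>F n in sequentially. ind n k = 1"
        using ksqs_mono by (auto simp: eventually_sequentially ind_def)
      then show ?thesis by (rule tendsto_eventually)
    qed
    have "(\<lambda>n. dg (ind n) y) \<longlonglongrightarrow> dg (\<lambda>_. 1) y"
    proof (rule tendsto_dg[where B=1])
      show "\<forall>\<^sub>F n in sequentially. mult_sym (ind n) \<and> (\<forall>k. \<bar>ind n k\<bar> \<le> 1)"
        using indm by (auto simp: ind_def)
    qed (auto intro: lim mult_symI[where B=1])
    then have "(\<lambda>n. dg (wC \<delta>) u + dg (ind n) y + M n *\<^sub>R one_hat) \<longlonglongrightarrow> dg (wC \<delta>) u + y + 0 *\<^sub>R one_hat"
      by (intro tendsto_intros \<open>M \<longlonglongrightarrow> 0\<close>) simp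
    then show ?thesis by (simp add: Uf_def y_def)
  qed
  then have "(\<lambda>n. (Uf n + M n *\<^sub>R one_hat, V)) \<longlonglongrightarrow> (U, V)" by (intro tendsto_Pair tendsto_const)
  with r show ?thesis by (rule reaches_closed)
qed

definition reaches_poly :: "nat \<Rightarrow> ('d::finite) cstate \<Rightarrow> real \<Rightarrow> (nat \<Rightarrow> 'd cstate) \<Rightarrow> bool" where
  "reaches_poly n x T z \<longleftrightarrow> (\<forall>M. reaches T x (\<Sum>i\<le>n. M ^ i *\<^sub>R z i))"

text \<open>Composing with 1 + M \<open>pot \<phi>\<close> raises the degree by one, and the new top
  coefficient depends on the old one alone. Time and coefficients do not depend on \<open>M\<close>,
  so that \<open>M\<close> can be chosen at the end.\<close>

lemma reaches_poly_round:
  assumes r: "reaches_poly n x T z" and t: "trig \<phi>" and \<tau>: "\<tau> > 0"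
  shows "\<exists>z'. reaches_poly (Suc n) x (T + \<tau>) z' \<and> z' (Suc n) = wv \<tau> (pot \<phi> (z n))"
proof -
  note lp = bounded_linear.linear[OF bounded_linear_pot[OF t]]
  note lw = bounded_linear.linear[OF bounded_linear_wv]
  \<comment> \<open>Coefficients of the product of 1 + M \<open>pot \<phi>\<close> with the old
    polynomial: the old ones plus the old ones shifted by one degree.\<close>
  define g where "g i = (if i \<le> n then z i else 0) + (case i of 0 \<Rightarrow> 0 | Suc m \<Rightarrow> pot \<phi> (z m))" for i
  have "reaches (T + \<tau>) x (\<Sum>i\<le>Suc n. M ^ i *\<^sub>R wv \<tau> (g i))" for M
  proof -
    let ?s = "\<Sum>i\<le>n. M ^ i *\<^sub>R z i"
    have k: "kick (\<lambda>x. M * \<phi> x) ?s = ?s + M *\<^sub>R pot \<phi> ?s"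
      by (simp add: kick_def pot_def Mop_scale[OF t])
    have "(\<Sum>i\<le>Suc n. M ^ i *\<^sub>R g i) = (\<Sum>i\<le>Suc n. M ^ i *\<^sub>R (if i \<le> n then z i else 0))
        + (\<Sum>i\<le>Suc n. M ^ i *\<^sub>R (case i of 0 \<Rightarrow> 0 | Suc m \<Rightarrow> pot \<phi> (z m)))"
      by (simp add: g_def scaleR_add_right sum.distrib del: sum.atMost_Suc)
    also have "(\<Sum>i\<le>Suc n. M ^ i *\<^sub>R (if i \<le> n then z i else 0)) = ?s" by simp
    also have "(\<Sum>i\<le>Suc n. M ^ i *\<^sub>R (case i of 0 \<Rightarrow> 0 | Suc m \<Rightarrow> pot \<phi> (z m))) = M *\<^sub>R pot \<phi> ?s"
      by (subst sum.atMost_Suc_shift) (simp add: linear_sum[OF lp] linear_scale[OF lp] scaleR_sum_right)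
    finally have eq: "kick (\<lambda>x. M * \<phi> x) ?s = (\<Sum>i\<le>Suc n. M ^ i *\<^sub>R g i)" using k by simp
    have "reaches T x (kick (\<lambda>x. M * \<phi> x) ?s)"
      using r reaches_kick[OF trig.scale[OF t]] reaches_trans0 unfolding reaches_poly_def by blast
    from reaches_trans[OF this reaches_wv[OF \<tau>]]
    have "reaches (T + \<tau>) x (wv \<tau> (\<Sum>i\<le>Suc n. M ^ i *\<^sub>R g i))" by (simp only: eq)
    then show ?thesis by (simp only: linear_sum[OF lw] linear_scale[OF lw])
  qed
  moreover have "g (Suc n) = pot \<phi> (z n)" by (simp add: g_def)
  ultimately show ?thesis unfolding reaches_poly_def by (intro exI[of _ "\<lambda>i. wv \<tau> (g i)"]) simp
qed

lemma cf_NN_power: "cf ((NN ^^ n) a) k = cf a k / of_real (lamk k ^ n)"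
  by (induction n) (auto simp: power_commutes)

text \<open>With the constant impulse each round multiplies the top position by
  \<open>wS \<delta>\<close>. This adds one factor \<open>NN\<close>, as
  \<open>lamk k * wS \<delta> k\<close> is bounded, and loses no mode, as \<open>wS \<delta>\<close>
  has no zero.\<close>

lemma reaches_poly_smooth:
  fixes x :: "('d::finite) cstate"
  assumes x: "fst x \<noteq> 0" and \<delta>: "\<delta> > 0" "\<And>k::int^'d. wS \<delta> k \<noteq> 0"
  shows "\<exists>T\<ge>0. \<exists>z b. reaches_poly n x T z \<and> fst (z n) = (NN ^^ n) b \<and> fst (z n) \<noteq> 0"
proof (induction n)
  case 0
  have "reaches_poly 0 x 0 (\<lambda>_. x)" by (simp add: reaches_poly_def reaches_refl)
  then show ?case using x by (intro exI[of _ 0] conjI exI[of _ "\<lambda>_. x"] exI[of _ "fst x"]) auto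
next
  case (Suc n)
  then obtain T z b where IH: "T \<ge> 0" "reaches_poly n x T z" "fst (z n) = (NN ^^ n) b" "fst (z n) \<noteq> 0" by blast
  obtain z' where z': "reaches_poly (Suc n) x (T + \<delta>) z'" "z' (Suc n) = wv \<delta> (pot (\<lambda>x. 1) (z n))"
    using reaches_poly_round[OF IH(2) trig_const \<delta>(1)] by blast
  have f: "cf (fst (z' (Suc n))) k = of_real (wS \<delta> k) * cf (fst (z n)) k" for k
    by (simp add: z'(2) wv_def pot_def cf_dg)
  have "fst (z' (Suc n)) = (NN ^^ Suc n) (dg (\<lambda>k. lamk k * wS \<delta> k) b)"
    by (rule hl2_eqI) (simp only: f IH(3) cf_NN_power cf_dg mult_sym_lamk_wS, simp)
  moreover obtain k where "cf (fst (z n)) k \<noteq> 0" using IH(4) by (metis hl2_eqI cf_zero)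
  then have "cf (fst (z' (Suc n))) k \<noteq> 0" using \<delta>(2)[of k] by (simp add: f)
  then have "fst (z' (Suc n)) \<noteq> 0" by auto
  ultimately show ?case using z'(1) IH(1) \<delta>(1) by (intro exI[of _ "T + \<delta>"]) auto
qed

section \<open>Absolute summability and a dominant mean\<close>

lemma sum_int_bounded: "\<exists>C\<ge>0. \<forall>S::int set. finite S \<longrightarrow> (\<Sum>m\<in>S. 1 / (1 + (real_of_int m)^2)) \<le> C"
proof -
  let ?f = "\<lambda>n::nat. 1 / (1 + (real n)^2)"
  have sm: "summable ?f"
  proof (rule summable_comparison_test'[where N=1])
    show "summable (\<lambda>n. inverse (real n ^ 2))" by (rule inverse_power_summable) simp
    show "norm (?f n) \<le> inverse (real n ^ 2)" if "n \<ge> 1" for n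
      using that by (simp add: divide_inverse le_imp_inverse_le)
  qed
  have "(\<Sum>m\<in>S. 1 / (1 + (real_of_int m)^2)) \<le> 2 * suminf ?f" if S: "finite S" for S :: "int set"
  proof -
    let ?g = "\<lambda>m::int. 1 / (1 + (real_of_int m)^2)"
    let ?A = "nat ` (S \<inter> {0..})" and ?B = "(\<lambda>m. nat (- m)) ` (S \<inter> {..<0})"
    have g0: "0 \<le> ?g m" for m by (simp add: add_nonneg_nonneg)
    have "sum ?g S = sum ?g (S \<inter> {0..}) + sum ?g (S \<inter> {..<0})"
      by (subst sum.union_disjoint[symmetric]) (use S in \<open>auto intro!: sum.cong\<close>)
    also have "sum ?g (S \<inter> {0..}) = sum ?f ?A"
      by (subst sum.reindex) (auto simp: inj_on_def intro!: sum.cong)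
    also have "sum ?g (S \<inter> {..<0}) = sum ?f ?B"
      by (subst sum.reindex) (auto simp: inj_on_def intro!: sum.cong)
    also have "sum ?f ?A + sum ?f ?B \<le> suminf ?f + suminf ?f"
      by (intro add_mono sum_le_suminf sm) (use S in \<open>auto simp: add_nonneg_nonneg\<close>)
    finally show ?thesis by simp
  qed
  moreover have "0 \<le> 2 * suminf ?f" by (intro mult_nonneg_nonneg suminf_nonneg sm) (auto simp: add_nonneg_nonneg)
  ultimately show ?thesis by blast
qed

text \<open>The d-th power of 1 + |k|^2 is at least the product of the 1 + k_i^2, and over a box the
  sum of the reciprocal products factorises into one-dimensional sums.\<close>

lemma sum_lamk_bounded:
  "\<exists>C. \<forall>F::(int^'d::finite) set. finite F \<longrightarrow> (\<Sum>k\<in>F. 1 / (1 + ksq k) ^ CARD('d)) \<le> C"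
proof -
  obtain C where C: "C \<ge> 0" "\<And>S::int set. finite S \<Longrightarrow> (\<Sum>m\<in>S. 1 / (1 + (real_of_int m)^2)) \<le> C"
    using sum_int_bounded by blast
  have "(\<Sum>k\<in>F. 1 / (1 + ksq k) ^ CARD('d)) \<le> C ^ CARD('d)" if F: "finite F" for F :: "(int^'d) set"
  proof -
    let ?h = "\<lambda>m::int. 1 / (1 + (real_of_int m)^2)"
    define S where "S = (\<Union>i. (\<lambda>k. k $ i) ` F)"
    have S: "finite S" using F by (simp add: S_def)
    have h0: "0 \<le> ?h m" for m by (simp add: add_nonneg_nonneg)
    have "(\<Sum>k\<in>F. 1 / (1 + ksq k) ^ CARD('d)) \<le> (\<Sum>k\<in>F. \<Prod>i\<in>UNIV. ?h (k $ i))"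
    proof (rule sum_mono)
      fix k :: "int^'d"
      have "(\<Prod>i\<in>(UNIV::'d set). 1 / (1 + ksq k)) \<le> (\<Prod>i\<in>UNIV. ?h (k $ i))"
      proof (rule prod_mono, intro conjI)
        fix i
        have "(real_of_int (k $ i))^2 \<le> ksq k" unfolding ksq_def by (rule member_le_sum) auto
        then show "1 / (1 + ksq k) \<le> ?h (k $ i)" by (intro divide_left_mono) (auto intro!: mult_pos_pos add_pos_nonneg)
        show "0 \<le> 1 / (1 + ksq k)" by (simp add: add_nonneg_nonneg)
      qed
      then show "1 / (1 + ksq k) ^ CARD('d) \<le> (\<Prod>i\<in>UNIV. ?h (k $ i))" by (simp add: power_divide)
    qed
    also have "\<dots> = (\<Sum>g\<in>vec_nth ` F. \<Prod>i\<in>UNIV. ?h (g i))"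
      by (subst sum.reindex) (auto simp: inj_on_def vec_nth_inject)
    also have "\<dots> \<le> (\<Sum>g\<in>PiE UNIV (\<lambda>_::'d. S). \<Prod>i\<in>UNIV. ?h (g i))"
      by (rule sum_mono2) (use S h0 in \<open>auto intro!: finite_PiE prod_nonneg simp: S_def\<close>)
    also have "\<dots> = (\<Prod>i\<in>(UNIV::'d set). \<Sum>m\<in>S. ?h m)"
      by (rule prod_sum_PiE[symmetric]) (use S in auto)
    also have "\<dots> \<le> (\<Prod>i\<in>(UNIV::'d set). C)"
      by (rule prod_mono) (use C(2)[OF S] h0 in \<open>auto intro: sum_nonneg\<close>)
    finally show ?thesis by simp
  qed
  then show ?thesis by blast
qed

text \<open>Young's inequality splits |b_k| / \<open>lamk k\<close> ^ d into |b_k|^2 and (1 +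
  |k|^2)^(-d), both summable; this fixes the number of smoothing rounds.\<close>

lemma smooth_l1:
  fixes b :: "('d::finite) hl2"
  shows "\<exists>C. \<forall>F. finite F \<longrightarrow> (\<Sum>k\<in>F. cmod (cf ((NN ^^ CARD('d)) b) k)) \<le> C"
proof -
  obtain C where C: "\<And>F::(int^'d) set. finite F \<Longrightarrow> (\<Sum>k\<in>F. 1 / (1 + ksq k) ^ CARD('d)) \<le> C"
    using sum_lamk_bounded by blast
  have "(\<Sum>k\<in>F. cmod (cf ((NN ^^ CARD('d)) b) k)) \<le> (norm b)^2 + C" if F: "finite F" for F
  proof -
    have "cmod (cf ((NN ^^ CARD('d)) b) k) \<le> (cmod (cf b k))^2 + 1 / (1 + ksq k) ^ CARD('d)" for k
    proof -
      define p where "p = 1 / lamk k ^ CARD('d)"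
      have "p^2 = 1 / (1 + ksq k) ^ CARD('d)"
        unfolding lamk_sq[symmetric] by (simp add: p_def power_divide mult.commute flip: power_mult)
      moreover have "cmod (cf ((NN ^^ CARD('d)) b) k) = cmod (cf b k) * p"
        by (simp add: cf_NN_power norm_divide norm_power p_def abs_of_pos)
      moreover have "cmod (cf b k) * p \<le> (cmod (cf b k))^2 + p^2"
      proof -
        have "0 \<le> cmod (cf b k) * p" by (simp add: p_def less_imp_le)
        then show ?thesis using sum_squares_bound[of "cmod (cf b k)" p] by linarith
      qed
      ultimately show ?thesis by simp
    qed
    then have "(\<Sum>k\<in>F. cmod (cf ((NN ^^ CARD('d)) b) k)) \<le> (\<Sum>k\<in>F. (cmod (cf b k))^2 + 1 / (1 + ksq k) ^ CARD('d))"
      by (intro sum_mono) auto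
    also have "\<dots> \<le> (norm b)^2 + C"
      unfolding sum.distrib by (intro add_mono hl2_sum_le_norm C F)
    finally show ?thesis .
  qed
  then show ?thesis by blast
qed

text \<open>The margin 1 keeps every partial sum at distance at least 1 from zero at every point, a
  closed condition that survives the almost everywhere limit.\<close>

lemma dominant_mode_nonzero:
  fixes a :: "('d::finite) hl2"
  assumes d: "\<And>F. finite F \<Longrightarrow> 0 \<notin> F \<Longrightarrow> (\<Sum>k\<in>F. cmod (cf a k)) + 1 \<le> cmod (cf a 0)"
  shows "AE x in tM. RF a x \<noteq> 0"
proof -
  have ge: "1 \<le> \<bar>psum a n x\<bar>" for n x
  proof -
    have "0 \<in> ksqs n" by (simp add: ksqs_def)
    then have "tpoly (ksqs n) (cf a) x = cf a 0 + tpoly (ksqs n - {0}) (cf a) x"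
      unfolding tpoly_def by (subst sum.remove[of _ 0]) auto
    moreover have "cmod (tpoly (ksqs n - {0}) (cf a) x) \<le> (\<Sum>k\<in>ksqs n - {0}. cmod (cf a k))"
      by (rule cmod_tpoly_le)
    ultimately have "1 \<le> cmod (tpoly (ksqs n) (cf a) x)"
      using d[of "ksqs n - {0}"] norm_diff_ineq[of "cf a 0" "tpoly (ksqs n - {0}) (cf a) x"] by simp
    then show ?thesis by (metis of_real_psum norm_of_real)
  qed
  obtain r where "AE x in tM. (\<lambda>j. psum a (r j) x) \<longlonglongrightarrow> RF a x" using RF_AE_psum by blast
  then show ?thesis
  proof eventually_elim
    fix x assume "(\<lambda>j. psum a (r j) x) \<longlonglongrightarrow> RF a x"
    from tendsto_rabs[OF this] have "1 \<le> \<bar>RF a x\<bar>" by (rule LIMSEQ_le_const) (use ge in auto)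
    then show "RF a x \<noteq> 0" by auto
  qed
qed

lemma cf_Mop_cos: "cf (Mop (\<lambda>x. cos (kdot l x)) a) k = (cf a (k - l) + cf a (k + l)) / 2"
  using hat_cos_mult[OF RF(1), of l a] by (simp add: Mop_def cf_shift_op[where B=1] add_divide_distrib)

lemma cf_Mop_sin: "cf (Mop (\<lambda>x. sin (kdot l x)) a) k = - \<i> / 2 * cf a (k - l) + \<i> / 2 * cf a (k + l)"
  using hat_sin_mult[OF RF(1), of l a] by (simp add: Mop_def cf_shift_op[where B=1])

text \<open>Multiplying by the cosine or the sine of frequency \<open>l\<close> puts the real part
  or minus the imaginary part of the \<open>l\<close>-th coefficient into the mean. The bound by two
  shifts keeps the coefficients absolutely summable.\<close>

lemma exists_nonzero_mean:
  assumes "a \<noteq> 0"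
  shows "\<exists>\<phi> l. trig \<phi> \<and> cf (Mop \<phi> a) 0 \<noteq> 0 \<and> (\<forall>k. cmod (cf (Mop \<phi> a) k) \<le> cmod (cf a (k - l)) + cmod (cf a (k + l)))"
proof -
  obtain l where l: "cf a l \<noteq> 0" using assms by (metis hl2_eqI cf_zero)
  show ?thesis
  proof (cases "Re (cf a l) = 0")
    case False
    have "cf (Mop (\<lambda>x. cos (kdot l x)) a) 0 = of_real (Re (cf a l))"
      by (simp add: cf_Mop_cos cf_uminus complex_eq_iff)
    moreover have "cmod (cf (Mop (\<lambda>x. cos (kdot l x)) a) k) \<le> cmod (cf a (k - l)) + cmod (cf a (k + l))" for k
    proof -
      have "cmod (cf (Mop (\<lambda>x. cos (kdot l x)) a) k) = cmod (cf a (k - l) + cf a (k + l)) / 2"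
        by (simp add: cf_Mop_cos norm_divide)
      then show ?thesis using norm_triangle_ineq[of "cf a (k - l)" "cf a (k + l)"] norm_ge_zero[of "cf a (k - l) + cf a (k + l)"] by linarith
    qed
    ultimately show ?thesis using False trig.cos[of l] by (metis of_real_eq_0_iff)
  next
    case True
    have "cf (Mop (\<lambda>x. sin (kdot l x)) a) 0 = of_real (- Im (cf a l))"
      by (simp add: cf_Mop_sin cf_uminus complex_eq_iff)
    moreover have "Im (cf a l) \<noteq> 0" using True l by (simp add: complex_eq_iff)
    moreover have "cmod (cf (Mop (\<lambda>x. sin (kdot l x)) a) k) \<le> cmod (cf a (k - l)) + cmod (cf a (k + l))" for k
    proof -
      have "cmod (cf (Mop (\<lambda>x. sin (kdot l x)) a) k) \<le> cmod (- \<i> / 2 * cf a (k - l)) + cmod (\<i> / 2 * cf a (k + l))"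
        unfolding cf_Mop_sin by (rule norm_triangle_ineq)
      then have "cmod (cf (Mop (\<lambda>x. sin (kdot l x)) a) k) \<le> cmod (cf a (k - l)) / 2 + cmod (cf a (k + l)) / 2"
        by (simp add: norm_mult norm_divide)
      then show ?thesis using norm_ge_zero[of "cf a (k - l)"] norm_ge_zero[of "cf a (k + l)"] by linarith
    qed
    ultimately show ?thesis using trig.sin[of l] by (metis of_real_eq_0_iff neg_equal_0_iff_equal)
  qed
qed

text \<open>Each round multiplies the top coefficient in the parameter \<open>M\<close> by the wave propagator, which
  gains one derivative; once it lies in the Wiener algebra, a last long round makes its zero mode,
  which grows linearly in time, dominate all others.\<close>
lemma reaches_nonvanishing:
  fixes x :: "('d::finite) cstate"
  assumes x: "fst x \<noteq> 0"
  shows "\<exists>T\<ge>0. \<exists>y. reaches T x y \<and> (AE t in tM. RF (NN (fst y)) t \<noteq> 0)"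
proof -
  obtain \<delta> where \<delta>: "\<delta> > 0" "\<And>k::int^'d. wS \<delta> k \<noteq> 0" using exists_injective_time by blast
  \<comment> \<open>As many rounds as \<open>smooth_l1\<close> requires.\<close>
  let ?n = "CARD('d)"
  obtain T z b where T: "T \<ge> 0" "reaches_poly ?n x T z" "fst (z ?n) = (NN ^^ ?n) b" "fst (z ?n) \<noteq> 0"
    using reaches_poly_smooth[OF x \<delta>, of ?n] by blast
  define a where "a = NN (fst (z ?n))"
  obtain C where C: "\<And>F. finite F \<Longrightarrow> (\<Sum>k\<in>F. cmod (cf (fst (z ?n)) k)) \<le> C"
    using smooth_l1[of b] T(3) by auto
  have aC: "(\<Sum>k\<in>F. cmod (cf a k)) \<le> C" if "finite F" for F
  proof -
    have "cmod (cf a k) \<le> cmod (cf (fst (z ?n)) k)" for k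
    proof -
      have "cmod (cf a k) = cmod (cf (fst (z ?n)) k) / lamk k" by (simp add: a_def norm_divide abs_of_pos)
      also have "\<dots> \<le> cmod (cf (fst (z ?n)) k) / 1" by (rule divide_left_mono) (use lamk_ge_1 in auto)
      finally show ?thesis by simp
    qed
    then show ?thesis using C[OF that] sum_mono order_trans by meson
  qed
  have a0: "a \<noteq> 0"
  proof -
    obtain k where "cf (fst (z ?n)) k \<noteq> 0" using T(4) by (metis hl2_eqI cf_zero)
    then have "cf a k \<noteq> 0" by (simp add: a_def)
    then show ?thesis by auto
  qed
  obtain \<phi> l where \<phi>: "trig \<phi>" "cf (Mop \<phi> a) 0 \<noteq> 0"
    "\<And>k. cmod (cf (Mop \<phi> a) k) \<le> cmod (cf a (k - l)) + cmod (cf a (k + l))"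
    using exists_nonzero_mean[OF a0] by blast
  let ?g = "Mop \<phi> a"
  have sh: "(\<Sum>k\<in>F. cmod (cf a (k + m))) \<le> C" if "finite F" for F m
  proof -
    have "(\<Sum>k\<in>F. cmod (cf a (k + m))) = (\<Sum>k\<in>(\<lambda>k. k + m) ` F. cmod (cf a k))"
      by (subst sum.reindex) (auto simp: inj_on_def)
    also have "\<dots> \<le> C" by (rule aC) (simp add: that)
    finally show ?thesis .
  qed
  have gC: "(\<Sum>k\<in>F. cmod (cf ?g k)) \<le> 2 * C" if "finite F" for F
  proof -
    have "(\<Sum>k\<in>F. cmod (cf ?g k)) \<le> (\<Sum>k\<in>F. cmod (cf a (k + (-l))) + cmod (cf a (k + l)))"
      using \<phi>(3) by (intro sum_mono) simp
    also have "\<dots> \<le> C + C" unfolding sum.distrib by (intro add_mono sh that)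
    finally show ?thesis by simp
  qed
  have C0: "0 \<le> C" using aC[of "{}"] by simp
  \<comment> \<open>Chosen so that the zero mode reaches modulus 2 C + 1, one more than the bound
    \<open>2 * C\<close> on the sum of all the others.\<close>
  define \<tau> where "\<tau> = (2 * C + 1) / cmod (cf ?g 0)"
  have \<tau>: "\<tau> > 0" using \<phi>(2) C0 by (simp add: \<tau>_def)
  obtain z' where z': "reaches_poly (Suc ?n) x (T + \<tau>) z'" "z' (Suc ?n) = wv \<tau> (pot \<phi> (z ?n))"
    using reaches_poly_round[OF T(2) \<phi>(1) \<tau>] by blast
  define h where "h = NN (fst (z' (Suc ?n)))"
  have h: "cf h k = of_real (wS \<tau> k) * cf ?g k" for k
    by (simp add: h_def z'(2) wv_def pot_def a_def cf_dg)
  have "AE t in tM. RF h t \<noteq> 0"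
  proof (rule dominant_mode_nonzero)
    fix F :: "(int^'d) set" assume F: "finite F" "0 \<notin> F"
    have "(\<Sum>k\<in>F. cmod (cf h k)) \<le> (\<Sum>k\<in>F. cmod (cf ?g k))"
    proof (rule sum_mono)
      fix k assume "k \<in> F"
      then have k: "k \<noteq> 0" using F by auto
      \<comment> \<open>Nonzero integer frequencies have |k| at least 1, so these modes do not grow
        however long \<open>\<tau>\<close> is.\<close>
      have "\<bar>wS \<tau> k\<bar> \<le> 1"
      proof -
        have "\<bar>wS \<tau> k\<bar> = \<bar>sin (kap k * \<tau>)\<bar> / kap k" using k kap_ge_1[OF k] by (simp add: wS_def abs_divide)
        also have "\<dots> \<le> 1" using kap_ge_1[OF k] order_trans[OF abs_sin_le_one] by (simp add: divide_le_eq_1)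
        finally show ?thesis .
      qed
      then show "cmod (cf h k) \<le> cmod (cf ?g k)" unfolding h norm_mult norm_of_real by (intro mult_left_le_one_le) auto
    qed
    also have "\<dots> \<le> 2 * C" by (rule gC[OF F(1)])
    finally have 1: "(\<Sum>k\<in>F. cmod (cf h k)) \<le> 2 * C" .
    have "cmod (cf h 0) = \<tau> * cmod (cf ?g 0)" unfolding h norm_mult norm_of_real using \<tau> by (simp add: wS_def)
    then have "cmod (cf h 0) = 2 * C + 1" using \<phi>(2) by (simp add: \<tau>_def)
    with 1 show "(\<Sum>k\<in>F. cmod (cf h k)) + 1 \<le> cmod (cf h 0)" by simp
  qed
  define f where "f i = RF (NN (fst (z' i)))" for i
  have fL: "L2T (f i)" for i by (simp add: f_def RF)
  \<comment> \<open>Only the top coefficient is known to be nonvanishing; a generic \<open>M\<close>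
    transfers this to the whole polynomial.\<close>
  have "AE M in lborel. AE t in tM. (\<Sum>i\<le>Suc ?n. M ^ i * f i t) \<noteq> 0"
    by (rule AE_poly_nonzero[OF L2T_measurable[OF fL]]) (use \<open>AE t in tM. RF h t \<noteq> 0\<close> in \<open>simp add: f_def h_def\<close>)
  from AE_lborel_imp_ex[OF this, of 0 1]
  obtain M where M: "AE t in tM. (\<Sum>i\<le>Suc ?n. M ^ i * f i t) \<noteq> 0" by auto
  define y where "y = (\<Sum>i\<le>Suc ?n. M ^ i *\<^sub>R z' i)"
  have "hat (\<lambda>t. \<Sum>i\<le>Suc ?n. M ^ i * f i t) = (\<Sum>i\<le>Suc ?n. M ^ i *\<^sub>R NN (fst (z' i)))"
    by (subst hat_sum) (auto simp: L2T_scale fL hat_scale simp del: sum.atMost_Suc, simp add: f_def)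
  also have "\<dots> = NN (fst y)"
    by (rule hl2_eqI) (simp add: y_def fst_sum cf_sum sum_divide_distrib del: sum.atMost_Suc)
  finally have "AE t in tM. RF (NN (fst y)) t = (\<Sum>i\<le>Suc ?n. M ^ i * f i t)"
    by (intro hat_eq_imp_AE RF(1) L2T_sum L2T_scale fL) simp
  with M have "AE t in tM. RF (NN (fst y)) t \<noteq> 0" by eventually_elim simp
  moreover have "reaches (T + \<tau>) x y" using z'(1) by (simp add: reaches_poly_def y_def)
  moreover have "0 \<le> T + \<tau>" using T(1) \<tau> by simp
  ultimately show ?thesis by blast
qed

text \<open>Three stages add their times: making the position nonzero, making it nonzero almost
  everywhere, and steering from there to any target.\<close>

lemma approx_ctrl_of_nonzero:
  fixes W0 :: "('d::finite) state"
  assumes W0: "H1L2 W0" and nonzero: "\<not> (AE x in lebesgue. fst W0 x = 0 \<and> snd W0 x = 0)"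
  shows "\<exists>T\<ge>0. approx_ctrl T W0"
proof -
  obtain \<delta> where \<delta>: "\<delta> > 0" "\<And>k::int^'d. wS \<delta> k \<noteq> 0" using exists_injective_time by blast
  let ?z = "shat W0"
  have "?z \<noteq> 0"
  proof
    assume "?z = 0"
    then have "hat (fst W0) = 0" "hat (snd W0) = 0"
      using NN_fst_shat[OF W0] bounded_linear.linear[OF bounded_linear_dg[OF mult_sym_N]] linear_0
      by (metis fst_zero, simp add: shat_def zero_prod_def)
    then have "AE x in tM. fst W0 x = 0" "AE x in tM. snd W0 x = 0"
      using hat_eq_imp_AE[OF H1L2_L2T(1)[OF W0] L2T_zero] hat_eq_imp_AE[OF H1L2_L2T(2)[OF W0] L2T_zero]
      by (simp_all add: hat_zero)
    then have "AE x in lebesgue. fst W0 x = 0" "AE x in lebesgue. snd W0 x = 0"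
      using AE_tM_imp_AE_lebesgue H1L2_L2T[OF W0] by (auto simp: L2T_iff)
    with nonzero show False by auto
  qed
  \<comment> \<open>If the position vanishes, some velocity mode does not, and the wave flow for
    time \<open>\<delta>\<close> moves every velocity mode into the position.\<close>
  have "\<exists>T0\<ge>0. \<exists>x. reaches T0 ?z x \<and> fst x \<noteq> 0"
  proof (cases "fst ?z = 0")
    case False
    then show ?thesis using reaches_refl by blast
  next
    case True
    then have "snd ?z \<noteq> 0" using \<open>?z \<noteq> 0\<close> by (simp add: prod_eq_iff)
    then obtain k where k: "cf (snd ?z) k \<noteq> 0" by (metis hl2_eqI cf_zero)
    have "cf (fst (wv \<delta> ?z)) k = of_real (lamk k * wS \<delta> k) * cf (snd ?z) k"
      using True by (simp add: wv_def cf_dg)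
    then have "cf (fst (wv \<delta> ?z)) k \<noteq> 0" using k \<delta>(2)[of k] by simp
    then have "fst (wv \<delta> ?z) \<noteq> 0" by auto
    then show ?thesis using reaches_wv[OF \<delta>(1)] \<delta>(1) less_imp_le by blast
  qed
  then obtain T0 x where x: "T0 \<ge> 0" "reaches T0 ?z x" "fst x \<noteq> 0" by blast
  obtain T1 y where y: "T1 \<ge> 0" "reaches T1 x y" "AE t in tM. RF (NN (fst y)) t \<noteq> 0"
    using reaches_nonvanishing[OF x(3)] by blast
  have "reaches \<delta> y w" for w
    using reaches_everything[OF y(3) \<delta>, of "snd y" "fst w" "snd w"] by simp
  then have "reaches (T0 + T1 + \<delta>) ?z w" for w
    using reaches_trans[OF reaches_trans[OF x(2) y(2)]] by blast
  then have "approx_ctrl (T0 + T1 + \<delta>) W0" by (rule approx_ctrl_of_reaches[OF W0])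
  then show ?thesis using x(1) y(1) \<delta>(1) by (intro exI[of _ "T0 + T1 + \<delta>"]) auto
qed

theorem mainTheorem5:
  fixes W0 :: "'d::finite state"
  assumes d3: "CARD('d) \<ge> 3"
    and W0: "H1L2 W0"
    and nonzero: "\<not> (AE x in lebesgue. fst W0 x = 0 \<and> snd W0 x = 0)"
    and cases:
      "((AE x in lebesgue. fst W0 x = 0) \<and>
          (\<exists>s. s > real CARD('d) / 2 - 1 \<and> HsT s (snd W0)) \<and>
          ((AE x in lebesgue. snd W0 x \<ge> 0) \<or> (AE x in lebesgue. snd W0 x \<le> 0)))
       \<or> ((AE x in lebesgue. (fst W0 x = 0 \<longleftrightarrow> (fst W0 x = 0 \<and> snd W0 x = 0))) \<and>
          (closed_zero_set W0 \<or> CARD('d) = 3))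
       \<or> (HsT 1 (snd W0) \<and> (closed_zero_set W0 \<or> CARD('d) = 3))"
  shows "ctrl_time W0 < \<infinity>"
proof -
  obtain T where T: "T \<ge> 0" "approx_ctrl T W0" using approx_ctrl_of_nonzero[OF W0 nonzero] by blast
  then have "ctrl_time W0 \<le> ereal T" unfolding ctrl_time_def by (intro Inf_lower) auto
  also have "\<dots> < \<infinity>" by simp
  finally show ?thesis .
qed

end
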